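(* For each real $a>0$ and each $\nu\in\mathbb{N}$, $\nu\geq 1$, the set $$\{H \in X_a^\nu \mid (e^{tH})_{t\geq 0} \text{ is stable but not exponentially stable}\}$$ is a dense $G_\delta$ set in the metric space $(X_a^\nu,d)$.
   Context: Fix $a>0$ and $\nu\in\mathbb{N}$. For a (bounded) Borel function $V:\mathbb{R}^\nu\to\mathbb{R}$ with $-a\leq V(x)\leq 0$ for every $x\in\mathbb{R}^\nu$, let $H_V$ be the negative self-adjoint Schrödinger operator on the complex Hilbert space $\mathrm{L}^2(\mathbb{R}^\nu)$ with domain the Sobolev space $\mathcal{H}^2(\mathbb{R}^\nu)$ and action $(H_Vu)(x)=\triangle u(x)+V(x)u(x)$, where $\triangle$ is the Laplacian. $X_a^\nu$ denotes the set of all such operators $H_V$ (indexed by the functions $V$), endowed with the metric $$d(H_V,H_U):=\sum_{j=0}^\infty \min\bigl(2^{-j},\|V-U\|_j\bigr),\qquad \|V-U\|_j:=\sup_{x\in B(0,j)}|V(x)-U(x)|,$$ where $B(0,j)$ is the open Euclidean ball of radius $j$ centered at $0$ (the supremum over the empty ball $B(0,0)$ is taken to be $0$). The functions $V$ are functions defined pointwise, and functions that differ at some point index different elements of $X_a^\nu$. A self-adjoint operator $A$ is called negative if $A\leq 0$, i.e. $\sigma(A)\subset(-\infty,0]$. Such an $A$ on a Hilbert space $\mathcal{H}$ generates the $C_0$-semigroup of contractions $(e^{tA})_{t\geq 0}$ defined by the functional calculus. A $C_0$-semigroup $(T(t))_{t\geq 0}$ on $\mathcal{H}$ is stable if $\lim_{t\to\infty}\|T(t)x\|_{\mathcal{H}}=0$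 for every $x\in\mathcal{H}$; it is exponentially stable if there exist constants $C>0$ and $c>0$ such that $\|T(t)\|_{\mathcal{B}(\mathcal{H})}\leq Ce^{-tc}$ for every $t\geq 0$. *)

theory Defs
  imports "HOL-Analysis.Analysis"
begin

section \<open>The complex Hilbert space of square-integrable functions on Euclidean space\<close>

definition square_integrable :: "(real ^ 'n::finite \<Rightarrow> complex) \<Rightarrow> bool" where
  "square_integrable f \<longleftrightarrow>
     f \<in> borel_measurable borel \<and> integrable lborel (\<lambda>x. (cmod (f x))\<^sup>2)"

lemma borel_measurable_cnj [measurable (raw)]:
  "f \<in> borel_measurable M \<Longrightarrow> (\<lambda>x. cnj (f x)) \<in> borel_measurable M"
  by (rule borel_measurable_continuous_on) (intro continuous_intros)

lemma square_integrable_zero: "square_integrable (\<lambda>_. 0)"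
  by (simp add: square_integrable_def)

lemma square_integrable_scale:
  assumes "square_integrable f" shows "square_integrable (\<lambda>x. c * f x)"
  using assms by (auto simp: square_integrable_def norm_mult power_mult_distrib)

lemma square_integrable_uminus:
  "square_integrable f \<Longrightarrow> square_integrable (\<lambda>x. - f x)"
  using square_integrable_scale[of f "-1"] by simp

lemma square_integrable_add:
  assumes "square_integrable f" "square_integrable g"
  shows "square_integrable (\<lambda>x. f x + g x)"
proof -
  have [measurable]: "f \<in> borel_measurable borel" "g \<in> borel_measurable borel"
    using assms by (auto simp: square_integrable_def)
  have "integrable lborel (\<lambda>x. (cmod (f x + g x))\<^sup>2)"
  proof (rule Bochner_Integration.integrable_bound)
    show "integrable lborel (\<lambda>x. 2 * (cmod (f x))\<^sup>2 + 2 * (cmod (g x))\<^sup>2)"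
      using assms by (simp add: square_integrable_def)
    show "(\<lambda>x. (cmod (f x + g x))\<^sup>2) \<in> borel_measurable lborel"
      by measurable
    have "norm ((cmod (f x + g x))\<^sup>2) \<le> norm (2 * (cmod (f x))\<^sup>2 + 2 * (cmod (g x))\<^sup>2)" for x
    proof -
      have "(cmod (f x + g x))\<^sup>2 \<le> (cmod (f x) + cmod (g x))\<^sup>2"
        by (intro power_mono norm_triangle_ineq norm_ge_zero)
      also have "\<dots> \<le> 2 * (cmod (f x))\<^sup>2 + 2 * (cmod (g x))\<^sup>2"
        using sum_squares_bound[of "cmod (f x)" "cmod (g x)"] unfolding power2_sum by linarith
      finally show ?thesis by simp
    qed
    then show "AE x in lborel. norm ((cmod (f x + g x))\<^sup>2) \<le>
        norm (2 * (cmod (f x))\<^sup>2 + 2 * (cmod (g x))\<^sup>2)"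
      by (rule AE_I2)
  qed
  then show ?thesis by (simp add: square_integrable_def)
qed

lemma square_integrable_cnj_mult:
  assumes "square_integrable f" "square_integrable g"
  shows "integrable lborel (\<lambda>x. cnj (f x) * g x)"
proof (rule Bochner_Integration.integrable_bound)
  have [measurable]: "f \<in> borel_measurable borel" "g \<in> borel_measurable borel"
    using assms by (auto simp: square_integrable_def)
  show "(\<lambda>x. cnj (f x) * g x) \<in> borel_measurable lborel"
    by measurable
  show "integrable lborel (\<lambda>x. (cmod (f x))\<^sup>2 + (cmod (g x))\<^sup>2)"
    using assms by (simp add: square_integrable_def)
  have "cmod (cnj (f x) * g x) \<le> norm ((cmod (f x))\<^sup>2 + (cmod (g x))\<^sup>2)" for x
  proof -
    have "2 * (cmod (f x) * cmod (g x)) \<le> (cmod (f x))\<^sup>2 + (cmod (g x))\<^sup>2"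
      using sum_squares_bound[of "cmod (f x)" "cmod (g x)"] by (simp add: mult.assoc)
    moreover have "0 \<le> cmod (f x) * cmod (g x)" by simp
    ultimately have "cmod (f x) * cmod (g x) \<le> (cmod (f x))\<^sup>2 + (cmod (g x))\<^sup>2"
      by linarith
    then show ?thesis by (simp add: norm_mult)
  qed
  then show "AE x in lborel. norm (cnj (f x) * g x) \<le> norm ((cmod (f x))\<^sup>2 + (cmod (g x))\<^sup>2)"
    by (rule AE_I2)
qed

definition L2_eq :: "(real ^ 'n::finite \<Rightarrow> complex) \<Rightarrow> (real ^ 'n \<Rightarrow> complex) \<Rightarrow> bool" where
  "L2_eq f g \<longleftrightarrow> square_integrable f \<and> square_integrable g \<and> (AE x in lborel. f x = g x)"

lemma L2_eq_scale: "L2_eq f g \<Longrightarrow> L2_eq (\<lambda>x. c * f x) (\<lambda>x. c * g x)"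
  by (auto simp: L2_eq_def intro: square_integrable_scale)

quotient_type (overloaded) 'n L2 = "real ^ 'n::finite \<Rightarrow> complex" / partial: L2_eq
proof (rule part_equivpI)
  show "\<exists>f::real ^ 'n \<Rightarrow> complex. L2_eq f f"
    by (rule exI[of _ "\<lambda>_. 0"]) (simp add: L2_eq_def square_integrable_zero)
  show "symp (L2_eq :: (real ^ 'n \<Rightarrow> complex) \<Rightarrow> _)"
    by (rule sympI) (auto simp: L2_eq_def)
  show "transp (L2_eq :: (real ^ 'n \<Rightarrow> complex) \<Rightarrow> _)"
    by (rule transpI) (auto simp: L2_eq_def)
qed

lift_definition scaleC :: "complex \<Rightarrow> 'n::finite L2 \<Rightarrow> 'n L2" is "\<lambda>c f x. c * f x"
  by (rule L2_eq_scale)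

lift_definition cinner :: "'n::finite L2 \<Rightarrow> 'n L2 \<Rightarrow> complex" is
  "\<lambda>f g. LINT x|lborel. cnj (f x) * g x"
proof -
  fix f1 f2 g1 g2 :: "real ^ 'n \<Rightarrow> complex"
  assume *: "L2_eq f1 f2" "L2_eq g1 g2"
  then have [measurable]: "f1 \<in> borel_measurable borel" "f2 \<in> borel_measurable borel"
      "g1 \<in> borel_measurable borel" "g2 \<in> borel_measurable borel"
    by (auto simp: L2_eq_def square_integrable_def)
  show "(LINT x|lborel. cnj (f1 x) * g1 x) = (LINT x|lborel. cnj (f2 x) * g2 x)"
    using * by (intro integral_cong_AE) (auto simp: L2_eq_def)
qed

instantiation L2 :: (finite) real_vector
begin

lift_definition zero_L2 :: "'a L2" is "\<lambda>_. 0"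
  by (simp add: L2_eq_def square_integrable_zero)

lift_definition plus_L2 :: "'a L2 \<Rightarrow> 'a L2 \<Rightarrow> 'a L2" is "\<lambda>f g x. f x + g x"
  by (auto simp: L2_eq_def intro: square_integrable_add)

lift_definition uminus_L2 :: "'a L2 \<Rightarrow> 'a L2" is "\<lambda>f x. (-1) * f x"
  by (rule L2_eq_scale)

definition minus_L2 :: "'a L2 \<Rightarrow> 'a L2 \<Rightarrow> 'a L2" where
  "minus_L2 u v = u + (- v)"

definition scaleR_L2 :: "real \<Rightarrow> 'a L2 \<Rightarrow> 'a L2" where
  "scaleR_L2 r u = scaleC (complex_of_real r) u"

instance
proof
  fix u v w :: "'a L2" and r s :: real
  show "u + v + w = u + (v + w)"
    by transfer (auto simp: L2_eq_def add.assoc intro!: square_integrable_add)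
  show "u + v = v + u"
    by transfer (auto simp: L2_eq_def add.commute intro!: square_integrable_add)
  show "0 + u = u"
    by transfer (auto simp: L2_eq_def)
  show "- u + u = 0"
    by transfer
       (auto simp: L2_eq_def intro!: square_integrable_add square_integrable_zero square_integrable_uminus)
  show "u - v = u + - v"
    by (simp add: minus_L2_def)
  show "r *\<^sub>R (u + v) = r *\<^sub>R u + r *\<^sub>R v"
    unfolding scaleR_L2_def
    by transfer (auto simp: L2_eq_def distrib_left intro!: square_integrable_add square_integrable_scale)
  show "(r + s) *\<^sub>R u = r *\<^sub>R u + s *\<^sub>R u"
    unfolding scaleR_L2_def
    by transfer (auto simp: L2_eq_def distrib_right intro!: square_integrable_add square_integrable_scale)
  show "r *\<^sub>R s *\<^sub>R u = (r * s) *\<^sub>R u"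
    unfolding scaleR_L2_def
    by transfer (auto simp: L2_eq_def mult.assoc intro!: square_integrable_scale)
  show "1 *\<^sub>R u = u"
    unfolding scaleR_L2_def by transfer (auto simp: L2_eq_def)
qed

end

instantiation L2 :: (finite) real_inner
begin

definition inner_L2 :: "'a L2 \<Rightarrow> 'a L2 \<Rightarrow> real" where
  "inner_L2 u v = Re (cinner u v)"

definition norm_L2 :: "'a L2 \<Rightarrow> real" where
  "norm_L2 u = sqrt (inner u u)"

definition sgn_L2 :: "'a L2 \<Rightarrow> 'a L2" where
  "sgn_L2 u = u /\<^sub>R norm u"

definition dist_L2 :: "'a L2 \<Rightarrow> 'a L2 \<Rightarrow> real" where
  "dist_L2 u v = norm (u - v)"

definition uniformity_L2 :: "('a L2 \<times> 'a L2) filter" where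
  "uniformity_L2 = (INF e\<in>{0 <..}. principal {(u, v). dist u v < e})"

definition open_L2 :: "'a L2 set \<Rightarrow> bool" where
  "open_L2 U \<longleftrightarrow> (\<forall>u\<in>U. eventually (\<lambda>(u', v). u' = u \<longrightarrow> v \<in> U) uniformity)"

instance
proof
  fix u v w :: "'a L2" and r :: real
  show "dist u v = norm (u - v)" by (simp add: dist_L2_def)
  show "sgn u = u /\<^sub>R norm u" by (simp add: sgn_L2_def)
  show "uniformity = (INF e\<in>{0 <..}. principal {(u, v). dist (u::'a L2) v < e})"
    by (simp add: uniformity_L2_def)
  show "open U \<longleftrightarrow> (\<forall>u\<in>U. \<forall>\<^sub>F (u', v) in uniformity. u' = u \<longrightarrow> v \<in> U)" for U :: "'a L2 set"
    by (simp add: open_L2_def)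
  show "norm u = sqrt (inner u u)" by (simp add: norm_L2_def)
  show "inner u v = inner v u"
    unfolding inner_L2_def
  proof transfer
    fix f g :: "real ^ 'a \<Rightarrow> complex"
    assume "L2_eq f f" "L2_eq g g"
    then have "integrable lborel (\<lambda>x. cnj (f x) * g x)" "integrable lborel (\<lambda>x. cnj (g x) * f x)"
      by (auto simp: L2_eq_def intro!: square_integrable_cnj_mult)
    then show "Re (LINT x|lborel. cnj (f x) * g x) = Re (LINT x|lborel. cnj (g x) * f x)"
      by (simp flip: integral_Re add: mult.commute)
  qed
  show "inner (u + v) w = inner u w + inner v w"
    unfolding inner_L2_def
  proof transfer
    fix f g h :: "real ^ 'a \<Rightarrow> complex"
    assume "L2_eq f f" "L2_eq g g" "L2_eq h h"
    then have "integrable lborel (\<lambda>x. cnj (f x) * h x)" "integrable lborel (\<lambda>x. cnj (g x) * h x)"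
      by (auto simp: L2_eq_def intro!: square_integrable_cnj_mult)
    then show "Re (LINT x|lborel. cnj (f x + g x) * h x) =
        Re (LINT x|lborel. cnj (f x) * h x) + Re (LINT x|lborel. cnj (g x) * h x)"
      by (simp add: distrib_right)
  qed
  show "inner (r *\<^sub>R u) v = r * inner u v"
    unfolding inner_L2_def scaleR_L2_def
    by transfer (simp add: mult.assoc)
  have sq: "Re (LINT x|lborel. cnj (f x) * f x) = (LINT x|lborel. (cmod (f x))\<^sup>2)"
    if "square_integrable f" for f :: "real ^ 'a \<Rightarrow> complex"
    using square_integrable_cnj_mult[OF that that]
    by (simp flip: integral_Re add: cmod_def power2_eq_square)
  show "0 \<le> inner u u"
    unfolding inner_L2_def by transfer (simp add: sq L2_eq_def)
  show "inner u u = 0 \<longleftrightarrow> u = 0"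
    unfolding inner_L2_def
  proof transfer
    fix f :: "real ^ 'a \<Rightarrow> complex"
    assume "L2_eq f f"
    then have f: "square_integrable f" by (simp add: L2_eq_def)
    have "(LINT x|lborel. (cmod (f x))\<^sup>2) = 0 \<longleftrightarrow> (AE x in lborel. (cmod (f x))\<^sup>2 = 0)"
      using f by (intro integral_nonneg_eq_0_iff_AE) (auto simp: square_integrable_def)
    then show "Re (LINT x|lborel. cnj (f x) * f x) = 0 \<longleftrightarrow> L2_eq f (\<lambda>_. 0)"
      using f by (simp add: sq L2_eq_def square_integrable_zero)
  qed
qed

end

section \<open>Spectral measures and functional calculus\<close>

text \<open>
  An unbounded linear operator is given by its domain \<open>D\<close> and a function \<open>A\<close> of which only the
  values on \<open>D\<close> matter.
\<close>

definition linear_operator_on :: "'n::finite L2 set \<Rightarrow> ('n L2 \<Rightarrow> 'n L2) \<Rightarrow> bool" where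
  "linear_operator_on D A \<longleftrightarrow>
     0 \<in> D \<and>
     (\<forall>u\<in>D. \<forall>v\<in>D. u + v \<in> D \<and> A (u + v) = A u + A v) \<and>
     (\<forall>c. \<forall>u\<in>D. scaleC c u \<in> D \<and> A (scaleC c u) = scaleC c (A u))"

definition orthogonal_projection :: "('n::finite L2 \<Rightarrow> 'n L2) \<Rightarrow> bool" where
  "orthogonal_projection P \<longleftrightarrow>
     linear_operator_on UNIV P \<and> (\<forall>u. P (P u) = P u) \<and> (\<forall>u v. cinner u (P v) = cinner (P u) v)"

definition projection_valued_measure :: "(real set \<Rightarrow> 'n::finite L2 \<Rightarrow> 'n L2) \<Rightarrow> bool" where
  "projection_valued_measure E \<longleftrightarrow>
     (\<forall>B\<in>sets borel. orthogonal_projection (E B)) \<and>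
     E {} = (\<lambda>u. 0) \<and> E UNIV = (\<lambda>u. u) \<and>
     (\<forall>B\<in>sets borel. \<forall>C\<in>sets borel. E (B \<inter> C) = E B \<circ> E C) \<and>
     (\<forall>B :: nat \<Rightarrow> real set. range B \<subseteq> sets borel \<longrightarrow> disjoint_family B \<longrightarrow>
        (\<forall>u. (\<lambda>n. E (B n) u) sums E (\<Union>n. B n) u))"

text \<open>The measure \<open>B \<mapsto> \<langle>u, E(B)u\<rangle>\<close>; on the complex space \<open>L2\<close>, \<open>inner\<close> is the real part of
  \<open>cinner\<close>, and \<open>\<langle>u, E(B)u\<rangle>\<close> is real and nonnegative.\<close>

definition scalar_measure ::
    "(real set \<Rightarrow> 'n::finite L2 \<Rightarrow> 'n L2) \<Rightarrow> 'n L2 \<Rightarrow> real measure" where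
  "scalar_measure E u = measure_of UNIV (sets borel) (\<lambda>B. ennreal (inner u (E B u)))"

definition spectral_integral_domain ::
    "(real set \<Rightarrow> 'n::finite L2 \<Rightarrow> 'n L2) \<Rightarrow> (real \<Rightarrow> real) \<Rightarrow> 'n L2 set" where
  "spectral_integral_domain E g = {u. integrable (scalar_measure E u) (\<lambda>s. (g s)\<^sup>2)}"

text \<open>
  The operator \<open>(D, A)\<close> is \<open>\<integral> g dE\<close>. By polarization, the quadratic form determines the linear
  operator on its (dense) domain.
\<close>

definition has_spectral_integral ::
    "(real set \<Rightarrow> 'n::finite L2 \<Rightarrow> 'n L2) \<Rightarrow> (real \<Rightarrow> real) \<Rightarrow>
     'n L2 set \<Rightarrow> ('n L2 \<Rightarrow> 'n L2) \<Rightarrow> bool" where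
  "has_spectral_integral E g D A \<longleftrightarrow>
     D = spectral_integral_domain E g \<and> linear_operator_on D A \<and>
     (\<forall>u\<in>D. cinner u (A u) = complex_of_real (LINT s|scalar_measure E u. g s))"

text \<open>
  For self-adjoint \<open>(D, A)\<close> the spectral theorem provides such an \<open>E\<close>, unique on Borel sets (its
  values on other sets are irrelevant, whence \<open>SOME\<close> rather than \<open>THE\<close>).
\<close>

definition spectral_measure ::
    "'n::finite L2 set \<Rightarrow> ('n L2 \<Rightarrow> 'n L2) \<Rightarrow> real set \<Rightarrow> 'n L2 \<Rightarrow> 'n L2" where
  "spectral_measure D A =
     (SOME E. projection_valued_measure E \<and> has_spectral_integral E (\<lambda>s. s) D A)"

text \<open>\<open>g(A)\<close>, determined on \<open>spectral_integral_domain (spectral_measure D A) g\<close>.\<close>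

definition functional_calculus ::
    "'n::finite L2 set \<Rightarrow> ('n L2 \<Rightarrow> 'n L2) \<Rightarrow> (real \<Rightarrow> real) \<Rightarrow> 'n L2 \<Rightarrow> 'n L2" where
  "functional_calculus D A g =
     (let E = spectral_measure D A in
      SOME T. has_spectral_integral E g (spectral_integral_domain E g) T)"

definition exp_semigroup ::
    "'n::finite L2 set \<Rightarrow> ('n L2 \<Rightarrow> 'n L2) \<Rightarrow> real \<Rightarrow> 'n L2 \<Rightarrow> 'n L2" where
  "exp_semigroup D A t = functional_calculus D A (\<lambda>s. exp (t * s))"

section \<open>Stability of operator semigroups\<close>

definition stable_semigroup :: "(real \<Rightarrow> 'a::real_normed_vector \<Rightarrow> 'a) \<Rightarrow> bool" where
  "stable_semigroup T \<longleftrightarrow> (\<forall>u. ((\<lambda>t. norm (T t u)) \<longlongrightarrow> 0) at_top)"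

definition exponentially_stable_semigroup :: "(real \<Rightarrow> 'a::real_normed_vector \<Rightarrow> 'a) \<Rightarrow> bool" where
  "exponentially_stable_semigroup T \<longleftrightarrow>
     (\<exists>C>0. \<exists>c>0. \<forall>t\<ge>0. bounded_linear (T t) \<and> onorm (T t) \<le> C * exp (- t * c))"

section \<open>Sobolev spaces\<close>

definition partial_deriv :: "'n::finite \<Rightarrow> (real ^ 'n \<Rightarrow> complex) \<Rightarrow> real ^ 'n \<Rightarrow> complex" where
  "partial_deriv i f x = frechet_derivative f (at x) (axis i 1)"

text \<open>Multi-indices are lists of coordinate directions, so \<open>length\<close> is the order.\<close>

primrec iterated_partial ::
    "'n::finite list \<Rightarrow> (real ^ 'n \<Rightarrow> complex) \<Rightarrow> real ^ 'n \<Rightarrow> complex" where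
  "iterated_partial [] f = f"
| "iterated_partial (i # \<alpha>) f = partial_deriv i (iterated_partial \<alpha> f)"

definition test_function :: "(real ^ 'n::finite \<Rightarrow> complex) \<Rightarrow> bool" where
  "test_function \<phi> \<longleftrightarrow>
     (\<forall>\<alpha>. iterated_partial \<alpha> \<phi> differentiable_on UNIV) \<and> compact (closure {x. \<phi> x \<noteq> 0})"

definition weak_derivative :: "'n::finite list \<Rightarrow> 'n L2 \<Rightarrow> 'n L2 \<Rightarrow> bool" where
  "weak_derivative \<alpha> u v \<longleftrightarrow>
     (\<forall>\<phi>. test_function \<phi> \<longrightarrow>
        (LINT x|lborel. rep_L2 u x * iterated_partial \<alpha> \<phi> x) =
        (- 1) ^ length \<alpha> * (LINT x|lborel. rep_L2 v x * \<phi> x))"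

definition sobolev :: "nat \<Rightarrow> 'n::finite L2 set" where
  "sobolev k = {u. \<forall>\<alpha>. length \<alpha> \<le> k \<longrightarrow> (\<exists>v. weak_derivative \<alpha> u v)}"

definition laplacian :: "'n::finite L2 \<Rightarrow> 'n L2" where
  "laplacian u = (\<Sum>i\<in>UNIV. (THE v. weak_derivative [i, i] u v))"

section \<open>Schroedinger operators and the metric space of potentials\<close>

definition potentials :: "real \<Rightarrow> (real ^ 'n::finite \<Rightarrow> real) set" where
  "potentials a = {V \<in> borel_measurable borel. \<forall>x. - a \<le> V x \<and> V x \<le> 0}"

definition mult_operator :: "(real ^ 'n::finite \<Rightarrow> real) \<Rightarrow> 'n L2 \<Rightarrow> 'n L2" where
  "mult_operator V u = abs_L2 (\<lambda>x. complex_of_real (V x) * rep_L2 u x)"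

text \<open>The action of \<open>H\<^sub>V\<close>, whose domain is \<open>sobolev 2\<close>.\<close>

definition schroedinger :: "(real ^ 'n::finite \<Rightarrow> real) \<Rightarrow> 'n L2 \<Rightarrow> 'n L2" where
  "schroedinger V u = laplacian u + mult_operator V u"

definition schroedinger_semigroup ::
    "(real ^ 'n::finite \<Rightarrow> real) \<Rightarrow> real \<Rightarrow> 'n L2 \<Rightarrow> 'n L2" where
  "schroedinger_semigroup V = exp_semigroup (sobolev 2) (schroedinger V)"

text \<open>
  As operators on \<open>L2\<close>, \<open>H\<^sub>V\<close> only depends on \<open>V\<close> up to null sets, but the space of Schroedinger
  operators is the family indexed by the pointwise defined functions \<open>V\<close>. Its carrier is therefore
  the index set \<open>potentials a\<close>. The suprema are taken in the extended nonnegative reals, where the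
  supremum over the empty ball is \<open>0\<close>.
\<close>

definition local_sup_dist ::
    "nat \<Rightarrow> (real ^ 'n::finite \<Rightarrow> real) \<Rightarrow> (real ^ 'n \<Rightarrow> real) \<Rightarrow> ennreal" where
  "local_sup_dist j V U = (SUP x\<in>ball 0 (real j). ennreal \<bar>V x - U x\<bar>)"

definition potential_dist ::
    "(real ^ 'n::finite \<Rightarrow> real) \<Rightarrow> (real ^ 'n \<Rightarrow> real) \<Rightarrow> real" where
  "potential_dist V U = (\<Sum>j. enn2real (min (ennreal ((1 / 2) ^ j)) (local_sup_dist j V U)))"

lemma potential_dist_term:
  "0 \<le> enn2real (min (ennreal ((1 / 2) ^ j)) z)"
  "enn2real (min (ennreal ((1 / 2) ^ j)) z) \<le> (1 / 2) ^ j"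
  by (auto intro!: enn2real_leI)

lemma summable_potential_dist:
  "summable (\<lambda>j. enn2real (min (ennreal ((1 / 2) ^ j)) (local_sup_dist j V U)))"
  by (rule summable_comparison_test'[of "\<lambda>j. (1 / 2 :: real) ^ j" 0])
     (use potential_dist_term in \<open>auto simp: summable_geometric\<close>)

lemma Metric_space_potentials: "Metric_space (potentials a :: (real ^ 'n::finite \<Rightarrow> real) set) potential_dist"
proof
  fix U V W :: "real ^ 'n \<Rightarrow> real"
  show "0 \<le> potential_dist V U"
    unfolding potential_dist_def by (intro suminf_nonneg summable_potential_dist) simp
  show "potential_dist V U = potential_dist U V"
    by (simp add: potential_dist_def local_sup_dist_def abs_minus_commute)
  show "potential_dist V U = 0 \<longleftrightarrow> V = U"
  proof
    assume "potential_dist V U = 0"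
    then have *: "enn2real (min (ennreal ((1 / 2) ^ j)) (local_sup_dist j V U)) = 0" for j
      unfolding potential_dist_def
      by (subst (asm) suminf_eq_zero_iff[OF summable_potential_dist]) auto
    show "V = U"
    proof
      fix x :: "real ^ 'n"
      obtain j :: nat where j: "norm x < real j" using reals_Archimedean2 by blast
      have "min (ennreal ((1 / 2) ^ j)) (local_sup_dist j V U) = 0"
        using *[of j] by (auto simp: enn2real_eq_0_iff min_def split: if_splits)
      then have "local_sup_dist j V U = 0"
        by (auto simp: min_def split: if_splits)
      moreover have "ennreal \<bar>V x - U x\<bar> \<le> local_sup_dist j V U"
        unfolding local_sup_dist_def using j by (intro SUP_upper) auto
      ultimately show "V x = U x" by (simp add: ennreal_eq_0_iff)
    qed
  next
    assume "V = U"
    have "local_sup_dist j U U = 0" for j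
      by (simp add: local_sup_dist_def bot_ennreal SUP_constant)
    then show "potential_dist V U = 0"
      using \<open>V = U\<close> by (simp add: potential_dist_def)
  qed
  show "potential_dist U W \<le> potential_dist U V + potential_dist V W"
  proof -
    let ?t = "\<lambda>j U W. enn2real (min (ennreal ((1 / 2) ^ j)) (local_sup_dist j U W))"
    have "?t j U W \<le> ?t j U V + ?t j V W" for j
    proof -
      let ?m = "\<lambda>z. min (ennreal ((1 / 2) ^ j)) z"
      have fin: "?m z < top" for z by (simp add: min_less_iff_disj)
      have "local_sup_dist j U W \<le> local_sup_dist j U V + local_sup_dist j V W"
        unfolding local_sup_dist_def
      proof (rule SUP_least)
        fix x :: "real ^ 'n" assume x: "x \<in> ball 0 (real j)"
        have "ennreal \<bar>U x - W x\<bar> \<le> ennreal \<bar>U x - V x\<bar> + ennreal \<bar>V x - W x\<bar>"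
          by (simp flip: ennreal_plus add: ennreal_leI)
        also have "\<dots> \<le> (SUP x\<in>ball 0 (real j). ennreal \<bar>U x - V x\<bar>) +
            (SUP x\<in>ball 0 (real j). ennreal \<bar>V x - W x\<bar>)"
          using x by (intro add_mono SUP_upper)
        finally show "ennreal \<bar>U x - W x\<bar> \<le> \<dots>" .
      qed
      moreover have "?m z \<le> ?m x + ?m y" if "z \<le> x + y" for x y z :: ennreal
      proof (cases "x \<le> ennreal ((1 / 2) ^ j) \<and> y \<le> ennreal ((1 / 2) ^ j)")
        case True
        then show ?thesis using that by (simp add: min_absorb2 min.coboundedI2)
      next
        case False
        then have "ennreal ((1 / 2) ^ j) \<le> ?m x + ?m y"
          by (auto simp: min_def add_increasing add_increasing2)
        then show ?thesis using min.coboundedI1 by blast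
      qed
      ultimately have "?m (local_sup_dist j U W) \<le>
          ?m (local_sup_dist j U V) + ?m (local_sup_dist j V W)" by blast
      then have "?t j U W \<le> enn2real (?m (local_sup_dist j U V) + ?m (local_sup_dist j V W))"
        using fin by (intro enn2real_mono) auto
      also have "\<dots> = ?t j U V + ?t j V W"
        using fin by (intro enn2real_plus)
      finally show ?thesis .
    qed
    then show ?thesis
      unfolding potential_dist_def
      by (subst suminf_add[OF summable_potential_dist summable_potential_dist])
         (intro suminf_le summable_potential_dist summable_add)
  qed
qed

definition potential_topology :: "real \<Rightarrow> (real ^ 'n::finite \<Rightarrow> real) topology" where
  "potential_topology a = Metric_space.mtopology (potentials a) potential_dist"

end

theory Submission
  imports Defs "HOL-Probability.Helly_Selection" "HOL-Computational_Algebra.Polynomial"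
begin

text \<open>Write \<open>H\<^sub>V = \<triangle> + V\<close>. Its quadratic form on the Sobolev space of order 2 is
\<open>\<langle>u, H\<^sub>V u\<rangle> = - \<parallel>\<nabla>u\<parallel>\<^sup>2 + \<integral> V \<bar>u\<bar>\<^sup>2\<close>, a sum of two nonpositive terms. Both properties of the semigroup
are read off from this form.

Stability holds for every potential. By dominated convergence \<open>\<parallel>exp (t H\<^sub>V) u\<parallel>\<^sup>2 = \<integral> exp (2 t s) d\<nu>\<^sub>u\<close>
tends to the mass that the spectral measure \<open>\<nu>\<^sub>u\<close> gives to 0, the squared norm of the projection of
\<open>u\<close> onto the kernel of \<open>H\<^sub>V\<close>. A vector of the kernel has zero gradient, hence is invariant under
translations, hence is 0 (lemma \<open>constant_weakly_imp_zero\<close>).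

Exponential stability is equivalent to a gap: \<open>\<langle>u, H\<^sub>V u\<rangle> \<le> - c \<parallel>u\<parallel>\<^sup>2\<close> for some \<open>c > 0\<close> and all
\<open>u\<close> in the domain (lemma \<open>exponentially_stable_iff\<close>). So the set of the theorem is the intersection
over \<open>n\<close> of the sets \<open>gap_fails a n\<close> of potentials for which the gap \<open>1 / (n + 1)\<close> fails. Each is
open: convergence in the metric is in particular pointwise, so by dominated convergence the form at a
fixed \<open>u\<close> is continuous in \<open>V\<close>. The intersection is dense, because a potential \<open>V\<close> that is replaced
by 0 outside a large ball moves by little in the metric, and belongs to every \<open>gap_fails a n\<close>: a bump
that lives far away and is spread over a length \<open>L\<close> does not see the truncated potential, and its form
is of order \<open>L\<^sup>-\<^sup>2\<close> times its squared norm.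

Most of the text constructs the objects of this argument. The operator \<open>H\<^sub>V\<close> is shown to be
self-adjoint through its resolvent. A weak solution \<open>u\<close> of \<open>u - H\<^sub>V u = f\<close> comes from an
orthogonal projection onto the graph of \<open>u \<mapsto> (\<nabla>u, sqrt (- V) u)\<close>, and difference quotients in the
equation show that \<open>u\<close> has second derivatives (lemma \<open>elliptic_regularity\<close>). The resolvent
\<open>R = (1 - H\<^sub>V)\<^sup>-\<^sup>1\<close> is symmetric with \<open>0 \<le> R \<le> 1\<close>. For such an operator the spectral theorem is
proved as a moment problem on \<open>[0, 1]\<close>: the Bernstein weights \<open>\<langle>u, (n choose k) R\<^sup>k (1 - R)\<^sup>n\<^sup>-\<^sup>k u\<rangle>\<close>
are nonnegative, the discrete measures that they define are tight, and a weak limit \<open>\<mu>\<^sub>u\<close> has the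
moments \<open>\<langle>u, R\<^sup>m u\<rangle>\<close>. Functions of \<open>R\<close> are limits of polynomials in the space \<open>L\<^sup>2(\<mu>\<^sub>u)\<close>, and the
image of the spectral projections of \<open>R\<close> under \<open>r \<mapsto> 1 - 1 / r\<close> is a projection-valued measure for
\<open>H\<^sub>V\<close>. This proves that spectral measures of \<open>H\<^sub>V\<close> exist. The semigroup is then analysed for an
arbitrary projection-valued measure that represents \<open>H\<^sub>V\<close>, so uniqueness is never at issue.\<close>

section \<open>Projections and weak limits in Hilbert spaces\<close>

text \<open>A minimizing sequence for the distance to \<open>S\<close> is Cauchy by the parallelogram law, and the minimizer is
the orthogonal projection because moving it along \<open>s\<close> cannot shorten the distance.\<close>

lemma closed_subspace_projection:
  fixes S :: "'a::{real_inner,complete_space} set"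
  assumes S: "subspace S" "closed S"
  obtains p where "p \<in> S" "\<And>s. s \<in> S \<Longrightarrow> inner (x - p) s = 0"
proof -
  have ne: "S \<noteq> {}" using subspace_0[OF S(1)] by auto
  define d where "d = infdist x S"
  have d: "d \<le> norm (x - s)" if "s \<in> S" for s
    using infdist_le[OF that, of x] by (simp add: d_def dist_norm)
  have d0: "0 \<le> d" by (simp add: d_def infdist_nonneg)
  have "\<exists>s\<in>S. (norm (x - s))\<^sup>2 < d\<^sup>2 + 1 / real (Suc n)" for n
  proof -
    have "d < sqrt (d\<^sup>2 + 1 / real (Suc n))"
      by (rule real_less_rsqrt) simp
    then obtain s where "s \<in> S" "dist x s < sqrt (d\<^sup>2 + 1 / real (Suc n))"
      unfolding d_def infdist_def using ne cInf_lessD[of "dist x ` S"] by auto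
    moreover have "(dist x s)\<^sup>2 < (sqrt (d\<^sup>2 + 1 / real (Suc n)))\<^sup>2"
      using calculation(2) by (intro power_strict_mono) auto
    moreover have "\<dots> = d\<^sup>2 + 1 / real (Suc n)" by (simp add: add_nonneg_nonneg)
    ultimately show ?thesis by (auto simp: dist_norm)
  qed
  then obtain y where y: "\<And>n. y n \<in> S" "\<And>n. (norm (x - y n))\<^sup>2 < d\<^sup>2 + 1 / real (Suc n)"
    by metis
  have par: "(norm (y m - y n))\<^sup>2 \<le> 2 / real (Suc m) + 2 / real (Suc n)" for m n
  proof -
    have "(1/2) *\<^sub>R (y m + y n) \<in> S"
      using S(1) y(1) by (intro subspace_scale subspace_add)
    then have "d\<^sup>2 \<le> (norm (x - (1/2) *\<^sub>R (y m + y n)))\<^sup>2"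
      using d d0 by (intro power_mono)
    \<comment> \<open>the parallelogram law; the midpoint lies in \<open>S\<close>, hence not closer than \<open>d\<close>\<close>
    moreover have "(norm (y m - y n))\<^sup>2 = 2 * (norm (x - y m))\<^sup>2 + 2 * (norm (x - y n))\<^sup>2
        - 4 * (norm (x - (1/2) *\<^sub>R (y m + y n)))\<^sup>2"
      by (simp add: power2_norm_eq_inner inner_diff inner_add inner_commute algebra_simps)
    ultimately show ?thesis using y(2)[of m] y(2)[of n] by simp
  qed
  have "Cauchy y"
  proof (rule metric_CauchyI)
    fix e :: real assume e: "e > 0"
    then obtain N where N: "4 / e\<^sup>2 < real N" using reals_Archimedean2 by blast
    have "dist (y m) (y n) < e" if "m \<ge> N" "n \<ge> N" for m n
    proof -
      have *: "2 / real (Suc k) < e\<^sup>2 / 2" if "k \<ge> N" for k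
      proof -
        have "4 / e\<^sup>2 < real (Suc k)" using N that by linarith
        then show ?thesis using e by (simp add: field_simps)
      qed
      have "(norm (y m - y n))\<^sup>2 < e\<^sup>2"
        using par[of m n] *[OF that(1)] *[OF that(2)] by linarith
      then show ?thesis using e by (simp add: dist_norm power2_less_imp_less)
    qed
    then show "\<exists>M. \<forall>m\<ge>M. \<forall>n\<ge>M. dist (y m) (y n) < e" by blast
  qed
  then obtain p where p: "y \<longlonglongrightarrow> p" by (auto simp: Cauchy_convergent_iff convergent_def)
  have pS: "p \<in> S" using S(2) y(1) p closed_sequentially by blast
  have "(\<lambda>n. (norm (x - y n))\<^sup>2) \<longlonglongrightarrow> (norm (x - p))\<^sup>2"
    by (intro tendsto_intros p)
  moreover have "(\<lambda>n. d\<^sup>2 + 1 / real (Suc n)) \<longlonglongrightarrow> d\<^sup>2 + 0"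
    by (intro tendsto_intros LIMSEQ_Suc lim_1_over_n)
  ultimately have pd: "(norm (x - p))\<^sup>2 \<le> d\<^sup>2"
    using y(2) by (intro LIMSEQ_le[of _ "(norm (x - p))\<^sup>2" _ "d\<^sup>2"]) (auto intro: less_imp_le)
  have "inner (x - p) s = 0" if s: "s \<in> S" for s
  proof (rule ccontr)
    assume nz: "inner (x - p) s \<noteq> 0"
    define t where "t = inner (x - p) s / inner s s"
    have s0: "inner s s > 0" using nz by auto
    have "p + t *\<^sub>R s \<in> S" using S(1) pS s by (intro subspace_scale subspace_add)
    then have "d\<^sup>2 \<le> (norm (x - (p + t *\<^sub>R s)))\<^sup>2" using d d0 by (intro power_mono)
    also have "\<dots> = (norm (x - p))\<^sup>2 - 2 * t * inner (x - p) s + t * t * inner s s"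
      by (simp add: power2_norm_eq_inner inner_diff inner_add inner_commute algebra_simps)
    also have "\<dots> = (norm (x - p))\<^sup>2 - (inner (x - p) s)\<^sup>2 / inner s s"
      using s0 by (simp add: t_def power2_eq_square field_simps)
    finally show False using pd nz s0 by (smt (verit) divide_pos_pos zero_less_power2)
  qed
  with pS show thesis using that by blast
qed

lemma riesz_representation:
  fixes f :: "'a::{real_inner,complete_space} \<Rightarrow> real"
  assumes "bounded_linear f"
  obtains w where "\<And>x. f x = inner w x"
proof (cases "\<forall>x. f x = 0")
  case True
  then show ?thesis using that[of 0] by simp
next
  case False
  interpret bounded_linear f by fact
  obtain x0 where x0: "f x0 \<noteq> 0" using False by blast
  let ?K = "{x. f x = 0}"
  have "subspace ?K" by (auto simp: subspace_def add scale)
  moreover have "closed ?K"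
    by (intro closed_Collect_eq continuous_on continuous_intros)
  ultimately obtain p where p: "p \<in> ?K" "\<And>s. s \<in> ?K \<Longrightarrow> inner (x0 - p) s = 0"
    using closed_subspace_projection by metis
  define z where "z = x0 - p"
  have fz: "f z \<noteq> 0" using p x0 by (simp add: z_def diff)
  have zz: "inner z z \<noteq> 0" using fz zero by auto
  have "f x = inner ((f z / inner z z) *\<^sub>R z) x" for x
  proof -
    have "inner z (x - (f x / f z) *\<^sub>R z) = 0"
      using p(2)[of "x - (f x / f z) *\<^sub>R z"] fz by (simp add: z_def[symmetric] diff scale)
    then show ?thesis using fz zz by (simp add: inner_diff_right field_simps)
  qed
  then show ?thesis using that by blast
qed

lemma closure_subspace:
  fixes S :: "'a::real_normed_vector set"
  assumes "subspace S" shows "subspace (closure S)"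
proof (rule subspaceI)
  show "0 \<in> closure S" using assms subspace_0 closure_subset by blast
next
  fix x y assume "x \<in> closure S" "y \<in> closure S"
  then obtain f g where "\<forall>n. f n \<in> S" "f \<longlonglongrightarrow> x" "\<forall>n. g n \<in> S" "g \<longlonglongrightarrow> y"
    unfolding closure_sequential by blast
  then show "x + y \<in> closure S"
    unfolding closure_sequential
    by (intro exI[of _ "\<lambda>n. f n + g n"]) (auto intro: tendsto_add subspace_add[OF assms])
next
  fix c :: real and x assume "x \<in> closure S"
  then obtain f where "\<forall>n. f n \<in> S" "f \<longlonglongrightarrow> x"
    unfolding closure_sequential by blast
  then show "c *\<^sub>R x \<in> closure S"
    unfolding closure_sequential
    by (intro exI[of _ "\<lambda>n. c *\<^sub>R f n"]) (auto intro!: tendsto_intros subspace_scale[OF assms])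
qed

text \<open>The difference of \<open>x\<close> and its projection onto the closure of \<open>S\<close> is orthogonal to \<open>S\<close>.\<close>

lemma dense_if_orthogonal_complement_trivial:
  fixes S :: "'a::{real_inner,complete_space} set"
  assumes S: "subspace S" and triv: "\<And>x. (\<And>s. s \<in> S \<Longrightarrow> inner s x = 0) \<Longrightarrow> x = 0"
  shows "closure S = UNIV"
proof -
  have "x \<in> closure S" for x
  proof -
    obtain p where p: "p \<in> closure S" "\<And>s. s \<in> closure S \<Longrightarrow> inner (x - p) s = 0"
      using closed_subspace_projection[OF closure_subspace[OF S] closed_closure] by metis
    have "x - p = 0"
      using p(2) closure_subset by (intro triv) (auto simp: inner_commute)
    then show ?thesis using p by simp
  qed
  then show ?thesis by auto
qed

lemma norm_le_if_inner_le_on_dense: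
  fixes S :: "'a::real_inner set"
  assumes dense: "closure S = UNIV" and le: "\<And>s. s \<in> S \<Longrightarrow> inner s w \<le> C * norm s"
    and C: "0 \<le> C"
  shows "norm w \<le> C"
proof (cases "w = 0")
  case False
  have "w \<in> closure S" using dense by simp
  then obtain f where f: "\<forall>n. f n \<in> S" "f \<longlonglongrightarrow> w"
    unfolding closure_sequential by blast
  have "(\<lambda>n. inner (f n) w) \<longlonglongrightarrow> inner w w" "(\<lambda>n. C * norm (f n)) \<longlonglongrightarrow> C * norm w"
    by (intro tendsto_intros f)+
  then have "inner w w \<le> C * norm w" using le f(1) by (intro LIMSEQ_le) auto
  then have "norm w * norm w \<le> C * norm w" by (metis dot_square_norm power2_eq_square)
  then show ?thesis using False mult_right_le_imp_le[of "norm w" "norm w" C] by fastforce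
qed (use C in simp)

text \<open>The substitute for weak compactness: on a bounded sequence the limits of inner products extend from a
dense set to the whole space, and the Riesz theorem turns the limit functional into a vector.\<close>

lemma weak_limit_if_convergent_on_dense:
  fixes w :: "nat \<Rightarrow> 'a::{real_inner,complete_space}"
  assumes dense: "closure S = UNIV" and bd: "\<And>n. norm (w n) \<le> C"
    and conv: "\<And>s. s \<in> S \<Longrightarrow> convergent (\<lambda>n. inner s (w n))"
  obtains w' where "\<And>x. (\<lambda>n. inner x (w n)) \<longlonglongrightarrow> inner x w'"
proof -
  have C: "0 \<le> C" using bd[of 0] norm_ge_zero order_trans by blast
  have "Cauchy (\<lambda>n. inner x (w n))" for x
  proof (rule metric_CauchyI)
    fix e :: real assume e: "e > 0"
    have "x \<in> closure S" using dense by simp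
    moreover have "0 < e / (3 * (C + 1))" using e C by simp
    ultimately obtain s where s: "s \<in> S" "dist s x < e / (3 * (C + 1))"
      unfolding closure_approachable by blast
    obtain M where M: "\<And>m n. m \<ge> M \<Longrightarrow> n \<ge> M \<Longrightarrow> dist (inner s (w m)) (inner s (w n)) < e / 3"
      using metric_CauchyD[OF convergent_Cauchy[OF conv[OF s(1)]], of "e / 3"] e by auto
    have near: "\<bar>inner x (w n) - inner s (w n)\<bar> \<le> e / 3" for n
    proof -
      have "\<bar>inner x (w n) - inner s (w n)\<bar> \<le> norm (x - s) * norm (w n)"
        using Cauchy_Schwarz_ineq2[of "x - s" "w n"] by (simp add: inner_diff_left)
      also have "\<dots> \<le> (e / (3 * (C + 1))) * C"
        using s(2) bd e C by (intro mult_mono) (auto simp: dist_norm norm_minus_commute)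
      also have "\<dots> \<le> e / 3" using e C by (simp add: field_simps)
      finally show ?thesis .
    qed
    have "dist (inner x (w m)) (inner x (w n)) < e" if "m \<ge> M" "n \<ge> M" for m n
      using M[OF that] near[of m] near[of n] unfolding dist_real_def by linarith
    then show "\<exists>M. \<forall>m\<ge>M. \<forall>n\<ge>M. dist (inner x (w m)) (inner x (w n)) < e" by blast
  qed
  then have lim: "(\<lambda>n. inner x (w n)) \<longlonglongrightarrow> lim (\<lambda>n. inner x (w n))" for x
    by (simp add: Cauchy_convergent_iff convergent_LIMSEQ_iff)
  define L where "L x = lim (\<lambda>n. inner x (w n))" for x
  note lim' = lim[folded L_def]
  have "bounded_linear L"
  proof (rule bounded_linear_intro[where K = C])
    show "L (x + y) = L x + L y" for x y
      using tendsto_add[OF lim'[of x] lim'[of y]] lim'[of "x + y"] LIMSEQ_unique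
      by (auto simp: inner_add_left)
    show "L (r *\<^sub>R x) = r *\<^sub>R L x" for r x
      using tendsto_mult_left[OF lim'[of x], of r] lim'[of "r *\<^sub>R x"] LIMSEQ_unique by auto
    show "norm (L x) \<le> norm x * C" for x
    proof -
      have "norm (inner x (w n)) \<le> norm x * C" for n
        using Cauchy_Schwarz_ineq2[of x "w n"] mult_left_mono[OF bd[of n], of "norm x"] by simp
      then show ?thesis
        by (intro LIMSEQ_le_const2[OF tendsto_norm[OF lim'[of x]]]) auto
    qed
  qed
  then obtain w' where "\<And>x. L x = inner w' x" using riesz_representation by metis
  then show thesis using lim' by (intro that[of w']) (simp add: inner_commute)
qed

lemma tendsto_inner_if_weakly_on_dense:
  fixes w :: "nat \<Rightarrow> 'a::{real_inner,complete_space}"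
  assumes dense: "closure S = UNIV" and bd: "\<And>n. norm (w n) \<le> C"
    and conv: "\<And>s. s \<in> S \<Longrightarrow> (\<lambda>n. inner s (w n)) \<longlonglongrightarrow> inner s v"
  shows "(\<lambda>n. inner x (w n)) \<longlonglongrightarrow> inner x v"
proof -
  have "convergent (\<lambda>n. inner s (w n))" if "s \<in> S" for s
    using conv[OF that] by (rule convergentI)
  with dense bd obtain w' where w': "\<And>x. (\<lambda>n. inner x (w n)) \<longlonglongrightarrow> inner x w'"
    using weak_limit_if_convergent_on_dense[of S w C] by blast
  have "norm (w' - v) \<le> 0"
  proof (rule norm_le_if_inner_le_on_dense[OF dense])
    fix s assume "s \<in> S"
    then have "inner s w' = inner s v" using LIMSEQ_unique[OF w' conv] by blast
    then show "inner s (w' - v) \<le> 0 * norm s" by (simp add: inner_diff_right)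
  qed simp
  then show ?thesis using w' by simp
qed

section \<open>Polynomials are dense in L2 of measures on the unit interval\<close>

text \<open>Real functions on the line suffice for the calculus of a self-adjoint operator. Borel measurability is
required outright, so that one function can be used with several measures at once.\<close>

definition square_int :: "real measure \<Rightarrow> (real \<Rightarrow> real) \<Rightarrow> bool" where
  "square_int M f \<longleftrightarrow> f \<in> borel_measurable borel \<and> integrable M (\<lambda>x. (f x)\<^sup>2)"

definition unit_interval_measure :: "real measure \<Rightarrow> bool" where
  "unit_interval_measure M \<longleftrightarrow> finite_measure M \<and> sets M = sets borel \<and> (AE x in M. x \<in> {0..1})"

lemma square_int_mult_integrable:
  assumes "sets M = sets borel" "square_int M f" "square_int M g"
  shows "integrable M (\<lambda>x. f x * g x)"
proof (rule Bochner_Integration.integrable_bound)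
  note [measurable_cong] = assms(1)
  have [measurable]: "f \<in> borel_measurable borel" "g \<in> borel_measurable borel"
    using assms by (auto simp: square_int_def)
  show "integrable M (\<lambda>x. (f x)\<^sup>2 + (g x)\<^sup>2)" using assms by (auto simp: square_int_def)
  show "(\<lambda>x. f x * g x) \<in> borel_measurable M" by measurable
  have "norm (a * b) \<le> norm (a\<^sup>2 + b\<^sup>2)" for a b :: real
  proof -
    have "2 * \<bar>a * b\<bar> \<le> a\<^sup>2 + b\<^sup>2"
      using sum_squares_bound[of "\<bar>a\<bar>" "\<bar>b\<bar>"] by (simp add: abs_mult)
    then show ?thesis by simp
  qed
  then show "AE x in M. norm (f x * g x) \<le> norm ((f x)\<^sup>2 + (g x)\<^sup>2)" by simp
qed

lemma square_int_add:
  assumes "sets M = sets borel" "square_int M f" "square_int M g"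
  shows "square_int M (\<lambda>x. f x + g x)"
proof -
  have "integrable M (\<lambda>x. (f x)\<^sup>2 + (g x)\<^sup>2 + 2 * (f x * g x))"
    using assms square_int_mult_integrable[OF assms] by (auto simp: square_int_def)
  then show ?thesis using assms by (auto simp: square_int_def power2_sum algebra_simps)
qed

lemma square_int_cmult:
  assumes "square_int M f"
  shows "square_int M (\<lambda>x. c * f x)"
  using assms by (auto simp: square_int_def power_mult_distrib)

lemma square_int_diff:
  assumes "sets M = sets borel" "square_int M f" "square_int M g"
  shows "square_int M (\<lambda>x. f x - g x)"
  using square_int_add[OF assms(1,2) square_int_cmult[OF assms(3), of "-1"]] by simp

lemma integral_square_diff_triangle:
  assumes M: "sets M = sets borel" and "square_int M f" "square_int M g" "square_int M h"
  shows "(LINT x|M. (f x - h x)\<^sup>2) \<le> 2 * (LINT x|M. (f x - g x)\<^sup>2) + 2 * (LINT x|M. (g x - h x)\<^sup>2)"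
proof -
  have i: "integrable M (\<lambda>x. (f x - g x)\<^sup>2)" "integrable M (\<lambda>x. (g x - h x)\<^sup>2)" "integrable M (\<lambda>x. (f x - h x)\<^sup>2)"
    using assms square_int_diff[OF M] by (auto simp: square_int_def)
  have "(a - c)\<^sup>2 \<le> 2 * (a - b)\<^sup>2 + 2 * (b - c)\<^sup>2" for a b c :: real
    using sum_squares_bound[of "a - b" "b - c"] by (simp add: power2_eq_square algebra_simps)
  then have "(LINT x|M. (f x - h x)\<^sup>2) \<le> (LINT x|M. 2 * (f x - g x)\<^sup>2 + 2 * (g x - h x)\<^sup>2)"
    using i by (intro integral_mono) auto
  also have "\<dots> = 2 * (LINT x|M. (f x - g x)\<^sup>2) + 2 * (LINT x|M. (g x - h x)\<^sup>2)"
    using i by simp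
  finally show ?thesis .
qed

text \<open>The integral of \<open>(t f + g)\<^sup>2\<close> is a nonnegative quadratic polynomial in \<open>t\<close>.\<close>

lemma integral_Cauchy_Schwarz:
  assumes M: "sets M = sets borel" and f: "square_int M f" and g: "square_int M g"
  shows "\<bar>LINT x|M. f x * g x\<bar> \<le> sqrt (LINT x|M. (f x)\<^sup>2) * sqrt (LINT x|M. (g x)\<^sup>2)"
proof -
  define A B C where "A = (LINT x|M. (f x)\<^sup>2)" "B = (LINT x|M. f x * g x)" "C = (LINT x|M. (g x)\<^sup>2)"
  note i = square_int_mult_integrable[OF M f g]
  have ii: "integrable M (\<lambda>x. (f x)\<^sup>2)" "integrable M (\<lambda>x. (g x)\<^sup>2)" using f g by (auto simp: square_int_def)
  have q: "0 \<le> t * t * A + 2 * t * B + C" for t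
  proof -
    have "0 \<le> (LINT x|M. (t * f x + g x)\<^sup>2)" by simp
    also have "\<dots> = (LINT x|M. t * t * (f x)\<^sup>2 + 2 * t * (f x * g x) + (g x)\<^sup>2)"
      by (intro Bochner_Integration.integral_cong) (auto simp: power2_eq_square algebra_simps)
    also have "\<dots> = t * t * A + 2 * t * B + C"
      using i ii by (simp add: A_B_C_def)
    finally show ?thesis .
  qed
  have A0: "0 \<le> A" "0 \<le> C" by (auto simp: A_B_C_def)
  have "B\<^sup>2 \<le> A * C"
  proof (cases "A = 0")
    case True
    have "B = 0"
    proof (rule ccontr)
      assume "B \<noteq> 0"
      then have "2 * (- (C + 1) / (2 * B)) * B = - (C + 1)" by (simp add: field_simps)
      then show False using q[of "- (C + 1) / (2 * B)"] True by simp
    qed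
    then show ?thesis using True by simp
  next
    case False
    then have "0 < A" using A0 by simp
    then show ?thesis using q[of "- B / A"] by (simp add: field_simps power2_eq_square)
  qed
  then have "\<bar>B\<bar> \<le> sqrt (A * C)" by (metis real_sqrt_abs real_sqrt_le_mono)
  then show ?thesis by (simp add: A_B_C_def real_sqrt_mult)
qed

lemma tendsto_integral_mult_L2:
  assumes M: "sets M = sets borel" and f: "square_int M f" "\<And>n. square_int M (F n)"
    and g: "square_int M g" "\<And>n. square_int M (G n)"
    and F: "(\<lambda>n. LINT x|M. (F n x - f x)\<^sup>2) \<longlonglongrightarrow> 0" and G: "(\<lambda>n. LINT x|M. (G n x - g x)\<^sup>2) \<longlonglongrightarrow> 0"
  shows "(\<lambda>n. LINT x|M. F n x * G n x) \<longlonglongrightarrow> (LINT x|M. f x * g x)"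
proof -
  let ?s = "\<lambda>h. sqrt (LINT x|M. (h x)\<^sup>2)"
  note d = square_int_diff[OF M]
  have "norm ((LINT x|M. F n x * G n x) - (LINT x|M. f x * g x))
     \<le> ?s (\<lambda>x. F n x - f x) * ?s g + ?s f * ?s (\<lambda>x. G n x - g x) + ?s (\<lambda>x. F n x - f x) * ?s (\<lambda>x. G n x - g x)" for n
  proof -
    note i = square_int_mult_integrable[OF M]
    have "(LINT x|M. F n x * G n x) - (LINT x|M. f x * g x) =
      (LINT x|M. (F n x - f x) * g x + f x * (G n x - g x) + (F n x - f x) * (G n x - g x))"
      by (subst Bochner_Integration.integral_diff[symmetric])
         (auto intro!: i f g Bochner_Integration.integral_cong simp: algebra_simps)
    also have "\<dots> = (LINT x|M. (F n x - f x) * g x) + (LINT x|M. f x * (G n x - g x)) + (LINT x|M. (F n x - f x) * (G n x - g x))"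
      using i[OF d[OF f(2)[of n] f(1)] g(1)] i[OF f(1) d[OF g(2)[of n] g(1)]] i[OF d[OF f(2)[of n] f(1)] d[OF g(2)[of n] g(1)]]
      by simp
    finally show ?thesis
      using integral_Cauchy_Schwarz[OF M d[OF f(2)[of n] f(1)] g(1)] integral_Cauchy_Schwarz[OF M f(1) d[OF g(2)[of n] g(1)]]
        integral_Cauchy_Schwarz[OF M d[OF f(2)[of n] f(1)] d[OF g(2)[of n] g(1)]]
      by simp
  qed
  note le = this
  have "(\<lambda>n. ?s (\<lambda>x. F n x - f x) * ?s g + ?s f * ?s (\<lambda>x. G n x - g x) + ?s (\<lambda>x. F n x - f x) * ?s (\<lambda>x. G n x - g x)) \<longlonglongrightarrow> sqrt 0 * ?s g + ?s f * sqrt 0 + sqrt 0 * sqrt 0"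
    by (intro tendsto_intros F G)
  then have "(\<lambda>n. ?s (\<lambda>x. F n x - f x) * ?s g + ?s f * ?s (\<lambda>x. G n x - g x) + ?s (\<lambda>x. F n x - f x) * ?s (\<lambda>x. G n x - g x)) \<longlonglongrightarrow> 0"
    by simp
  then have "(\<lambda>n. (LINT x|M. F n x * G n x) - (LINT x|M. f x * g x)) \<longlonglongrightarrow> 0"
    by (rule Lim_null_comparison[OF always_eventually, rotated]) (use le in blast)
  then show ?thesis by (simp add: LIM_zero_iff)
qed

lemma square_int_bounded:
  assumes M: "unit_interval_measure M" and f: "f \<in> borel_measurable borel"
    and b: "\<And>x. x \<in> {0..1} \<Longrightarrow> \<bar>f x\<bar> \<le> B"
  shows "square_int M f"
proof -
  interpret finite_measure M using M by (simp add: unit_interval_measure_def)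
  have s [measurable_cong]: "sets M = sets borel" using M by (simp add: unit_interval_measure_def)
  note [measurable] = f
  have "AE x in M. norm ((f x)\<^sup>2) \<le> B\<^sup>2"
  proof -
    have "AE x in M. x \<in> {0..1}" using M by (simp add: unit_interval_measure_def)
    then show ?thesis
    proof eventually_elim
      case (elim x)
      then have "\<bar>f x\<bar>\<^sup>2 \<le> B\<^sup>2" using b by (intro power_mono) auto
      then show ?case by simp
    qed
  qed
  then have "integrable M (\<lambda>x. (f x)\<^sup>2)" by (intro integrable_const_bound) auto
  then show ?thesis using f by (simp add: square_int_def)
qed

lemma borel_measurable_poly [measurable]: "poly p \<in> borel_measurable (borel :: real measure)"
  by (intro borel_measurable_continuous_onI continuous_intros)

lemma square_int_continuous:
  assumes M: "unit_interval_measure M" and f: "continuous_on UNIV f"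
  shows "square_int M f"
proof -
  have "compact (f ` {0..1})" using f by (intro compact_continuous_image) (auto intro: continuous_on_subset)
  then have "bounded (f ` {0..1})" by (rule compact_imp_bounded)
  then obtain B where "\<forall>x\<in>{0..1}. \<bar>f x\<bar> \<le> B" by (auto simp: bounded_iff)
  then show ?thesis using borel_measurable_continuous_onI[OF f] M by (auto intro: square_int_bounded)
qed

lemma square_int_poly: "unit_interval_measure M \<Longrightarrow> square_int M (poly p)"
  by (rule square_int_continuous) (auto intro: continuous_intros)

text \<open>One polynomial has to be close to \<open>f\<close> for all measures of the set \<open>\<M>\<close> simultaneously. This is what
makes the functional calculus work without uniqueness of the spectral measures: additivity in the vector, for
example, follows by approximating for the measures of \<open>u\<close>, \<open>v\<close> and \<open>u + v\<close> at the same time.\<close>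

definition poly_approximable :: "real measure set \<Rightarrow> (real \<Rightarrow> real) \<Rightarrow> bool" where
  "poly_approximable \<M> f \<longleftrightarrow> (\<forall>M\<in>\<M>. square_int M f) \<and>
     (\<forall>e>0. \<exists>p. \<forall>M\<in>\<M>. (LINT x|M. (poly p x - f x)\<^sup>2) < e)"

lemma poly_approximable_limit:
  assumes \<M>: "\<And>M. M \<in> \<M> \<Longrightarrow> unit_interval_measure M" and f: "\<And>M. M \<in> \<M> \<Longrightarrow> square_int M f"
    and ap: "\<And>e. e > 0 \<Longrightarrow> \<exists>g. poly_approximable \<M> g \<and> (\<forall>M\<in>\<M>. (LINT x|M. (g x - f x)\<^sup>2) < e)"
  shows "poly_approximable \<M> f"
  unfolding poly_approximable_def
proof (intro conjI ballI allI impI f)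
  fix e :: real assume e: "e > 0"
  then obtain g where g: "poly_approximable \<M> g" "\<forall>M\<in>\<M>. (LINT x|M. (g x - f x)\<^sup>2) < e / 4"
    using ap[of "e / 4"] by auto
  then obtain p where p: "\<forall>M\<in>\<M>. (LINT x|M. (poly p x - g x)\<^sup>2) < e / 4"
    unfolding poly_approximable_def using e by (metis divide_pos_pos zero_less_numeral)
  have "(LINT x|M. (poly p x - f x)\<^sup>2) < e" if "M \<in> \<M>" for M
  proof -
    have "sets M = sets borel" using \<M>[OF that] by (simp add: unit_interval_measure_def)
    then have "(LINT x|M. (poly p x - f x)\<^sup>2) \<le> 2 * (LINT x|M. (poly p x - g x)\<^sup>2) + 2 * (LINT x|M. (g x - f x)\<^sup>2)"
      using that g f \<M> by (intro integral_square_diff_triangle) (auto simp: poly_approximable_def square_int_poly)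
    then show ?thesis using p g(2) that by fastforce
  qed
  then show "\<exists>p. \<forall>M\<in>\<M>. (LINT x|M. (poly p x - f x)\<^sup>2) < e" by blast
qed

text \<open>Dominated convergence for each of the finitely many measures.\<close>

lemma poly_approximable_limit_seq:
  assumes fin: "finite \<M>" and \<M>: "\<And>M. M \<in> \<M> \<Longrightarrow> unit_interval_measure M"
    and f: "\<And>M. M \<in> \<M> \<Longrightarrow> square_int M f"
    and F: "\<And>n. poly_approximable \<M> (F n)"
    and bd: "\<And>n x. \<bar>F n x\<bar> \<le> w x" and w: "\<And>M. M \<in> \<M> \<Longrightarrow> square_int M w"
    and lim: "\<And>x. (\<lambda>n. F n x) \<longlonglongrightarrow> f x"
  shows "poly_approximable \<M> f"
proof (rule poly_approximable_limit[OF \<M> f])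
  fix e :: real assume e: "e > 0"
  have *: "(\<lambda>n. LINT x|M. (F n x - f x)\<^sup>2) \<longlonglongrightarrow> 0" if M: "M \<in> \<M>" for M
  proof -
    have s [measurable_cong]: "sets M = sets borel" using \<M>[OF M] by (simp add: unit_interval_measure_def)
    have [measurable]: "f \<in> borel_measurable borel" using f[OF M] by (simp add: square_int_def)
    have [measurable]: "F n \<in> borel_measurable borel" for n
      using F[of n] M by (simp add: poly_approximable_def square_int_def)
    have "(\<lambda>n. LINT x|M. (F n x - f x)\<^sup>2) \<longlonglongrightarrow> (LINT x|M. 0)"
    proof (rule integral_dominated_convergence)
      show "integrable M (\<lambda>x. 4 * (w x)\<^sup>2)" using w[OF M] by (simp add: square_int_def)
      show "AE x in M. (\<lambda>n. (F n x - f x)\<^sup>2) \<longlonglongrightarrow> 0"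
        using lim by (intro AE_I2) (simp add: tendsto_null_power LIM_zero)
      show "AE x in M. norm ((F n x - f x)\<^sup>2) \<le> 4 * (w x)\<^sup>2" for n
      proof (intro AE_I2)
        fix x
        have "\<bar>f x\<bar> \<le> w x" using bd by (intro LIMSEQ_le_const2[OF tendsto_rabs[OF lim[of x]]]) auto
        then have "\<bar>F n x - f x\<bar> \<le> 2 * w x" using bd[of n x] by linarith
        then have "\<bar>F n x - f x\<bar>\<^sup>2 \<le> (2 * w x)\<^sup>2" by (intro power_mono) auto
        then show "norm ((F n x - f x)\<^sup>2) \<le> 4 * (w x)\<^sup>2" by (simp add: power_mult_distrib)
      qed
    qed measurable
    then show ?thesis by simp
  qed
  have "eventually (\<lambda>n. \<forall>M\<in>\<M>. (LINT x|M. (F n x - f x)\<^sup>2) < e) sequentially"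
    using fin by (intro eventually_ball_finite ballI order_tendstoD(2)[OF * e]) auto
  then obtain n where "\<forall>M\<in>\<M>. (LINT x|M. (F n x - f x)\<^sup>2) < e"
    by (auto simp: eventually_sequentially)
  then show "\<exists>g. poly_approximable \<M> g \<and> (\<forall>M\<in>\<M>. (LINT x|M. (g x - f x)\<^sup>2) < e)"
    using F by blast
qed

lemma poly_approximable_add:
  assumes \<M>: "\<And>M. M \<in> \<M> \<Longrightarrow> unit_interval_measure M"
    and f: "poly_approximable \<M> f" and g: "poly_approximable \<M> g"
  shows "poly_approximable \<M> (\<lambda>x. f x + g x)"
  unfolding poly_approximable_def
proof (intro conjI ballI allI impI)
  fix M assume "M \<in> \<M>"
  then show "square_int M (\<lambda>x. f x + g x)"
    using f g \<M> by (intro square_int_add) (auto simp: poly_approximable_def unit_interval_measure_def)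
next
  fix e :: real assume e: "e > 0"
  obtain p where p: "\<forall>M\<in>\<M>. (LINT x|M. (poly p x - f x)\<^sup>2) < e / 4"
    using f unfolding poly_approximable_def using e by (metis divide_pos_pos zero_less_numeral)
  obtain q where q: "\<forall>M\<in>\<M>. (LINT x|M. (poly q x - g x)\<^sup>2) < e / 4"
    using g unfolding poly_approximable_def using e by (metis divide_pos_pos zero_less_numeral)
  have "(LINT x|M. (poly (p + q) x - (f x + g x))\<^sup>2) < e" if M: "M \<in> \<M>" for M
  proof -
    have s: "sets M = sets borel" using \<M>[OF M] by (simp add: unit_interval_measure_def)
    note sq = square_int_poly[OF \<M>[OF M], of p] square_int_poly[OF \<M>[OF M], of q]
    have square_zero: "square_int M (\<lambda>x. 0)" by (simp add: square_int_def)
    have fg: "square_int M f" "square_int M g" using f g M by (auto simp: poly_approximable_def)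
    have "(LINT x|M. ((poly p x - f x) - (g x - poly q x))\<^sup>2) \<le> 2 * (LINT x|M. ((poly p x - f x) - 0)\<^sup>2) + 2 * (LINT x|M. (0 - (g x - poly q x))\<^sup>2)"
      by (rule integral_square_diff_triangle[OF s square_int_diff[OF s sq(1) fg(1)] square_zero square_int_diff[OF s fg(2) sq(2)]])
    also have "\<dots> < e" using p q M by fastforce
    finally show ?thesis by (simp add: algebra_simps)
  qed
  then show "\<exists>p. \<forall>M\<in>\<M>. (LINT x|M. (poly p x - (f x + g x))\<^sup>2) < e" by blast
qed

lemma poly_approximable_poly:
  assumes "\<And>M. M \<in> \<M> \<Longrightarrow> unit_interval_measure M"
  shows "poly_approximable \<M> (poly p)"
  using assms unfolding poly_approximable_def by (auto intro: square_int_poly intro!: exI[of _ p])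

lemma poly_approximable_zero:
  assumes "\<And>M. M \<in> \<M> \<Longrightarrow> unit_interval_measure M"
  shows "poly_approximable \<M> (\<lambda>x. 0)"
proof -
  have "poly (0 :: real poly) = (\<lambda>x. 0)" by auto
  then show ?thesis using poly_approximable_poly[OF assms, of \<M> 0] by simp
qed

lemma poly_approximable_cmult:
  assumes f: "poly_approximable \<M> f"
  shows "poly_approximable \<M> (\<lambda>x. c * f x)"
  unfolding poly_approximable_def
proof (intro conjI ballI allI impI)
  fix M assume "M \<in> \<M>"
  then show "square_int M (\<lambda>x. c * f x)"
    using f by (auto simp: poly_approximable_def intro: square_int_cmult)
next
  fix e :: real assume e: "e > 0"
  then have "0 < e / (c\<^sup>2 + 1)" by (simp add: add_nonneg_pos)
  then obtain p where p: "\<forall>M\<in>\<M>. (LINT x|M. (poly p x - f x)\<^sup>2) < e / (c\<^sup>2 + 1)"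
    using f unfolding poly_approximable_def by metis
  have "(LINT x|M. (poly (smult c p) x - c * f x)\<^sup>2) < e" if M: "M \<in> \<M>" for M
  proof -
    have "(LINT x|M. (poly (smult c p) x - c * f x)\<^sup>2) = c\<^sup>2 * (LINT x|M. (poly p x - f x)\<^sup>2)"
      by (simp flip: right_diff_distrib add: power_mult_distrib)
    also have "\<dots> \<le> (c\<^sup>2 + 1) * (LINT x|M. (poly p x - f x)\<^sup>2)" by (intro mult_right_mono) auto
    also have "\<dots> < (c\<^sup>2 + 1) * (e / (c\<^sup>2 + 1))" using p M by (intro mult_strict_left_mono) (auto simp: add_nonneg_pos)
    also have "\<dots> = e" using add_nonneg_pos[of "c\<^sup>2" 1] by simp
    finally show ?thesis .
  qed
  then show "\<exists>p. \<forall>M\<in>\<M>. (LINT x|M. (poly p x - c * f x)\<^sup>2) < e" by blast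
qed

definition bernstein_poly :: "nat \<Rightarrow> nat \<Rightarrow> real poly" where
  "bernstein_poly n k = smult (real (n choose k)) ([:0, 1:] ^ k * [:1, -1:] ^ (n - k))"

lemma poly_bernstein_poly: "poly (bernstein_poly n k) x = Bernstein n k x"
  by (simp add: bernstein_poly_def Bernstein_def)

text \<open>The Bernstein polynomials of \<open>f\<close> converge uniformly on the unit interval, which carries all the measures.\<close>

lemma poly_approximable_continuous:
  assumes \<M>: "\<And>M. M \<in> \<M> \<Longrightarrow> unit_interval_measure M" and fin: "finite \<M>"
    and f: "continuous_on UNIV f"
  shows "poly_approximable \<M> f"
proof (rule poly_approximable_limit[OF \<M>])
  show "square_int M f" if "M \<in> \<M>" for M using square_int_continuous[OF \<M>[OF that] f] .
  fix e :: real assume e: "e > 0"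
  define K where "K = (\<Sum>M\<in>\<M>. measure M UNIV)"
  have K0: "0 \<le> K" by (simp add: K_def sum_nonneg)
  define d where "d = sqrt (e / (K + 1))"
  have d: "0 < d" "d\<^sup>2 * K < e" using e K0 by (auto simp: d_def field_simps)
  obtain N where N: "\<forall>n x. N \<le> n \<and> x \<in> {0..1} \<longrightarrow> \<bar>f x - (\<Sum>k\<le>n. f(k/n) * Bernstein n k x)\<bar> < d"
    using Bernstein_Weierstrass[of f d] d f by (auto intro: continuous_on_subset)
  define p where "p = (\<Sum>k\<le>N. smult (f(k/N)) (bernstein_poly N k))"
  have p: "\<bar>poly p x - f x\<bar> < d" if "x \<in> {0..1}" for x
  proof -
    have "poly p x = (\<Sum>k\<le>N. f(k/N) * Bernstein N k x)"
      by (simp add: p_def poly_sum poly_bernstein_poly)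
    then show ?thesis using N that by (simp add: abs_minus_commute)
  qed
  have "(LINT x|M. (poly p x - f x)\<^sup>2) < e" if M: "M \<in> \<M>" for M
  proof -
    interpret finite_measure M using \<M>[OF M] by (simp add: unit_interval_measure_def)
    have s: "sets M = sets borel" and ae: "AE x in M. x \<in> {0..1}" using \<M>[OF M] by (auto simp: unit_interval_measure_def)
    have sp: "space M = UNIV" using sets_eq_imp_space_eq[OF s] by simp
    have "square_int M (\<lambda>x. poly p x - f x)"
      using square_int_continuous[OF \<M>[OF M] f] square_int_poly[OF \<M>[OF M]] by (intro square_int_diff s) auto
    then have "(LINT x|M. (poly p x - f x)\<^sup>2) \<le> (LINT x|M. d\<^sup>2)"
    proof (intro integral_mono_AE)
      show "AE x in M. (poly p x - f x)\<^sup>2 \<le> d\<^sup>2"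
        using ae
      proof eventually_elim
        case (elim x)
        then have "\<bar>poly p x - f x\<bar>\<^sup>2 \<le> d\<^sup>2" using p[OF elim] by (intro power_mono) auto
        then show ?case by simp
      qed
    qed (auto simp: square_int_def)
    also have "\<dots> = d\<^sup>2 * measure M UNIV" by (simp add: sp)
    also have "\<dots> \<le> d\<^sup>2 * K" unfolding K_def
      using fin M by (intro mult_left_mono member_le_sum) auto
    finally show ?thesis using d by simp
  qed
  then show "\<exists>g. poly_approximable \<M> g \<and> (\<forall>M\<in>\<M>. (LINT x|M. (g x - f x)\<^sup>2) < e)"
    using poly_approximable_poly[OF \<M>] by blast
qed

text \<open>Closed intervals are limits of continuous functions, and the Borel sets with the property are closed
under complements and disjoint countable unions.\<close>

lemma poly_approximable_indicator:
  assumes \<M>: "\<And>M. M \<in> \<M> \<Longrightarrow> unit_interval_measure M" and fin: "finite \<M>"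
    and B: "B \<in> sets borel"
  shows "poly_approximable \<M> (indicator B)"
proof -
  have ind: "square_int M (indicator B)" if "M \<in> \<M>" "B \<in> sets borel" for M B
    using that \<M> by (intro square_int_bounded[where B = 1]) (auto simp: indicator_def)
  have one: "square_int M (\<lambda>x. 1)" if "M \<in> \<M>" for M
    using that \<M> by (intro square_int_bounded[where B = 1]) auto
  have empty_ind: "(indicator {} :: real \<Rightarrow> real) = (\<lambda>x. 0)" by (auto simp: fun_eq_iff)
  show ?thesis using B
  proof (induction B rule: borel_set_induct)
    case empty
    show ?case unfolding empty_ind by (rule poly_approximable_zero[OF \<M>])
  next
    case (interval a b)
    define F where "F n x = max 0 (1 - real n * infdist x {a..b})" for n x
    show ?case
    proof (rule poly_approximable_limit_seq[OF fin \<M>, where F = F and w = "\<lambda>x. 1"])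
      show "poly_approximable \<M> (F n)" for n
        unfolding F_def by (intro poly_approximable_continuous[OF \<M> fin] continuous_intros)
      show "\<bar>F n x\<bar> \<le> 1" for n x by (auto simp: F_def infdist_nonneg)
      show "(\<lambda>n. F n x) \<longlonglongrightarrow> indicator {a..b} x" for x
      proof (cases "x \<in> {a..b}")
        case True
        then show ?thesis by (simp add: F_def)
      next
        case False
        have "infdist x {a..b} > 0"
          using False interval in_closed_iff_infdist_zero[of "{a..b}" x] infdist_nonneg[of x "{a..b}"] by auto
        then obtain N where N: "1 < real N * infdist x {a..b}" using reals_Archimedean3 by blast
        have "F n x = 0" if "n \<ge> N" for n
        proof -
          have "real N * infdist x {a..b} \<le> real n * infdist x {a..b}"
            using that by (intro mult_right_mono infdist_nonneg) auto
          then show ?thesis using N by (simp add: F_def)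
        qed
        then have "(\<lambda>n. F n x) \<longlonglongrightarrow> 0" by (intro tendsto_eventually) (auto simp: eventually_sequentially)
        then show ?thesis using False by simp
      qed
    qed (auto intro: ind one)
  next
    case (compl B)
    have "poly_approximable \<M> (\<lambda>x. poly 1 x + (-1) * indicator B x)"
      by (rule poly_approximable_add[OF \<M> poly_approximable_poly[OF \<M>] poly_approximable_cmult[OF compl(2)]])
    moreover have "(\<lambda>x. poly 1 x + (-1) * indicator B x) = (indicator (- B) :: real \<Rightarrow> real)"
      by (auto simp: fun_eq_iff indicator_def)
    ultimately show ?case by (simp only:)
  next
    case (union C)
    have fs: "poly_approximable \<M> (indicator (\<Union>i<n. C i))" for n
    proof (induction n)
      case 0
      have e: "(\<Union>i<0::nat. C i) = {}" by simp
      show ?case unfolding e empty_ind by (rule poly_approximable_zero[OF \<M>])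
    next
      case (Suc n)
      have "C n \<inter> (\<Union>i<n. C i) = {}"
      proof -
        have "C n \<inter> C i = {}" if "i < n" for i
          using union(1) that by (intro disjoint_family_onD[of C UNIV]) auto
        then show ?thesis by blast
      qed
      then have "indicator (\<Union>i<n. C i) x + indicator (C n) x = (indicator (\<Union>i<Suc n. C i) x :: real)" for x
        unfolding lessThan_Suc UN_insert by (auto simp: indicator_def)
      then have "(\<lambda>x. indicator (\<Union>i<n. C i) x + indicator (C n) x) = (indicator (\<Union>i<Suc n. C i) :: real \<Rightarrow> real)"
        by (rule ext)
      moreover have "poly_approximable \<M> (\<lambda>x. indicator (\<Union>i<n. C i) x + indicator (C n) x)"
        by (rule poly_approximable_add[OF \<M> Suc union(3)])
      ultimately show ?case by (simp only:)
    qed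
    show ?case
    proof (rule poly_approximable_limit_seq[OF fin \<M> _ fs, where w = "\<lambda>x. 1"])
      have "(\<Union>i. C i) \<in> sets borel" using union(2) by auto
      then show "square_int M (indicator (\<Union>i. C i))" if "M \<in> \<M>" for M by (rule ind[OF that])
      show "\<bar>indicator (\<Union>i<n. C i) x\<bar> \<le> (1::real)" for n x by (simp add: indicator_def)
      show "(\<lambda>n. indicator (\<Union>i<n. C i) x) \<longlonglongrightarrow> (indicator (\<Union>i. C i) x :: real)" for x
        by (rule LIMSEQ_indicator_UN)
    qed (auto intro: one)
  qed
qed

lemma poly_approximable_square_int:
  assumes \<M>: "\<And>M. M \<in> \<M> \<Longrightarrow> unit_interval_measure M" and fin: "finite \<M>"
    and f: "\<And>M. M \<in> \<M> \<Longrightarrow> square_int M f" and fm [measurable]: "f \<in> borel_measurable borel"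
  shows "poly_approximable \<M> f"
proof -
  obtain F where F: "\<And>i. simple_function borel (F i)" "\<And>x. (\<lambda>i. F i x) \<longlonglongrightarrow> f x"
      "\<And>i x. dist (F i x) 0 \<le> 2 * dist (f x) 0"
    using borel_measurable_implies_sequence_metric[OF fm, of 0] by auto
  show ?thesis
  proof (rule poly_approximable_limit_seq[OF fin \<M> f, where w = "\<lambda>x. 2 * \<bar>f x\<bar>" and F = F])
    show "poly_approximable \<M> (F n)" for n
    proof -
      have fi: "finite (range (F n))" using F(1)[of n] by (simp add: simple_function_def)
      have lv: "F n -` {y} \<in> sets borel" for y
      proof (cases "y \<in> range (F n)")
        case True
        then show ?thesis using F(1)[of n] by (auto simp: simple_function_def)
      next
        case False
        then have "F n -` {y} = {}" by auto
        then show ?thesis by simp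
      qed
      have "poly_approximable \<M> (\<lambda>x. \<Sum>y\<in>Y. y * indicator (F n -` {y}) x)" if "finite Y" for Y
        using that
      proof (induction Y)
        case empty
        show ?case unfolding sum.empty by (rule poly_approximable_zero[OF \<M>])
      next
        case (insert y Y)
        have "poly_approximable \<M> (\<lambda>x. y * indicator (F n -` {y}) x + (\<Sum>y\<in>Y. y * indicator (F n -` {y}) x))"
          by (intro poly_approximable_add[OF \<M>] poly_approximable_cmult poly_approximable_indicator[OF \<M> fin lv] insert)
        then show ?case unfolding sum.insert[OF insert(1,2)] .
      qed
      from this[OF fi] have "poly_approximable \<M> (\<lambda>x. \<Sum>y\<in>range (F n). y * indicator (F n -` {y}) x)" .
      moreover have "(\<lambda>x. \<Sum>y\<in>range (F n). y * indicator (F n -` {y}) x) = F n"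
      proof
        fix x
        have "(\<Sum>y\<in>range (F n). y * indicator (F n -` {y}) x) = (\<Sum>y\<in>range (F n). if y = F n x then y else 0)"
          by (intro sum.cong) (auto simp: indicator_def)
        also have "\<dots> = F n x" using fi by simp
        finally show "(\<Sum>y\<in>range (F n). y * indicator (F n -` {y}) x) = F n x" .
      qed
      ultimately show ?thesis by simp
    qed
    show "square_int M (\<lambda>x. 2 * \<bar>f x\<bar>)" if "M \<in> \<M>" for M
      using f[OF that] by (auto simp: square_int_def power_mult_distrib)
  qed (use F in \<open>auto\<close>)
qed

lemma poly_approximating_sequence:
  assumes \<M>: "\<And>M. M \<in> \<M> \<Longrightarrow> unit_interval_measure M" and fin: "finite \<M>"
    and f: "\<And>M. M \<in> \<M> \<Longrightarrow> square_int M f" and fm: "f \<in> borel_measurable borel"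
  obtains P where "\<And>M. M \<in> \<M> \<Longrightarrow> (\<lambda>n. LINT x|M. (poly (P n) x - f x)\<^sup>2) \<longlonglongrightarrow> 0"
proof -
  have "\<forall>n. \<exists>p. \<forall>M\<in>\<M>. (LINT x|M. (poly p x - f x)\<^sup>2) < 1 / real (Suc n)"
    using poly_approximable_square_int[OF \<M> fin f fm] unfolding poly_approximable_def by auto
  then obtain P where P: "\<And>n M. M \<in> \<M> \<Longrightarrow> (LINT x|M. (poly (P n) x - f x)\<^sup>2) < 1 / real (Suc n)"
    by metis
  have "(\<lambda>n. LINT x|M. (poly (P n) x - f x)\<^sup>2) \<longlonglongrightarrow> 0" if "M \<in> \<M>" for M
    using P[OF that] by (intro tendsto_sandwich[OF _ _ tendsto_const LIMSEQ_Suc[OF lim_1_over_n]])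
      (auto intro!: always_eventually less_imp_le)
  then show thesis using that by blast
qed

section \<open>Spectral measures of positive contractions\<close>

text \<open>The ratio of the binomials is the product of the factors \<open>(k - i) / (n - i)\<close> for \<open>i < m\<close>. Each of
them is within \<open>m / (n - m)\<close> of \<open>k / n\<close>, and all are bounded by 1 in absolute value.\<close>

lemma binomial_ratio_approx:
  assumes n: "n \<ge> 2 * m" "0 < n" and k: "k \<le> n"
  shows "\<bar>real (k choose m) / real (n choose m) - (real k / real n) ^ m\<bar> \<le> real m * (real m / (real n - real m))"
proof (cases "m = 0")
  case False
  then have mn: "m < n" using n by linarith
  have pr: "real (k choose m) / real (n choose m) = (\<Prod>i=0..<m. (real k - real i) / (real n - real i))"
    by (simp add: binomial_gbinomial gbinomial_prod_rev prod_dividef)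
  have "\<bar>real (k choose m) / real (n choose m) - (real k / real n) ^ m\<bar>
      = norm ((\<Prod>i=0..<m. (real k - real i) / (real n - real i)) - (\<Prod>i=0..<m. real k / real n))"
    by (simp add: pr)
  also have "\<dots> \<le> (\<Sum>i=0..<m. norm ((real k - real i) / (real n - real i) - real k / real n))"
  proof (rule norm_prod_diff)
    fix i assume "i \<in> {0..<m}"
    then have i: "real i + real m \<le> real n" "i < m" using n by auto
    have "\<bar>real k - real i\<bar> \<le> real n - real i" using i k by (auto simp: abs_if)
    moreover have "real n - real i > 0" using i mn by auto
    ultimately show "norm ((real k - real i) / (real n - real i)) \<le> 1" by (simp add: abs_divide)
  qed (use k n in auto)
  also have "\<dots> \<le> (\<Sum>i=0..<m. real m / (real n - real m))"
  proof (rule sum_mono)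
    fix i assume "i \<in> {0..<m}"
    then have i: "i < m" by auto
    have p: "real n - real i > 0" "real n > 0" "real n - real m > 0" using i mn by auto
    have "(real k - real i) / (real n - real i) - real k / real n = - (real i * (real n - real k)) / (real n * (real n - real i))"
      using p by (simp add: field_simps)
    then have "norm ((real k - real i) / (real n - real i) - real k / real n) = (real i * (real n - real k)) / (real n * (real n - real i))"
      using p k by (simp add: abs_divide abs_mult)
    also have "\<dots> \<le> (real m * real n) / (real n * (real n - real m))"
      using p k i by (intro frac_le mult_mono) auto
    also have "\<dots> = real m / (real n - real m)" using p by simp
    finally show "norm ((real k - real i) / (real n - real i) - real k / real n) \<le> real m / (real n - real m)" .
  qed
  finally show ?thesis by simp
qed simp

text \<open>The factorial moments of the Bernstein weights are exact, unlike the power moments. The reason is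
\<open>(n choose k) (k choose m) = (n choose m) (n - m choose k - m)\<close>, after which the binomial theorem
applies to \<open>x + (1 - x) = 1\<close>.\<close>

lemma bernstein_factorial_moment:
  assumes "m \<le> n"
  shows "(\<Sum>k\<le>n. smult (real (k choose m)) (bernstein_poly n k)) = smult (real (n choose m)) ([:0, 1:] ^ m)"
proof (rule poly_eq_poly_eq_iff[THEN iffD1], rule ext)
  fix x :: real
  have "poly (\<Sum>k\<le>n. smult (real (k choose m)) (bernstein_poly n k)) x
      = (\<Sum>k\<le>n. real (k choose m) * (real (n choose k) * x ^ k * (1 - x) ^ (n - k)))"
    by (simp add: poly_sum poly_bernstein_poly Bernstein_def)
  also have "\<dots> = (\<Sum>k\<in>{m..n}. real (k choose m) * (real (n choose k) * x ^ k * (1 - x) ^ (n - k)))"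
    by (intro sum.mono_neutral_right) (auto simp: not_le intro: binomial_eq_0)
  also have "\<dots> = (\<Sum>j\<le>n - m. real ((j + m) choose m) * (real (n choose (j + m)) * x ^ (j + m) * (1 - x) ^ (n - (j + m))))"
    using assms by (intro sum.reindex_bij_witness[of _ "\<lambda>j. j + m" "\<lambda>k. k - m"]) auto
  also have "\<dots> = (\<Sum>j\<le>n - m. real (n choose m) * x ^ m * (real ((n - m) choose j) * x ^ j * (1 - x) ^ (n - m - j)))"
  proof (rule sum.cong[OF refl])
    fix j assume "j \<in> {..n - m}"
    then have "(n choose (j + m)) * ((j + m) choose m) = (n choose m) * ((n - m) choose j)"
      using choose_mult[of m "j + m" n] assms by simp
    then have e: "real (n choose (j + m)) * real ((j + m) choose m) = real (n choose m) * real ((n - m) choose j)"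
      by (metis of_nat_mult)
    have "n - (j + m) = n - m - j" by simp
    then have "real ((j + m) choose m) * (real (n choose (j + m)) * x ^ (j + m) * (1 - x) ^ (n - (j + m)))
       = (real (n choose (j + m)) * real ((j + m) choose m)) * (x ^ m * x ^ j * (1 - x) ^ (n - m - j))"
      by (simp add: power_add algebra_simps)
    then show "real ((j + m) choose m) * (real (n choose (j + m)) * x ^ (j + m) * (1 - x) ^ (n - (j + m)))
       = real (n choose m) * x ^ m * (real ((n - m) choose j) * x ^ j * (1 - x) ^ (n - m - j))"
      unfolding e by simp
  qed
  also have "\<dots> = real (n choose m) * x ^ m * (x + (1 - x)) ^ (n - m)"
    unfolding binomial_ring by (simp add: sum_distrib_left)
  finally show "poly (\<Sum>k\<le>n. smult (real (k choose m)) (bernstein_poly n k)) x = poly (smult (real (n choose m)) ([:0, 1:] ^ m)) x"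
    by simp
qed

text \<open>A symmetric operator with \<open>0 \<le> R \<le> 1\<close>. Real Hilbert spaces suffice: a complex structure enters only
through an operator that commutes with \<open>R\<close>.\<close>

locale positive_contraction =
  fixes R :: "'a::{real_inner,complete_space} \<Rightarrow> 'a"
  assumes bounded_linear_R: "bounded_linear R"
    and R_sym: "inner (R u) v = inner u (R v)"
    and R_nonneg: "0 \<le> inner u (R u)"
    and R_le: "inner u (R u) \<le> inner u u"
begin

lemmas R_add = linear_add[OF bounded_linear.linear[OF bounded_linear_R]]
lemmas R_scale = linear_scale[OF bounded_linear.linear[OF bounded_linear_R]]
lemmas R_zero = linear_0[OF bounded_linear.linear[OF bounded_linear_R]]

definition poly_op :: "real poly \<Rightarrow> 'a \<Rightarrow> 'a" where
  "poly_op p u = fold_coeffs (\<lambda>a v. a *\<^sub>R u + R v) p 0"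

lemma poly_op_0 [simp]: "poly_op 0 u = 0"
  by (simp add: poly_op_def)

lemma poly_op_pCons [simp]: "poly_op (pCons a p) u = a *\<^sub>R u + R (poly_op p u)"
  by (cases "p = 0 \<and> a = 0") (auto simp: poly_op_def R_zero)

lemma poly_op_1 [simp]: "poly_op 1 u = u"
  by (simp add: one_pCons R_zero)

lemma poly_op_add: "poly_op (p + q) u = poly_op p u + poly_op q u"
  by (induction p q rule: poly_induct2) (auto simp: R_add algebra_simps)

lemma poly_op_smult: "poly_op (smult c p) u = c *\<^sub>R poly_op p u"
  by (induction p) (auto simp: R_scale algebra_simps)

lemma poly_op_diff: "poly_op (p - q) u = poly_op p u - poly_op q u"
  using poly_op_add[of p "smult (-1) q" u] poly_op_smult[of "-1" q u] by simp

lemma poly_op_R: "poly_op p (R u) = R (poly_op p u)"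
  by (induction p) (auto simp: R_add R_scale R_zero)

lemma poly_op_mult: "poly_op (p * q) u = poly_op p (poly_op q u)"
  by (induction p) (auto simp: poly_op_add poly_op_smult)

lemma poly_op_sum: "poly_op (\<Sum>i\<in>I. f i) u = (\<Sum>i\<in>I. poly_op (f i) u)"
  by (induction I rule: infinite_finite_induct) (auto simp: poly_op_add)

lemma poly_op_linear:
  "poly_op p (u + v) = poly_op p u + poly_op p v" "poly_op p (c *\<^sub>R u) = c *\<^sub>R poly_op p u"
  by (induction p) (auto simp: R_add R_scale algebra_simps)

lemma poly_op_sym: "inner (poly_op p u) v = inner u (poly_op p v)"
  by (induction p arbitrary: u v)
     (auto simp: inner_add_left inner_add_right R_sym poly_op_R[symmetric])

lemma inner_poly_op_square: "inner u (poly_op (s * s * r) u) = inner (poly_op s u) (poly_op r (poly_op s u))"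
proof -
  have "s * s * r = s * (r * s)" by (simp add: algebra_simps)
  then show ?thesis by (simp only: poly_op_mult poly_op_sym)
qed

text \<open>Up to a square the exponents may be taken to be 0 or 1. The product \<open>X (1 - X)\<close> is the only case that is
not immediate: it equals \<open>X\<^sup>2 (1 - X) + (1 - X)\<^sup>2 X\<close>, so that no square roots of operators are needed.\<close>

lemma poly_op_XY_nonneg: "0 \<le> inner u (poly_op ([:0, 1:] ^ k * [:1, -1:] ^ l) u)"
proof -
  let ?X = "[:0, 1:] :: real poly" and ?Y = "[:1, -1:] :: real poly"
  let ?s = "?X ^ (k div 2) * ?Y ^ (l div 2)"
  have X: "0 \<le> inner v (poly_op ?X v)" for v by (simp add: R_nonneg R_zero)
  have Y: "0 \<le> inner v (poly_op ?Y v)" for v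
    using R_le[of v] by (simp add: R_zero inner_diff_right linear_neg[OF bounded_linear.linear[OF bounded_linear_R]])
  have XY: "0 \<le> inner v (poly_op (?X * ?Y) v)" for v
  proof -
    have "?X * ?Y = ?X * ?X * ?Y + ?Y * ?Y * ?X" by simp
    then have "inner v (poly_op (?X * ?Y) v) = inner v (poly_op (?X * ?X * ?Y) v) + inner v (poly_op (?Y * ?Y * ?X) v)"
      by (metis poly_op_add inner_add_right)
    then show ?thesis unfolding inner_poly_op_square using X Y by (metis add_nonneg_nonneg)
  qed
  have "?X ^ k = ?X ^ (k div 2) * ?X ^ (k div 2) * ?X ^ (k mod 2)"
    by (metis mult_2 mult_div_mod_eq power_add)
  moreover have "?Y ^ l = ?Y ^ (l div 2) * ?Y ^ (l div 2) * ?Y ^ (l mod 2)"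
    by (metis mult_2 mult_div_mod_eq power_add)
  ultimately have "?X ^ k * ?Y ^ l = ?s * ?s * (?X ^ (k mod 2) * ?Y ^ (l mod 2))"
    by (simp only: mult_ac)
  then have "inner u (poly_op (?X ^ k * ?Y ^ l) u) = inner (poly_op ?s u) (poly_op (?X ^ (k mod 2) * ?Y ^ (l mod 2)) (poly_op ?s u))"
    using inner_poly_op_square by metis
  moreover have "0 \<le> inner v (poly_op (?X ^ (k mod 2) * ?Y ^ (l mod 2)) v)" for v
  proof -
    consider "k mod 2 = 0" "l mod 2 = 0" | "k mod 2 = 1" "l mod 2 = 0" | "k mod 2 = 0" "l mod 2 = 1" | "k mod 2 = 1" "l mod 2 = 1"
      by linarith
    then show ?thesis
    proof cases
      case 1
      then show ?thesis by simp
    next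
      case 2
      then show ?thesis using X[of v] by (simp only: power_0 power_one_right mult_1_right)
    next
      case 3
      then show ?thesis using Y[of v] by (simp only: power_0 power_one_right mult_1_left)
    next
      case 4
      then show ?thesis using XY[of v] by (simp only: power_one_right)
    qed
  qed
  ultimately show ?thesis by metis
qed

lemma bernstein_weight_nonneg: "0 \<le> inner u (poly_op (bernstein_poly n k) u)"
  using poly_op_XY_nonneg[of u k "n - k"] by (simp add: bernstein_poly_def poly_op_smult)

lemma bernstein_weight_moment:
  assumes "m \<le> n"
  shows "(\<Sum>k\<le>n. real (k choose m) * inner u (poly_op (bernstein_poly n k) u)) = real (n choose m) * inner u (poly_op ([:0, 1:] ^ m) u)"
proof -
  have "(\<Sum>k\<le>n. real (k choose m) * inner u (poly_op (bernstein_poly n k) u))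
      = inner u (poly_op (\<Sum>k\<le>n. smult (real (k choose m)) (bernstein_poly n k)) u)"
    by (simp add: poly_op_sum poly_op_smult inner_sum_right)
  then show ?thesis by (simp only: bernstein_factorial_moment[OF assms] poly_op_smult inner_scaleR_right)
qed

lemma bernstein_moment_limit:
  assumes u: "norm u = 1"
  shows "(\<lambda>n. \<Sum>k\<le>n. inner u (poly_op (bernstein_poly n k) u) * (real k / real n) ^ m)
     \<longlonglongrightarrow> inner u (poly_op ([:0, 1:] ^ m) u)"
proof -
  let ?w = "\<lambda>n k. inner u (poly_op (bernstein_poly n k) u)"
  let ?L = "inner u (poly_op ([:0, 1:] ^ m) u)"
  have w1: "(\<Sum>k\<le>n. ?w n k) = 1" for n
    using bernstein_weight_moment[of 0 n u] u by (simp add: dot_square_norm)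
  have bd: "norm ((\<Sum>k\<le>n. ?w n k * (real k / real n) ^ m) - ?L) \<le> real m * (real m / (real n - real m))"
    if n: "n \<ge> 2 * m + 1" for n
  proof -
    have "real (n choose m) \<noteq> 0" using n by simp
    then have "?L = (\<Sum>k\<le>n. ?w n k * (real (k choose m) / real (n choose m)))"
      using bernstein_weight_moment[of m n u] n
      by (simp add: sum_divide_distrib[symmetric] mult.commute field_simps)
    then have "norm ((\<Sum>k\<le>n. ?w n k * (real k / real n) ^ m) - ?L) =
       norm (\<Sum>k\<le>n. ?w n k * ((real k / real n) ^ m - real (k choose m) / real (n choose m)))"
      by (simp add: sum_subtractf right_diff_distrib)
    also have "\<dots> \<le> (\<Sum>k\<le>n. ?w n k * (real m * (real m / (real n - real m))))"
    proof (rule sum_norm_le)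
      fix k assume "k \<in> {..n}"
      then have "\<bar>(real k / real n) ^ m - real (k choose m) / real (n choose m)\<bar> \<le> real m * (real m / (real n - real m))"
        using binomial_ratio_approx[of m n k] n by (simp add: abs_minus_commute)
      then show "norm (?w n k * ((real k / real n) ^ m - real (k choose m) / real (n choose m))) \<le> ?w n k * (real m * (real m / (real n - real m)))"
        unfolding norm_mult using bernstein_weight_nonneg[of u n k] by (simp add: mult_left_mono del: times_divide_eq_right)
    qed
    also have "\<dots> = real m * (real m / (real n - real m))" by (simp only: sum_distrib_right[symmetric] w1 mult_1_left)
    finally show ?thesis .
  qed
  have "(\<lambda>n. real m * (real m / (real n - real m))) \<longlonglongrightarrow> 0"
  proof -
    have "filterlim (\<lambda>n. - real m + real n) at_top sequentially"
      by (rule filterlim_tendsto_add_at_top[OF tendsto_const filterlim_real_sequentially])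
    then have "(\<lambda>n. real m / (- real m + real n)) \<longlonglongrightarrow> 0"
      by (intro tendsto_divide_0[OF tendsto_const] filterlim_at_top_imp_at_infinity)
    then have "(\<lambda>n. real m / (real n - real m)) \<longlonglongrightarrow> 0" by simp
    then show ?thesis by (rule tendsto_mult_right_zero)
  qed
  then have "(\<lambda>n. (\<Sum>k\<le>n. ?w n k * (real k / real n) ^ m) - ?L) \<longlonglongrightarrow> 0"
    by (rule Lim_null_comparison[rotated]) (rule eventually_sequentiallyI[of "2 * m + 1"], rule bd)
  then show ?thesis by (simp add: LIM_zero_iff)
qed

end

context positive_contraction
begin

text \<open>The Bernstein weights of order \<open>n\<close>, placed at the points \<open>k / n\<close>, form a probability measure. All these
measures live on the unit interval, so that Helly's theorem yields a weak limit, whose moments are the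
limits of the moments of the sequence.\<close>

lemma unit_vector_moment_measure:
  assumes u: "norm u = 1"
  obtains M where "unit_interval_measure M" "\<And>m. (LINT x|M. x ^ m) = inner u (poly_op ([:0, 1:] ^ m) u)"
proof -
  define w where "w n k = inner u (poly_op (bernstein_poly n k) u)" for n k
  have w0: "0 \<le> w n k" for n k by (simp add: w_def bernstein_weight_nonneg)
  have w1: "(\<Sum>k\<le>n. w n k) = 1" for n
    using bernstein_weight_moment[of 0 n u] u by (simp add: w_def dot_square_norm)
  define N where "N n = point_measure {..n} (\<lambda>k. ennreal (w n k))" for n
  define \<mu> where "\<mu> n = distr (N n) borel (\<lambda>k. real k / real n)" for n
  have spN: "space (N n) = {..n}" for n by (simp add: N_def space_point_measure)
  have psN: "prob_space (N n)" for n
  proof (rule prob_spaceI)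
    have "emeasure (N n) {..n} = (\<Sum>k\<le>n. ennreal (w n k))"
      unfolding N_def by (rule emeasure_point_measure_finite) auto
    also have "\<dots> = ennreal (\<Sum>k\<le>n. w n k)" by (rule sum_ennreal) (simp add: w0)
    finally show "emeasure (N n) (space (N n)) = 1" by (simp add: spN w1)
  qed
  have meas: "(\<lambda>k. real k / real n) \<in> measurable (N n) borel" for n
    by (simp add: N_def)
  have rd: "real_distribution (\<mu> n)" for n
    unfolding real_distribution_def real_distribution_axioms_def
    using prob_space.prob_space_distr[OF psN meas] by (simp add: \<mu>_def)
  have int: "(LINT x|\<mu> n. f x) = (\<Sum>k\<le>n. w n k * f (real k / real n))" if "f \<in> borel_measurable borel" for f :: "real \<Rightarrow> real" and n
  proof -
    have "(LINT x|\<mu> n. f x) = (LINT k|N n. f (real k / real n))"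
      unfolding \<mu>_def by (rule integral_distr[OF meas that])
    also have "\<dots> = (\<Sum>k\<le>n. w n k * f (real k / real n))"
      unfolding N_def by (subst lebesgue_integral_point_measure_finite) (auto simp: w0)
    finally show ?thesis .
  qed
  have m1: "measure (\<mu> n) {-1<..2} = 1" for n
  proof -
    have "(\<lambda>k. real k / real n) -` {-1<..2} \<inter> space (N n) = space (N n)"
    proof -
      have "-1 < real k / real n \<and> real k / real n \<le> 2" if "k \<le> n" for k
      proof -
        have "0 \<le> real k / real n" "real k / real n \<le> 1" using that by (auto simp: divide_le_eq_1)
        then show ?thesis by linarith
      qed
      then show ?thesis by (auto simp: spN)
    qed
    then show ?thesis unfolding \<mu>_def
      by (subst measure_distr[OF meas]) (auto intro: prob_space.prob_space[OF psN])
  qed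
  have "tight \<mu>"
    unfolding tight_def
  proof (intro conjI allI impI rd)
    fix e :: real assume "0 < e"
    then show "\<exists>a b. a < b \<and> (\<forall>n. measure (\<mu> n) {a<..b} > 1 - e)"
      using m1 by (intro exI[of _ "-1"] exI[of _ 2]) auto
  qed
  then obtain r M where r: "strict_mono r" and M: "real_distribution M" and wc: "weak_conv_m (\<mu> \<circ> id \<circ> r) M"
    using tight_imp_convergent_subsubsequence[of \<mu> id] by (auto simp: strict_mono_def)
  interpret M: real_distribution M by fact
  have conv: "(\<lambda>n. LINT x|\<mu> (r n). f x) \<longlonglongrightarrow> (LINT x|M. f x)"
    if "continuous_on UNIV f" "\<And>x. norm (f x) \<le> B" for f :: "real \<Rightarrow> real" and B
    using weak_conv_imp_integral_bdd_continuous_conv[of "\<lambda>n. \<mu> (r n)" M f B] rd M wc that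
    by (simp add: comp_def continuous_on_eq_continuous_at)
  have k01: "0 \<le> real k / real n" "real k / real n \<le> 1" if "k \<le> n" for k n
    using that by (auto simp: divide_le_eq_1)
  have ae: "AE x in M. x \<in> {0..1}"
  proof -
    \<comment> \<open>a bounded continuous function that vanishes exactly on the unit interval\<close>
    let ?f = "\<lambda>x. min 1 (infdist x {0..1::real})"
    have c: "continuous_on UNIV ?f" by (intro continuous_intros)
    have f01: "0 \<le> ?f x" "?f x \<le> 1" for x by (auto simp: infdist_nonneg)
    have m: "?f \<in> borel_measurable borel" by (rule borel_measurable_continuous_onI[OF c])
    have "(LINT x|\<mu> n. ?f x) = 0" for n
    proof -
      have "(\<Sum>k\<le>n. w n k * ?f (real k / real n)) = 0"
        by (intro sum.neutral ballI) (simp add: k01)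
      then show ?thesis using int[OF m] by simp
    qed
    have z: "(LINT x|M. ?f x) = 0"
    proof -
      have "norm (?f x) \<le> 1" for x using f01[of x] unfolding real_norm_def by linarith
      then have "(\<lambda>n. LINT x|\<mu> (r n). ?f x) \<longlonglongrightarrow> (LINT x|M. ?f x)" by (rule conv[OF c])
      then show ?thesis using \<open>\<And>n. (LINT x|\<mu> n. ?f x) = 0\<close> by (simp only: LIMSEQ_const_iff)
    qed
    have "integrable M ?f"
      using m f01 by (intro M.integrable_const_bound[where B = 1]) (auto intro!: AE_I2)
    then have "AE x in M. ?f x = 0"
      using z f01 by (subst integral_nonneg_eq_0_iff_AE[symmetric]) auto
    then show ?thesis
    proof eventually_elim
      case (elim x)
      then have "infdist x {0..1} = 0" by (auto simp: min_def split: if_splits)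
      then show ?case using in_closed_iff_infdist_zero[of "{0..1::real}" x] by auto
    qed
  qed
  have mom: "(LINT x|M. x ^ m) = inner u (poly_op ([:0, 1:] ^ m) u)" for m
  proof -
    \<comment> \<open>clamping makes the power bounded without changing it on the unit interval\<close>
    let ?c = "\<lambda>x. (max 0 (min 1 x)) ^ m :: real"
    have c: "continuous_on UNIV ?c" by (intro continuous_intros)
    have b: "norm (?c x) \<le> 1" for x by (auto intro!: power_le_one)
    have m: "?c \<in> borel_measurable borel" by (rule borel_measurable_continuous_onI[OF c])
    have "(LINT x|\<mu> n. ?c x) = (\<Sum>k\<le>n. w n k * (real k / real n) ^ m)" for n
      unfolding int[OF m] by (intro sum.cong refl) (simp add: k01 min_absorb2 max_absorb2)
    then have "(\<lambda>n. LINT x|\<mu> (r n). ?c x) \<longlonglongrightarrow> inner u (poly_op ([:0, 1:] ^ m) u)"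
      using LIMSEQ_subseq_LIMSEQ[OF bernstein_moment_limit[OF u, of m] r] by (simp add: comp_def w_def)
    then have "(LINT x|M. ?c x) = inner u (poly_op ([:0, 1:] ^ m) u)"
      using conv[OF c b] LIMSEQ_unique by blast
    moreover have "(LINT x|M. ?c x) = (LINT x|M. x ^ m)"
    proof (rule integral_cong_AE)
      show "AE x in M. ?c x = x ^ m" using ae by eventually_elim auto
    qed (use m in auto)
    ultimately show ?thesis by simp
  qed
  have "unit_interval_measure M"
    using ae M.finite_measure_axioms by (simp add: unit_interval_measure_def)
  then show thesis using that mom by blast
qed

lemma integral_poly_moments:
  assumes M: "unit_interval_measure M"
  shows "(LINT x|M. poly p x) = (\<Sum>i\<le>degree p. coeff p i * (LINT x|M. x ^ i))"
proof -
  interpret finite_measure M using M by (simp add: unit_interval_measure_def)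
  have s [measurable_cong]: "sets M = sets borel" using M by (simp add: unit_interval_measure_def)
  have "integrable M (\<lambda>x. x ^ i)" for i
  proof (rule integrable_const_bound[where B = 1])
    have "AE x in M. x \<in> {0..1}" using M by (simp add: unit_interval_measure_def)
    then show "AE x in M. norm (x ^ i) \<le> 1"
      by eventually_elim (auto intro!: power_le_one)
  qed measurable
  then show ?thesis by (simp add: poly_altdef)
qed

text \<open>A general vector is reduced to a unit vector by scaling the measure with the squared norm.\<close>

lemma moment_measure_exists:
  "\<exists>M. unit_interval_measure M \<and> (\<forall>p. (LINT x|M. poly p x) = inner u (poly_op p u))"
proof -
  have *: "\<exists>M. unit_interval_measure M \<and> (\<forall>m. (LINT x|M. x ^ m) = inner u (poly_op ([:0, 1:] ^ m) u))"
  proof (cases "u = 0")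
    case True
    have ae0: "AE x in null_measure borel. P x" for P :: "real \<Rightarrow> bool"
      by (rule AE_I'[of UNIV]) (auto simp: null_sets_def)
    have "unit_interval_measure (null_measure borel)"
      unfolding unit_interval_measure_def by (intro conjI ae0 finite_measureI) simp_all
    moreover have "(LINT x|null_measure borel. (x::real) ^ m) = 0" for m :: nat
      by (rule integral_eq_zero_AE) (rule ae0)
    ultimately show ?thesis
      by (intro exI[of _ "null_measure borel"]) (simp add: True)
  next
    case False
    let ?v = "u /\<^sub>R norm u" and ?c = "(norm u)\<^sup>2"
    have "norm ?v = 1" using False by simp
    then obtain N where N: "unit_interval_measure N" "\<And>m. (LINT x|N. x ^ m) = inner ?v (poly_op ([:0, 1:] ^ m) ?v)"
      using unit_vector_moment_measure by metis
    have s [measurable_cong]: "sets N = sets borel" using N(1) by (simp add: unit_interval_measure_def)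
    interpret finite_measure N using N(1) by (simp add: unit_interval_measure_def)
    define M where "M = density N (\<lambda>_. ennreal ?c)"
    have "unit_interval_measure M"
      unfolding unit_interval_measure_def
    proof (intro conjI)
      show "finite_measure M"
        by (rule finite_measureI) (simp add: M_def emeasure_density nn_integral_cmult_indicator ennreal_mult_eq_top_iff)
      show "sets M = sets borel" by (simp add: M_def s)
      show "AE x in M. x \<in> {0..1}"
        using N(1) unfolding M_def unit_interval_measure_def by (subst AE_density) auto
    qed
    moreover have "(LINT x|M. x ^ m) = inner u (poly_op ([:0, 1:] ^ m) u)" for m
    proof -
      have "(LINT x|M. x ^ m) = ?c * (LINT x|N. x ^ m)"
        unfolding M_def by (subst integral_density) auto
      also have "\<dots> = inner u (poly_op ([:0, 1:] ^ m) u)"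
        unfolding N(2) using False by (simp add: poly_op_linear power2_eq_square field_simps)
      finally show ?thesis .
    qed
    ultimately show ?thesis by blast
  qed
  then obtain M where M: "unit_interval_measure M" "\<And>m. (LINT x|M. x ^ m) = inner u (poly_op ([:0, 1:] ^ m) u)" by blast
  have "(LINT x|M. poly p x) = inner u (poly_op p u)" for p
  proof -
    have "poly_op p u = (\<Sum>i\<le>degree p. coeff p i *\<^sub>R poly_op ([:0, 1:] ^ i) u)"
      by (subst poly_as_sum_of_monoms[of p, symmetric]) (simp only: poly_op_sum monom_altdef poly_op_smult)
    then show ?thesis by (simp add: integral_poly_moments[OF M(1)] M(2) inner_sum_right)
  qed
  with M(1) show ?thesis by blast
qed

text \<open>A solution of the moment problem for \<open>u\<close>, the spectral measure of \<open>R\<close> at \<open>u\<close>.\<close>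

definition \<mu> :: "'a \<Rightarrow> real measure" where
  "\<mu> u = (SOME M. unit_interval_measure M \<and> (\<forall>p. (LINT x|M. poly p x) = inner u (poly_op p u)))"

lemma \<mu>_unit: "unit_interval_measure (\<mu> u)"
  and \<mu>_poly: "(LINT x|\<mu> u. poly p x) = inner u (poly_op p u)"
  using someI_ex[OF moment_measure_exists[of u]] by (auto simp: \<mu>_def)

lemma \<mu>_sets [measurable_cong, simp]: "sets (\<mu> u) = sets borel"
  using \<mu>_unit[of u] by (simp add: unit_interval_measure_def)

lemma \<mu>_space [simp]: "space (\<mu> u) = UNIV"
  using sets_eq_imp_space_eq[OF \<mu>_sets[of u]] by simp

lemma \<mu>_finite: "finite_measure (\<mu> u)"
  using \<mu>_unit[of u] by (simp add: unit_interval_measure_def)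

lemma \<mu>_AE: "AE x in \<mu> u. x \<in> {0..1}"
  using \<mu>_unit[of u] by (simp add: unit_interval_measure_def)

lemma inner_poly_op: "inner (poly_op p u) (poly_op q u) = (LINT x|\<mu> u. poly p x * poly q x)"
proof -
  have "(LINT x|\<mu> u. poly (p * q) x) = inner u (poly_op (p * q) u)" by (rule \<mu>_poly)
  then show ?thesis by (simp add: poly_op_mult poly_op_sym)
qed

lemma norm_poly_op_diff: "(norm (poly_op p u - poly_op q u))\<^sup>2 = (LINT x|\<mu> u. (poly p x - poly q x)\<^sup>2)"
  using inner_poly_op[of "p - q" u "p - q"]
  by (simp add: poly_op_diff power2_norm_eq_inner) (simp add: power2_eq_square)

definition approximates :: "'a \<Rightarrow> (real \<Rightarrow> real) \<Rightarrow> (nat \<Rightarrow> real poly) \<Rightarrow> bool" where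
  "approximates u f P \<longleftrightarrow> (\<lambda>n. LINT x|\<mu> u. (poly (P n) x - f x)\<^sup>2) \<longlonglongrightarrow> 0"

text \<open>The vector \<open>f(R) u\<close>, for a fixed vector \<open>u\<close> and an \<open>f\<close> in \<open>L\<^sup>2(\<mu>\<^sub>u)\<close> that may be unbounded. The map
\<open>p \<mapsto> p(R) u\<close> is isometric for the norm of \<open>L\<^sup>2(\<mu>\<^sub>u)\<close> by \<open>norm_poly_op_diff\<close>, and this is its
continuous extension.\<close>

definition fun_calc :: "(real \<Rightarrow> real) \<Rightarrow> 'a \<Rightarrow> 'a" where
  "fun_calc f u = (SOME v. \<exists>P. approximates u f P \<and> (\<lambda>n. poly_op (P n) u) \<longlonglongrightarrow> v)"

lemma poly_op_diff_le:
  assumes "square_int (\<mu> u) f"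
  shows "(norm (poly_op p u - poly_op q u))\<^sup>2 \<le> 2 * (LINT x|\<mu> u. (poly p x - f x)\<^sup>2) + 2 * (LINT x|\<mu> u. (poly q x - f x)\<^sup>2)"
  using integral_square_diff_triangle[OF \<mu>_sets square_int_poly[OF \<mu>_unit] assms square_int_poly[OF \<mu>_unit], of p q]
  by (simp add: norm_poly_op_diff power2_commute[of "f _"])

lemma approximates_exists:
  assumes "square_int (\<mu> u) f"
  obtains P where "approximates u f P"
  using poly_approximating_sequence[of "{\<mu> u}" f] assms \<mu>_unit
  unfolding approximates_def square_int_def by auto

lemma approximates_convergent:
  assumes f: "square_int (\<mu> u) f" and P: "approximates u f P"
  shows "convergent (\<lambda>n. poly_op (P n) u)"
proof -
  have "Cauchy (\<lambda>n. poly_op (P n) u)"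
  proof (rule metric_CauchyI)
    fix e :: real assume e: "e > 0"
    have "eventually (\<lambda>n. (LINT x|\<mu> u. (poly (P n) x - f x)\<^sup>2) < e\<^sup>2 / 4) sequentially"
      using P e unfolding approximates_def by (intro order_tendstoD) auto
    then obtain N where N: "\<And>n. n \<ge> N \<Longrightarrow> (LINT x|\<mu> u. (poly (P n) x - f x)\<^sup>2) < e\<^sup>2 / 4"
      unfolding eventually_sequentially by blast
    have "dist (poly_op (P m) u) (poly_op (P n) u) < e" if "m \<ge> N" "n \<ge> N" for m n
    proof -
      have "(norm (poly_op (P m) u - poly_op (P n) u))\<^sup>2 < e\<^sup>2"
        using poly_op_diff_le[OF f, of "P m" "P n"] N[OF that(1)] N[OF that(2)] by linarith
      then show ?thesis using e by (simp add: dist_norm power2_less_imp_less)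
    qed
    then show "\<exists>M. \<forall>m\<ge>M. \<forall>n\<ge>M. dist (poly_op (P m) u) (poly_op (P n) u) < e" by blast
  qed
  then show ?thesis by (simp add: Cauchy_convergent_iff)
qed

lemma fun_calc_limit:
  assumes f: "square_int (\<mu> u) f" and P: "approximates u f P"
  shows "(\<lambda>n. poly_op (P n) u) \<longlonglongrightarrow> fun_calc f u"
proof -
  obtain v where "(\<lambda>n. poly_op (P n) u) \<longlonglongrightarrow> v"
    using approximates_convergent[OF f P] by (auto simp: convergent_def)
  then have "\<exists>v. \<exists>P. approximates u f P \<and> (\<lambda>n. poly_op (P n) u) \<longlonglongrightarrow> v"
    using P by blast
  from someI_ex[OF this] obtain Q where Q: "approximates u f Q" "(\<lambda>n. poly_op (Q n) u) \<longlonglongrightarrow> fun_calc f u"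
    unfolding fun_calc_def by blast
  have "(\<lambda>n. (norm (poly_op (P n) u - poly_op (Q n) u))\<^sup>2) \<longlonglongrightarrow> 0"
  proof (rule tendsto_sandwich[OF _ _ tendsto_const])
    show "(\<lambda>n. 2 * (LINT x|\<mu> u. (poly (P n) x - f x)\<^sup>2) + 2 * (LINT x|\<mu> u. (poly (Q n) x - f x)\<^sup>2)) \<longlonglongrightarrow> 0"
      using P Q(1) unfolding approximates_def by (intro tendsto_add_zero tendsto_mult_right_zero)
  qed (auto intro!: always_eventually poly_op_diff_le[OF f])
  then have "(\<lambda>n. sqrt ((norm (poly_op (P n) u - poly_op (Q n) u))\<^sup>2)) \<longlonglongrightarrow> sqrt 0" by (rule tendsto_real_sqrt)
  then have "(\<lambda>n. poly_op (P n) u - poly_op (Q n) u) \<longlonglongrightarrow> 0" by (simp add: tendsto_norm_zero_iff)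
  from tendsto_add[OF this Q(2)] show ?thesis by simp
qed

lemma inner_fun_calc:
  assumes f: "square_int (\<mu> u) f" and g: "square_int (\<mu> u) g"
  shows "inner (fun_calc f u) (fun_calc g u) = (LINT x|\<mu> u. f x * g x)"
proof -
  obtain P where P: "approximates u f P" using approximates_exists[OF f] .
  obtain Q where Q: "approximates u g Q" using approximates_exists[OF g] .
  have "(\<lambda>n. inner (poly_op (P n) u) (poly_op (Q n) u)) \<longlonglongrightarrow> inner (fun_calc f u) (fun_calc g u)"
    by (intro tendsto_inner fun_calc_limit f g P Q)
  moreover have "(\<lambda>n. inner (poly_op (P n) u) (poly_op (Q n) u)) \<longlonglongrightarrow> (LINT x|\<mu> u. f x * g x)"
    unfolding inner_poly_op
    by (rule tendsto_integral_mult_L2[OF \<mu>_sets f square_int_poly[OF \<mu>_unit] g square_int_poly[OF \<mu>_unit]])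
       (use P Q in \<open>auto simp: approximates_def\<close>)
  ultimately show ?thesis by (rule LIMSEQ_unique)
qed

lemma norm_fun_calc_diff:
  assumes f: "square_int (\<mu> u) f" and g: "square_int (\<mu> u) g"
  shows "(norm (fun_calc f u - fun_calc g u))\<^sup>2 = (LINT x|\<mu> u. (f x - g x)\<^sup>2)"
proof -
  note i = square_int_mult_integrable[OF \<mu>_sets]
  have "(norm (fun_calc f u - fun_calc g u))\<^sup>2 = inner (fun_calc f u) (fun_calc f u) - 2 * inner (fun_calc f u) (fun_calc g u) + inner (fun_calc g u) (fun_calc g u)"
    by (simp add: power2_norm_eq_inner inner_diff inner_commute)
  also have "\<dots> = (LINT x|\<mu> u. f x * f x - 2 * (f x * g x) + g x * g x)"
    using i[OF f f] i[OF f g] i[OF g g] by (simp add: inner_fun_calc f g)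
  also have "\<dots> = (LINT x|\<mu> u. (f x - g x)\<^sup>2)"
    by (intro Bochner_Integration.integral_cong) (auto simp: power2_eq_square algebra_simps)
  finally show ?thesis .
qed

lemma fun_calc_cong_AE:
  assumes f: "square_int (\<mu> u) f" and g: "square_int (\<mu> u) g" and eq: "AE x in \<mu> u. f x = g x"
  shows "fun_calc f u = fun_calc g u"
proof -
  have [measurable]: "f \<in> borel_measurable borel" "g \<in> borel_measurable borel" using f g by (auto simp: square_int_def)
  have "(LINT x|\<mu> u. (f x - g x)\<^sup>2) = (LINT x|\<mu> u. 0)"
    using eq by (intro integral_cong_AE) auto
  then show ?thesis using norm_fun_calc_diff[OF f g] by simp
qed

lemma fun_calc_poly: "fun_calc (poly p) u = poly_op p u"
proof -
  have "approximates u (poly p) (\<lambda>n. p)" by (simp add: approximates_def)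
  from fun_calc_limit[OF square_int_poly[OF \<mu>_unit] this] show ?thesis
    by (simp add: LIMSEQ_const_iff)
qed

lemma fun_calc_1: "fun_calc (\<lambda>x. 1) u = u"
proof -
  have "poly (1 :: real poly) = (\<lambda>x. 1)" by auto
  then show ?thesis using fun_calc_poly[of 1 u] by simp
qed

lemma fun_calc_id: "fun_calc (\<lambda>x. x) u = R u"
proof -
  have "poly ([:0, 1:] :: real poly) = (\<lambda>x. x)" by auto
  then show ?thesis using fun_calc_poly[of "[:0, 1:]" u] by (simp add: R_zero)
qed

lemma fun_calc_0: "fun_calc (\<lambda>x. 0) u = 0"
proof -
  have "poly (0 :: real poly) = (\<lambda>x. 0)" by auto
  then show ?thesis using fun_calc_poly[of 0 u] by simp
qed

lemma square_int_bounded_mult: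
  assumes f: "square_int (\<mu> u) f" and g: "g \<in> borel_measurable borel" "\<And>x. x \<in> {0..1} \<Longrightarrow> \<bar>g x\<bar> \<le> B"
  shows "square_int (\<mu> u) (\<lambda>x. g x * f x)"
proof -
  have [measurable]: "f \<in> borel_measurable borel" "g \<in> borel_measurable borel" using f g by (auto simp: square_int_def)
  have "integrable (\<mu> u) (\<lambda>x. (g x * f x)\<^sup>2)"
  proof (rule Bochner_Integration.integrable_bound)
    show "integrable (\<mu> u) (\<lambda>x. B\<^sup>2 * (f x)\<^sup>2)" using f by (simp add: square_int_def)
    show "AE x in \<mu> u. norm ((g x * f x)\<^sup>2) \<le> norm (B\<^sup>2 * (f x)\<^sup>2)"
      using \<mu>_AE
    proof eventually_elim
      case (elim x)
      have "\<bar>g x\<bar>\<^sup>2 \<le> B\<^sup>2" using g(2)[OF elim] by (intro power_mono) auto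
      then have "(g x)\<^sup>2 * (f x)\<^sup>2 \<le> B\<^sup>2 * (f x)\<^sup>2" by (intro mult_right_mono) auto
      then show ?case by (simp add: power_mult_distrib)
    qed
  qed measurable
  then show ?thesis by (simp add: square_int_def)
qed

lemma poly_bounded_unit_interval:
  obtains B where "\<And>x. x \<in> {0..1} \<Longrightarrow> \<bar>poly p x\<bar> \<le> (B::real)"
proof -
  have "compact (poly p ` {0..1})" by (intro compact_continuous_image continuous_intros) auto
  then have "bounded (poly p ` {0..1})" by (rule compact_imp_bounded)
  then obtain B where "\<forall>x\<in>{0..1}. \<bar>poly p x\<bar> \<le> B" by (auto simp: bounded_iff)
  then show thesis by (intro that[of B]) blast
qed

text \<open>A polynomial is bounded on the unit interval, so multiplication with it preserves approximation in
\<open>L\<^sup>2(\<mu>\<^sub>u)\<close>.\<close>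

lemma poly_op_fun_calc:
  assumes f: "square_int (\<mu> u) f"
  shows "poly_op p (fun_calc f u) = fun_calc (\<lambda>x. poly p x * f x) u"
proof -
  obtain B where B: "\<And>x. x \<in> {0..1} \<Longrightarrow> \<bar>poly p x\<bar> \<le> B" using poly_bounded_unit_interval[of p] by blast
  have pf: "square_int (\<mu> u) (\<lambda>x. poly p x * f x)" by (rule square_int_bounded_mult[OF f borel_measurable_poly B])
  obtain P where P: "approximates u f P" using approximates_exists[OF f] .
  have "approximates u (\<lambda>x. poly p x * f x) (\<lambda>n. p * P n)"
    unfolding approximates_def
  proof (rule tendsto_sandwich[OF _ _ tendsto_const])
    show "(\<lambda>n. B\<^sup>2 * (LINT x|\<mu> u. (poly (P n) x - f x)\<^sup>2)) \<longlonglongrightarrow> 0"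
      using P unfolding approximates_def by (rule tendsto_mult_right_zero)
    have "(LINT x|\<mu> u. (poly (p * P n) x - poly p x * f x)\<^sup>2) \<le> (LINT x|\<mu> u. B\<^sup>2 * (poly (P n) x - f x)\<^sup>2)" for n
    proof (rule integral_mono_AE)
      have "square_int (\<mu> u) (\<lambda>x. poly (p * P n) x - poly p x * f x)"
        by (intro square_int_diff[OF \<mu>_sets] square_int_poly[OF \<mu>_unit] pf)
      then show "integrable (\<mu> u) (\<lambda>x. (poly (p * P n) x - poly p x * f x)\<^sup>2)" by (simp add: square_int_def)
      have "square_int (\<mu> u) (\<lambda>x. poly (P n) x - f x)"
        by (intro square_int_diff[OF \<mu>_sets] square_int_poly[OF \<mu>_unit] f)
      then show "integrable (\<mu> u) (\<lambda>x. B\<^sup>2 * (poly (P n) x - f x)\<^sup>2)" by (simp add: square_int_def)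
      show "AE x in \<mu> u. (poly (p * P n) x - poly p x * f x)\<^sup>2 \<le> B\<^sup>2 * (poly (P n) x - f x)\<^sup>2"
        using \<mu>_AE
      proof eventually_elim
        case (elim x)
        have "(poly (p * P n) x - poly p x * f x)\<^sup>2 = \<bar>poly p x\<bar>\<^sup>2 * (poly (P n) x - f x)\<^sup>2"
          by (simp add: power_mult_distrib[symmetric] algebra_simps)
        also have "\<dots> \<le> B\<^sup>2 * (poly (P n) x - f x)\<^sup>2"
          using B[OF elim] by (intro mult_right_mono power_mono) auto
        finally show ?case .
      qed
    qed
    then show "\<forall>\<^sub>F n in sequentially. (LINT x|\<mu> u. (poly (p * P n) x - poly p x * f x)\<^sup>2) \<le> B\<^sup>2 * (LINT x|\<mu> u. (poly (P n) x - f x)\<^sup>2)"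
      by (intro always_eventually allI) simp
  qed (auto intro!: always_eventually)
  from fun_calc_limit[OF pf this] have l: "(\<lambda>n. poly_op p (poly_op (P n) u)) \<longlonglongrightarrow> fun_calc (\<lambda>x. poly p x * f x) u"
    by (simp only: poly_op_mult)
  have "(\<lambda>n. inner (poly_op p v) (poly_op (P n) u)) \<longlonglongrightarrow> inner (poly_op p v) (fun_calc f u)" for v
    by (intro tendsto_inner tendsto_const fun_calc_limit f P)
  then have "(\<lambda>n. inner v (poly_op p (poly_op (P n) u))) \<longlonglongrightarrow> inner v (poly_op p (fun_calc f u))" for v
    by (simp only: poly_op_sym)
  moreover have "(\<lambda>n. inner v (poly_op p (poly_op (P n) u))) \<longlonglongrightarrow> inner v (fun_calc (\<lambda>x. poly p x * f x) u)" for v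
    by (intro tendsto_inner tendsto_const l)
  ultimately have "inner v (poly_op p (fun_calc f u)) = inner v (fun_calc (\<lambda>x. poly p x * f x) u)" for v
    using LIMSEQ_unique by blast
  then show ?thesis by (metis vector_eq_rdot inner_commute)
qed

lemma R_fun_calc:
  assumes f: "square_int (\<mu> u) f"
  shows "R (fun_calc f u) = fun_calc (\<lambda>x. x * f x) u"
  using poly_op_fun_calc[OF f, of "[:0, 1:]"] by (simp add: R_zero)

text \<open>One would expect \<open>\<mu> (f(R) u) = f\<^sup>2 \<mu> u\<close>, which is the uniqueness of the moment problem. Choosing
polynomials that approximate \<open>g\<close> for both of these measures at once avoids it.\<close>

lemma fun_calc_fun_calc:
  assumes f: "square_int (\<mu> u) f" and g: "g \<in> borel_measurable borel" "\<And>x. x \<in> {0..1} \<Longrightarrow> \<bar>g x\<bar> \<le> B"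
  shows "fun_calc g (fun_calc f u) = fun_calc (\<lambda>x. g x * f x) u"
proof -
  let ?w = "fun_calc f u"
  define N where "N = density (\<mu> u) (\<lambda>x. ennreal ((f x)\<^sup>2))"
  have [measurable]: "f \<in> borel_measurable borel" "g \<in> borel_measurable borel" using f g by (auto simp: square_int_def)
  have gf: "square_int (\<mu> u) (\<lambda>x. g x * f x)" by (rule square_int_bounded_mult[OF f g])
  have N: "unit_interval_measure N"
    unfolding unit_interval_measure_def
  proof (intro conjI)
    have "(\<integral>\<^sup>+x. ennreal ((f x)\<^sup>2) \<partial>\<mu> u) < \<infinity>"
      using f unfolding square_int_def by (subst nn_integral_eq_integral) auto
    then show "finite_measure N" by (intro finite_measureI) (simp add: N_def emeasure_density)
    show "AE x in N. x \<in> {0..1}"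
    proof -
      have "AE x in \<mu> u. 0 < ennreal ((f x)\<^sup>2) \<longrightarrow> x \<in> {0..1}" using \<mu>_AE by eventually_elim simp
      then show ?thesis unfolding N_def by (subst AE_density) auto
    qed
  qed (simp add: N_def)
  have gw: "square_int (\<mu> ?w) g" "square_int N g"
    using square_int_bounded[OF \<mu>_unit g] square_int_bounded[OF N g] by auto
  obtain P where P: "\<And>M. M \<in> {\<mu> ?w, N} \<Longrightarrow> (\<lambda>n. LINT x|M. (poly (P n) x - g x)\<^sup>2) \<longlonglongrightarrow> 0"
    using poly_approximating_sequence[of "{\<mu> ?w, N}" g] gw N \<mu>_unit g(1) by auto
  have "(\<lambda>n. poly_op (P n) ?w) \<longlonglongrightarrow> fun_calc g ?w"
    by (rule fun_calc_limit) (use gw P in \<open>auto simp: approximates_def\<close>)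
  moreover have "(\<lambda>n. poly_op (P n) ?w) \<longlonglongrightarrow> fun_calc (\<lambda>x. g x * f x) u"
  proof -
    have "(norm (poly_op (P n) ?w - fun_calc (\<lambda>x. g x * f x) u))\<^sup>2 = (LINT x|N. (poly (P n) x - g x)\<^sup>2)" for n
    proof -
      obtain C where C: "\<And>x. x \<in> {0..1} \<Longrightarrow> \<bar>poly (P n) x\<bar> \<le> C" using poly_bounded_unit_interval[of "P n"] by blast
      have pf: "square_int (\<mu> u) (\<lambda>x. poly (P n) x * f x)" by (rule square_int_bounded_mult[OF f borel_measurable_poly C])
      have "(norm (poly_op (P n) ?w - fun_calc (\<lambda>x. g x * f x) u))\<^sup>2 = (LINT x|\<mu> u. (poly (P n) x * f x - g x * f x)\<^sup>2)"
        unfolding poly_op_fun_calc[OF f] by (rule norm_fun_calc_diff[OF pf gf])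
      also have "\<dots> = (LINT x|N. (poly (P n) x - g x)\<^sup>2)"
        unfolding N_def by (subst integral_density) (auto simp: power_mult_distrib[symmetric] algebra_simps)
      finally show ?thesis .
    qed
    then have "(\<lambda>n. (norm (poly_op (P n) ?w - fun_calc (\<lambda>x. g x * f x) u))\<^sup>2) \<longlonglongrightarrow> 0" using P[of N] by simp
    then have "(\<lambda>n. sqrt ((norm (poly_op (P n) ?w - fun_calc (\<lambda>x. g x * f x) u))\<^sup>2)) \<longlonglongrightarrow> sqrt 0" by (rule tendsto_real_sqrt)
    then have "(\<lambda>n. poly_op (P n) ?w - fun_calc (\<lambda>x. g x * f x) u) \<longlonglongrightarrow> 0" by (simp add: tendsto_norm_zero_iff)
    then show ?thesis by (simp add: LIM_zero_iff)
  qed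
  ultimately show ?thesis by (rule LIMSEQ_unique)
qed

lemma common_approximation:
  assumes fin: "finite U" and f: "\<And>u. u \<in> U \<Longrightarrow> square_int (\<mu> u) f" and m: "f \<in> borel_measurable borel"
  obtains P where "\<And>u. u \<in> U \<Longrightarrow> approximates u f P"
proof -
  obtain P where "\<And>M. M \<in> \<mu> ` U \<Longrightarrow> (\<lambda>n. LINT x|M. (poly (P n) x - f x)\<^sup>2) \<longlonglongrightarrow> 0"
    by (rule poly_approximating_sequence[of "\<mu> ` U" f]) (use fin f m \<mu>_unit in auto)
  then show thesis by (intro that[of P]) (simp add: approximates_def)
qed

lemma fun_calc_add:
  assumes f: "square_int (\<mu> u) f" "square_int (\<mu> v) f" "square_int (\<mu> (u + v)) f"
  shows "fun_calc f (u + v) = fun_calc f u + fun_calc f v"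
proof -
  obtain P where P: "\<And>w. w \<in> {u, v, u + v} \<Longrightarrow> approximates w f P"
    using common_approximation[of "{u, v, u + v}" f] f by (auto simp: square_int_def)
  have "(\<lambda>n. poly_op (P n) u + poly_op (P n) v) \<longlonglongrightarrow> fun_calc f u + fun_calc f v"
    by (intro tendsto_add fun_calc_limit f P) auto
  moreover have "(\<lambda>n. poly_op (P n) (u + v)) \<longlonglongrightarrow> fun_calc f (u + v)"
    by (intro fun_calc_limit f P) auto
  ultimately show ?thesis by (simp add: poly_op_linear LIMSEQ_unique)
qed

lemma fun_calc_commute:
  assumes J: "bounded_linear J" and JR: "\<And>u. R (J u) = J (R u)"
    and f: "square_int (\<mu> u) f" "square_int (\<mu> (J u)) f"
  shows "fun_calc f (J u) = J (fun_calc f u)"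
proof -
  obtain P where P: "\<And>w. w \<in> {u, J u} \<Longrightarrow> approximates w f P"
    using common_approximation[of "{u, J u}" f] f by (auto simp: square_int_def)
  have Jp: "poly_op p (J u) = J (poly_op p u)" for p
    by (induction p) (auto simp: JR linear_add[OF bounded_linear.linear[OF J]] linear_scale[OF bounded_linear.linear[OF J]] linear_0[OF bounded_linear.linear[OF J]])
  have "(\<lambda>n. J (poly_op (P n) u)) \<longlonglongrightarrow> J (fun_calc f u)"
    by (intro bounded_linear.tendsto[OF J] fun_calc_limit f P) auto
  moreover have "(\<lambda>n. poly_op (P n) (J u)) \<longlonglongrightarrow> fun_calc f (J u)"
    by (intro fun_calc_limit f P) auto
  ultimately show ?thesis by (simp add: Jp LIMSEQ_unique)
qed

lemma fun_calc_sym: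
  assumes f: "square_int (\<mu> u) f" "square_int (\<mu> v) f"
  shows "inner (fun_calc f u) v = inner u (fun_calc f v)"
proof -
  obtain P where P: "\<And>w. w \<in> {u, v} \<Longrightarrow> approximates w f P"
    using common_approximation[of "{u, v}" f] f by (auto simp: square_int_def)
  have "(\<lambda>n. inner (poly_op (P n) u) v) \<longlonglongrightarrow> inner (fun_calc f u) v"
    by (intro tendsto_inner tendsto_const fun_calc_limit f P) auto
  moreover have "(\<lambda>n. inner u (poly_op (P n) v)) \<longlonglongrightarrow> inner u (fun_calc f v)"
    by (intro tendsto_inner tendsto_const fun_calc_limit f P) auto
  ultimately show ?thesis by (simp add: poly_op_sym LIMSEQ_unique)
qed

end

section \<open>Completeness of L2\<close>

lemma square_integrable_rep: "square_integrable (rep_L2 u)"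
  using Quotient3_rep_reflp[OF Quotient3_L2, of u] by (simp add: L2_eq_def)

lemma abs_rep_L2: "abs_L2 (rep_L2 u) = u"
  by (rule Quotient3_abs_rep[OF Quotient3_L2])

text \<open>The quotient is partial, so equality of classes characterizes equality almost everywhere only for
square integrable representatives.\<close>

lemma abs_L2_eq_iff:
  "square_integrable f \<Longrightarrow> square_integrable g \<Longrightarrow> abs_L2 f = abs_L2 g \<longleftrightarrow> (AE x in lborel. f x = g x)"
  using Quotient3_rel[OF Quotient3_L2, of f g] by (auto simp: L2_eq_def)

lemma rep_abs_L2:
  assumes "square_integrable f" shows "AE x in lborel. rep_L2 (abs_L2 f) x = f x"
  using abs_L2_eq_iff[OF square_integrable_rep assms, of "abs_L2 f"] by (simp add: abs_rep_L2)

lemma measurable_rep_L2 [measurable]: "rep_L2 u \<in> borel_measurable borel"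
  using square_integrable_rep[of u] by (simp add: square_integrable_def)

lemma integrable_rep_L2: "integrable lborel (\<lambda>x. (cmod (rep_L2 u x))\<^sup>2)"
  using square_integrable_rep[of u] by (simp add: square_integrable_def)

lemma L2_self: "square_integrable f \<Longrightarrow> L2_eq f f"
  by (simp add: L2_eq_def)

lemma plus_abs_L2:
  "square_integrable f \<Longrightarrow> square_integrable g \<Longrightarrow> abs_L2 f + abs_L2 g = abs_L2 (\<lambda>x. f x + g x)"
  by (rule plus_L2.abs_eq) (auto intro: L2_self)

lemma scaleC_abs_L2: "square_integrable f \<Longrightarrow> scaleC c (abs_L2 f) = abs_L2 (\<lambda>x. c * f x)"
  by (rule scaleC.abs_eq) (auto intro: L2_self)

lemma uminus_abs_L2: "square_integrable f \<Longrightarrow> - abs_L2 f = abs_L2 (\<lambda>x. - f x)"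
  using uminus_L2.abs_eq[OF L2_self, of f] by simp

lemma square_integrable_diff:
  "square_integrable f \<Longrightarrow> square_integrable g \<Longrightarrow> square_integrable (\<lambda>x. f x - g x)"
  using square_integrable_add[OF _ square_integrable_uminus, of f g] by simp

lemma minus_abs_L2:
  assumes "square_integrable f" "square_integrable g"
  shows "abs_L2 f - abs_L2 g = abs_L2 (\<lambda>x. f x - g x)"
  using assms by (simp add: minus_L2_def uminus_abs_L2 plus_abs_L2 square_integrable_uminus)

lemma scaleR_abs_L2: "square_integrable f \<Longrightarrow> c *\<^sub>R abs_L2 f = abs_L2 (\<lambda>x. complex_of_real c * f x)"
  by (simp add: scaleR_L2_def scaleC_abs_L2)

lemma cinner_abs_L2:
  "square_integrable f \<Longrightarrow> square_integrable g \<Longrightarrow> cinner (abs_L2 f) (abs_L2 g) = (LINT x|lborel. cnj (f x) * g x)"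
  by (rule cinner.abs_eq) (auto intro: L2_self)

lemma inner_abs_L2:
  assumes "square_integrable f" "square_integrable g"
  shows "inner (abs_L2 f) (abs_L2 g) = (LINT x|lborel. Re (cnj (f x) * g x))"
  unfolding inner_L2_def cinner_abs_L2[OF assms]
  using square_integrable_cnj_mult[OF assms] by (simp flip: integral_Re)

lemma norm_abs_L2:
  assumes "square_integrable f"
  shows "(norm (abs_L2 f))\<^sup>2 = (LINT x|lborel. (cmod (f x))\<^sup>2)"
proof -
  have "Re (cnj z * z) = (cmod z)\<^sup>2" for z by (simp add: cmod_def power2_eq_square)
  then show ?thesis unfolding power2_norm_eq_inner inner_abs_L2[OF assms assms] by simp
qed

lemma nn_integral_square:
  assumes "square_integrable f"
  shows "(\<integral>\<^sup>+x. ennreal ((cmod (f x))\<^sup>2) \<partial>lborel) = ennreal ((norm (abs_L2 f))\<^sup>2)"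
  unfolding norm_abs_L2[OF assms] using assms by (intro nn_integral_eq_integral) (auto simp: square_integrable_def)

lemma square_integrableI:
  assumes "f \<in> borel_measurable borel" "(\<integral>\<^sup>+x. ennreal ((cmod (f x))\<^sup>2) \<partial>lborel) < \<infinity>"
  shows "square_integrable f"
  using assms unfolding square_integrable_def by (auto intro!: integrableI_nonneg)

text \<open>The series \<open>\<Sum> 4\<^sup>k \<bar>f\<^sub>k\<^sub>+\<^sub>1 - f\<^sub>k\<bar>\<^sup>2\<close> has finite integral. Where it is finite, the increments are
dominated by a geometric series.\<close>

lemma rapidly_Cauchy_L2_converges:
  fixes f :: "nat \<Rightarrow> real ^ 'n::finite \<Rightarrow> complex"
  assumes f: "\<And>k. square_integrable (f k)"
    and fast: "\<And>k. norm (abs_L2 (f (Suc k)) - abs_L2 (f k)) \<le> (1/4) ^ k"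
  obtains g where "g \<in> borel_measurable borel" "AE x in lborel. (\<lambda>k. f k x) \<longlonglongrightarrow> g x"
proof -
  have [measurable]: "f k \<in> borel_measurable borel" for k using f by (simp add: square_integrable_def)
  let ?d = "\<lambda>k x. (cmod (f (Suc k) x - f k x))\<^sup>2"
  have "(\<integral>\<^sup>+x. (\<Sum>k. ennreal (4 ^ k * ?d k x)) \<partial>lborel) = (\<Sum>k. (\<integral>\<^sup>+x. ennreal (4 ^ k * ?d k x) \<partial>lborel))"
    by (rule nn_integral_suminf) measurable
  also have "\<dots> \<le> (\<Sum>k. ennreal ((1/4) ^ k))"
  proof (rule suminf_le)
    fix k
    have "(\<integral>\<^sup>+x. ennreal (4 ^ k * ?d k x) \<partial>lborel) = 4 ^ k * (\<integral>\<^sup>+x. ennreal (?d k x) \<partial>lborel)"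
      by (simp add: ennreal_mult nn_integral_cmult ennreal_power[symmetric])
    also have "(\<integral>\<^sup>+x. ennreal (?d k x) \<partial>lborel) = ennreal ((norm (abs_L2 (f (Suc k)) - abs_L2 (f k)))\<^sup>2)"
      unfolding minus_abs_L2[OF f f] by (rule nn_integral_square[OF square_integrable_diff[OF f f]])
    also have "4 ^ k * \<dots> \<le> 4 ^ k * ennreal (((1/4) ^ k)\<^sup>2)"
      using fast[of k] by (intro mult_left_mono ennreal_leI power_mono) auto
    also have "\<dots> = ennreal (4 ^ k * ((1/4) ^ k)\<^sup>2)"
      by (simp add: ennreal_mult ennreal_power[symmetric])
    also have "(4::real) ^ k * ((1/4) ^ k)\<^sup>2 = (1/4) ^ k"
      by (simp add: power2_eq_square power_divide)
    finally show "(\<integral>\<^sup>+x. ennreal (4 ^ k * ?d k x) \<partial>lborel) \<le> ennreal ((1/4) ^ k)" .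
  qed (rule summableI)+
  also have "\<dots> < \<infinity>"
  proof -
    have sg: "summable (\<lambda>k. (1/4::real) ^ k)" by (rule summable_geometric) simp
    have "(\<Sum>k. ennreal ((1/4) ^ k)) = ennreal (\<Sum>k. (1/4::real) ^ k)"
      by (rule suminf_ennreal2[OF _ sg]) (rule zero_le_power, simp)
    then show ?thesis by (simp only: infinity_ennreal_def ennreal_less_top)
  qed
  finally have fin: "(\<integral>\<^sup>+x. (\<Sum>k. ennreal (4 ^ k * ?d k x)) \<partial>lborel) < \<infinity>" .
  have pinf: "AE x in lborel. (\<Sum>k. ennreal (4 ^ k * ?d k x)) \<noteq> \<infinity>"
  proof (rule nn_integral_PInf_AE)
    show "(\<lambda>x. \<Sum>k. ennreal (4 ^ k * ?d k x)) \<in> borel_measurable lborel" by measurable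
    show "(\<integral>\<^sup>+x. (\<Sum>k. ennreal (4 ^ k * ?d k x)) \<partial>lborel) \<noteq> \<infinity>" using fin by (rule less_imp_neq)
  qed
  from pinf have conv: "AE x in lborel. convergent (\<lambda>k. f k x)"
  proof eventually_elim
    case (elim x)
    obtain S where S: "S = (\<Sum>k. ennreal (4 ^ k * ?d k x))" by blast
    then have "S < top" using elim by (simp only: infinity_ennreal_def less_top)
    then have C: "(\<Sum>k. ennreal (4 ^ k * ?d k x)) = ennreal (enn2real S)" "0 \<le> enn2real S"
      unfolding S[symmetric] by simp_all
    let ?C = "enn2real S"
    have "cmod (f (Suc k) x - f k x) \<le> sqrt ?C * (1/2) ^ k" for k
    proof -
      have "(\<Sum>k\<in>{k}. ennreal (4 ^ k * ?d k x)) \<le> (\<Sum>k. ennreal (4 ^ k * ?d k x))"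
        by (rule sum_le_suminf) auto
      then have "ennreal (4 ^ k * ?d k x) \<le> ennreal ?C" unfolding C(1) by (simp only: sum.insert finite.emptyI empty_iff not_False_eq_True sum.empty add_0_right)
      then have "4 ^ k * ?d k x \<le> ?C" using C(2) by (subst (asm) ennreal_le_iff) auto
      then have "(2 ^ k * cmod (f (Suc k) x - f k x))\<^sup>2 \<le> ?C"
      proof -
        have "(2::real) ^ k * 2 ^ k = 4 ^ k" by (simp add: power_mult_distrib[symmetric])
        then show ?thesis using \<open>4 ^ k * ?d k x \<le> ?C\<close>
          by (simp add: power_mult_distrib power2_eq_square[of "2 ^ k"])
      qed
      then have "2 ^ k * cmod (f (Suc k) x - f k x) \<le> sqrt ?C" by (rule real_le_rsqrt)
      then have "cmod (f (Suc k) x - f k x) \<le> sqrt ?C / 2 ^ k" by (simp add: pos_le_divide_eq mult.commute)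
      then show ?thesis by (simp add: power_one_over)
    qed
    note le = this
    have "summable (\<lambda>k. sqrt ?C * (1/2) ^ k)" by (intro summable_mult summable_geometric) simp
    then have "summable (\<lambda>k. f (Suc k) x - f k x)"
      by (rule summable_comparison_test'[where N = 0]) (rule le)
    then have "convergent (\<lambda>n. \<Sum>k<n. f (Suc k) x - f k x)" by (simp add: summable_iff_convergent)
    then have "convergent (\<lambda>n. f n x - f 0 x)" by (simp only: sum_lessThan_telescope[of "\<lambda>k. f k x"])
    from convergent_add[OF this convergent_const[of "f 0 x"]] show ?case by simp
  qed
  show thesis
  proof (rule that[of "\<lambda>x. lim (\<lambda>k. f k x)"])
    show "(\<lambda>x. lim (\<lambda>k. f k x)) \<in> borel_measurable borel" by measurable
    show "AE x in lborel. (\<lambda>k. f k x) \<longlonglongrightarrow> lim (\<lambda>k. f k x)"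
      using conv by eventually_elim (simp add: convergent_LIMSEQ_iff)
  qed
qed

instance L2 :: (finite) complete_space
proof
  fix X :: "nat \<Rightarrow> 'a L2"
  assume X: "Cauchy X"
  obtain N where N: "\<And>e m n. e > 0 \<Longrightarrow> m \<ge> N e \<Longrightarrow> n \<ge> N e \<Longrightarrow> dist (X m) (X n) < e"
    using metric_CauchyD[OF X] by metis
  \<comment> \<open>a subsequence along which the increments are at most \<open>4\<^sup>-\<^sup>k\<close>\<close>
  define r where "r k = rec_nat (N ((1/4) ^ 0)) (\<lambda>k m. max (Suc m) (N ((1/4) ^ Suc k))) k" for k :: nat
  have rS: "r (Suc k) = max (Suc (r k)) (N ((1/4) ^ Suc k))" for k by (simp add: r_def)
  have rmono: "strict_mono r" by (auto simp: strict_mono_Suc_iff rS)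
  have rN: "N ((1/4) ^ k) \<le> r k" for k by (cases k) (auto simp: rS r_def)
  define f where "f k = rep_L2 (X (r k))" for k
  have f: "square_integrable (f k)" for k by (simp add: f_def square_integrable_rep)
  have af: "abs_L2 (f k) = X (r k)" for k by (simp add: f_def abs_rep_L2)
  have fast: "norm (abs_L2 (f (Suc k)) - abs_L2 (f k)) \<le> (1/4) ^ k" for k
    using N[of "(1/4)^k" "r (Suc k)" "r k"] rN[of k] rS[of k] by (simp add: af dist_norm less_imp_le)
  obtain g where g [measurable]: "g \<in> borel_measurable borel" and lim: "AE x in lborel. (\<lambda>k. f k x) \<longlonglongrightarrow> g x"
    by (rule rapidly_Cauchy_L2_converges[of f, OF f fast])
  have [measurable]: "f k \<in> borel_measurable borel" for k using f by (simp add: square_integrable_def)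
  \<comment> \<open>Fatou along the subsequence bounds the distance to the pointwise limit\<close>
  have fatou: "(\<integral>\<^sup>+x. ennreal ((cmod (g x - f k x))\<^sup>2) \<partial>lborel) \<le> ennreal (e\<^sup>2)"
    if e: "e > 0" and k: "N e \<le> r k" for e k
  proof -
    have "(\<integral>\<^sup>+x. ennreal ((cmod (g x - f k x))\<^sup>2) \<partial>lborel) = (\<integral>\<^sup>+x. liminf (\<lambda>j. ennreal ((cmod (f j x - f k x))\<^sup>2)) \<partial>lborel)"
    proof (rule nn_integral_cong_AE)
      show "AE x in lborel. ennreal ((cmod (g x - f k x))\<^sup>2) = liminf (\<lambda>j. ennreal ((cmod (f j x - f k x))\<^sup>2))"
        using lim
      proof eventually_elim
        case (elim x)
        have "(\<lambda>j. ennreal ((cmod (f j x - f k x))\<^sup>2)) \<longlonglongrightarrow> ennreal ((cmod (g x - f k x))\<^sup>2)"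
          by (intro tendsto_ennrealI tendsto_intros elim)
        then show ?case using lim_imp_Liminf[of sequentially] by fastforce
      qed
    qed
    also have "\<dots> \<le> liminf (\<lambda>j. (\<integral>\<^sup>+x. ennreal ((cmod (f j x - f k x))\<^sup>2) \<partial>lborel))"
      by (rule nn_integral_liminf) measurable
    also have "\<dots> \<le> ennreal (e\<^sup>2)"
    proof (rule Liminf_le)
      obtain j0 where j0: "\<And>j. j \<ge> j0 \<Longrightarrow> r j \<ge> N e"
        using seq_suble[OF rmono] by (meson order_trans)
      have "(\<integral>\<^sup>+x. ennreal ((cmod (f j x - f k x))\<^sup>2) \<partial>lborel) \<le> ennreal (e\<^sup>2)" if "j \<ge> j0" for j
      proof -
        have "norm (abs_L2 (f j) - abs_L2 (f k)) \<le> e"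
          using N[OF e j0[OF that] k] by (simp add: af dist_norm)
        then have "(norm (abs_L2 (f j) - abs_L2 (f k)))\<^sup>2 \<le> e\<^sup>2" by (intro power_mono) auto
        then show ?thesis
          using nn_integral_square[OF square_integrable_diff[OF f f], of j k]
          by (simp add: minus_abs_L2[OF f f] ennreal_leI)
      qed
      then show "\<forall>\<^sub>F j in sequentially. (\<integral>\<^sup>+x. ennreal ((cmod (f j x - f k x))\<^sup>2) \<partial>lborel) \<le> ennreal (e\<^sup>2)"
        by (auto simp: eventually_sequentially)
    qed simp
    finally show ?thesis .
  qed
  have d0: "square_integrable (\<lambda>x. g x - f k x)" if "e > 0" "N e \<le> r k" for e k
    by (rule square_integrableI) (use fatou[OF that] in \<open>auto simp: le_less_trans[OF _ ennreal_less_top]\<close>)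
  have "square_integrable (\<lambda>x. (g x - f 0 x) + f 0 x)"
    using d0[of 1 0] rN[of 0] by (intro square_integrable_add f) auto
  then have g2: "square_integrable g" by simp
  have "(\<lambda>k. X (r k)) \<longlonglongrightarrow> abs_L2 g"
  proof (rule metric_LIMSEQ_I)
    fix e :: real assume e: "e > 0"
    obtain j0 where j0: "\<And>j. j \<ge> j0 \<Longrightarrow> r j \<ge> N (e/2)"
      using seq_suble[OF rmono] by (meson order_trans)
    have "dist (X (r k)) (abs_L2 g) < e" if "k \<ge> j0" for k
    proof -
      have eq: "abs_L2 (\<lambda>x. g x - f k x) = abs_L2 g - X (r k)"
        by (simp only: minus_abs_L2[OF g2 f, symmetric] af)
      have "0 < e/2" using e by simp
      from fatou[OF this j0[OF that]] have "ennreal ((norm (abs_L2 g - X (r k)))\<^sup>2) \<le> ennreal ((e/2)\<^sup>2)"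
        unfolding nn_integral_square[OF square_integrable_diff[OF g2 f]] eq .
      then have "(norm (abs_L2 g - X (r k)))\<^sup>2 \<le> (e/2)\<^sup>2"
        by (subst (asm) ennreal_le_iff) auto
      then have "norm (abs_L2 g - X (r k)) \<le> e/2" by (rule power2_le_imp_le) (use e in simp)
      moreover have "dist (X (r k)) (abs_L2 g) = norm (abs_L2 g - X (r k))" by (simp add: dist_norm norm_minus_commute)
      ultimately show ?thesis using e by linarith
    qed
    then show "\<exists>no. \<forall>n\<ge>no. dist (X (r n)) (abs_L2 g) < e" by blast
  qed
  then have "(X \<circ> r) \<longlonglongrightarrow> abs_L2 g" by (simp add: comp_def)
  from Cauchy_converges_subseq[OF X rmono this] show "convergent X" by (rule convergentI)
qed

instance L2 :: (finite) banach ..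

section \<open>The complex structure\<close>

abbreviation \<J> :: "'n::finite L2 \<Rightarrow> 'n L2" where "\<J> \<equiv> scaleC \<i>"

lemma scaleC_add_right: "scaleC c (u + v) = scaleC c u + scaleC c v"
  by transfer (auto simp: L2_eq_def distrib_left intro!: square_integrable_add square_integrable_scale)

lemma scaleC_add_left: "scaleC (c + d) u = scaleC c u + scaleC d u"
  by transfer (auto simp: L2_eq_def distrib_right intro!: square_integrable_add square_integrable_scale)

lemma scaleC_scaleC: "scaleC c (scaleC d u) = scaleC (c * d) u"
  by transfer (auto simp: L2_eq_def mult.assoc intro!: square_integrable_scale)

lemma scaleC_of_real: "scaleC (complex_of_real r) u = r *\<^sub>R u"
  by (simp add: scaleR_L2_def)

lemma scaleC_decomp: "scaleC c u = Re c *\<^sub>R u + Im c *\<^sub>R \<J> u"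
proof -
  have "c = complex_of_real (Re c) + complex_of_real (Im c) * \<i>" by (simp add: complex_eq_iff)
  then have "scaleC c u = scaleC (complex_of_real (Re c)) u + scaleC (complex_of_real (Im c) * \<i>) u"
    using scaleC_add_left by metis
  then show ?thesis by (simp only: scaleC_scaleC[symmetric] scaleC_of_real)
qed

lemma J_scaleR: "\<J> (r *\<^sub>R u) = r *\<^sub>R \<J> u"
  unfolding scaleR_L2_def scaleC_scaleC by (simp only: mult.commute)

lemma J_J: "\<J> (\<J> u) = - u"
  using scaleC_of_real[of "-1" u] by (simp add: scaleC_scaleC)

lemma cinner_scaleC_right: "cinner u (scaleC c v) = c * cinner u v"
  by transfer (simp add: mult.left_commute)

lemma cinner_scaleC_left: "cinner (scaleC c u) v = cnj c * cinner u v"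
  by transfer (simp add: mult.assoc)

text \<open>The complex inner product is determined by the real one and by multiplication with the imaginary unit.
Hence everything can be done in the real Hilbert space, for operators that commute with \<open>\<J>\<close>.\<close>

lemma cinner_eq: "cinner u v = complex_of_real (inner u v) - \<i> * complex_of_real (inner u (\<J> v))"
  by (simp add: inner_L2_def cinner_scaleC_right complex_eq_iff)

lemma inner_J_J: "inner (\<J> u) (\<J> v) = inner u v"
  by (simp add: inner_L2_def cinner_scaleC_right cinner_scaleC_left)

lemma inner_J_left: "inner (\<J> u) v = - inner u (\<J> v)"
  using inner_J_J[of u "\<J> v"] by (simp add: J_J)

lemma inner_J_self: "inner u (\<J> u) = 0"
  using inner_J_left[of u u] by (simp add: inner_commute)

lemma norm_J: "norm (\<J> u) = norm u"
  by (simp add: norm_eq_sqrt_inner inner_J_J)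

lemma bounded_linear_J: "bounded_linear \<J>"
  by (rule bounded_linear_intro[where K = 1]) (auto simp: scaleC_add_right J_scaleR norm_J)

lemma linear_operator_onI:
  assumes "subspace D" "\<And>u. u \<in> D \<Longrightarrow> \<J> u \<in> D"
    and "\<And>u v. u \<in> D \<Longrightarrow> v \<in> D \<Longrightarrow> A (u + v) = A u + A v" "\<And>r u. u \<in> D \<Longrightarrow> A (r *\<^sub>R u) = r *\<^sub>R A u"
    and "\<And>u. u \<in> D \<Longrightarrow> A (\<J> u) = \<J> (A u)"
  shows "linear_operator_on D A"
  unfolding linear_operator_on_def
proof (intro conjI ballI allI)
  fix c u assume u: "u \<in> D"
  have D: "Re c *\<^sub>R u \<in> D" "Im c *\<^sub>R \<J> u \<in> D"
    using assms(1,2) u by (auto intro: subspace_scale)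
  show "scaleC c u \<in> D" unfolding scaleC_decomp[of c u] using assms(1) D by (intro subspace_add)
  have "A (scaleC c u) = A (Re c *\<^sub>R u) + A (Im c *\<^sub>R \<J> u)"
    unfolding scaleC_decomp[of c u] by (rule assms(3)[OF D])
  then show "A (scaleC c u) = scaleC c (A u)"
    using assms(4,5) u assms(2)[OF u] by (simp add: scaleC_decomp[of c "A u"])
qed (use assms in \<open>auto simp: subspace_def\<close>)

section \<open>Translations\<close>

lemma lborel_distr_translation: "distr lborel borel (\<lambda>x. x + h) = (lborel :: 'a::euclidean_space measure)"
proof -
  have "(\<lambda>x. x + h) = (+) h" by (auto simp: fun_eq_iff add.commute)
  then show ?thesis using lborel_distr_plus[of h] by simp
qed

lemma integral_translation:
  fixes f :: "'a::euclidean_space \<Rightarrow> 'b::{banach, second_countable_topology}"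
  assumes [measurable]: "f \<in> borel_measurable borel"
  shows "(LINT x|lborel. f (x + h)) = (LINT x|lborel. f x)"
  by (subst (2) lborel_distr_translation[of h, symmetric], subst integral_distr) auto

lemma integrable_translation:
  fixes f :: "'a::euclidean_space \<Rightarrow> 'b::{banach, second_countable_topology}"
  assumes "integrable lborel f"
  shows "integrable lborel (\<lambda>x. f (x + h))"
proof -
  have [measurable]: "f \<in> borel_measurable borel" using assms by auto
  have "integrable (distr lborel borel (\<lambda>x. x + h)) f" using assms by (simp add: lborel_distr_translation)
  then show ?thesis by (subst (asm) integrable_distr_eq) auto
qed

lemma AE_translation:
  fixes P :: "'a::euclidean_space \<Rightarrow> bool" and h :: 'a
  assumes "AE x in lborel. P x" "Measurable.pred borel P"
  shows "AE x in lborel. P (x + h)"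
proof -
  have "AE x in distr lborel borel (\<lambda>x. x + h). P x" unfolding lborel_distr_translation by (rule assms(1))
  then show ?thesis using assms(2) by (subst (asm) AE_distr_iff) auto
qed

lemma square_integrable_translation: "square_integrable f \<Longrightarrow> square_integrable (\<lambda>x. f (x + h))"
  using integrable_translation[of "\<lambda>x. (cmod (f x))\<^sup>2" h]
  by (auto simp: square_integrable_def intro!: measurable_compose[of "\<lambda>x. x + h" _ _ f])

lift_definition trans_L2 :: "real ^ 'n::finite \<Rightarrow> 'n L2 \<Rightarrow> 'n L2" is "\<lambda>h f x. f (x + h)"
proof -
  fix h :: "real ^ 'n" and f g :: "real ^ 'n \<Rightarrow> complex" assume *: "L2_eq f g"
  then have [measurable]: "f \<in> borel_measurable borel" "g \<in> borel_measurable borel"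
    by (auto simp: L2_eq_def square_integrable_def)
  show "L2_eq (\<lambda>x. f (x + h)) (\<lambda>x. g (x + h))"
    using * unfolding L2_eq_def
    by (intro conjI square_integrable_translation[of f] square_integrable_translation[of g]
        AE_translation[where P = "\<lambda>x. f x = g x"]) simp_all
qed

lemma trans_abs_L2: "square_integrable f \<Longrightarrow> trans_L2 h (abs_L2 f) = abs_L2 (\<lambda>x. f (x + h))"
  by (rule trans_L2.abs_eq) (rule L2_self)

lemma L2_cases:
  obtains f where "square_integrable f" "u = abs_L2 f"
  using square_integrable_rep abs_rep_L2 by metis

lemma trans_add: "trans_L2 h (u + v) = trans_L2 h u + trans_L2 h v"
proof -
  obtain f where f: "square_integrable f" "u = abs_L2 f" by (rule L2_cases)
  obtain g where g: "square_integrable g" "v = abs_L2 g" by (rule L2_cases)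
  show ?thesis
    unfolding f(2) g(2) plus_abs_L2[OF f(1) g(1)] trans_abs_L2[OF f(1)] trans_abs_L2[OF g(1)]
      trans_abs_L2[OF square_integrable_add[OF f(1) g(1)]]
      plus_abs_L2[OF square_integrable_translation[OF f(1)] square_integrable_translation[OF g(1)]] ..
qed

lemma trans_scaleC: "trans_L2 h (scaleC c u) = scaleC c (trans_L2 h u)"
proof -
  obtain f where f: "square_integrable f" "u = abs_L2 f" by (rule L2_cases)
  show ?thesis
    unfolding f(2) scaleC_abs_L2[OF f(1)] trans_abs_L2[OF f(1)] trans_abs_L2[OF square_integrable_scale[OF f(1)]]
      scaleC_abs_L2[OF square_integrable_translation[OF f(1)]] ..
qed

lemma trans_trans: "trans_L2 h (trans_L2 k u) = trans_L2 (h + k) u"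
proof -
  obtain f where f: "square_integrable f" "u = abs_L2 f" by (rule L2_cases)
  show ?thesis
    unfolding f(2) trans_abs_L2[OF f(1)] trans_abs_L2[OF square_integrable_translation[OF f(1)]]
    by (simp only: add.assoc)
qed

lemma trans_0 [simp]: "trans_L2 0 u = u"
proof -
  obtain f where f: "square_integrable f" "u = abs_L2 f" by (rule L2_cases)
  show ?thesis unfolding f(2) trans_abs_L2[OF f(1)] by simp
qed

lemma cinner_trans: "cinner (trans_L2 h u) (trans_L2 h v) = cinner u v"
proof transfer
  fix h :: "real ^ 'a" and f g :: "real ^ 'a \<Rightarrow> complex" assume *: "L2_eq f f" "L2_eq g g"
  then have [measurable]: "f \<in> borel_measurable borel" "g \<in> borel_measurable borel"
    by (auto simp: L2_eq_def square_integrable_def)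
  show "(LINT x|lborel. cnj (f (x + h)) * g (x + h)) = (LINT x|lborel. cnj (f x) * g x)"
    by (rule integral_translation[where f = "\<lambda>x. cnj (f x) * g x"]) measurable
qed

lemma inner_trans: "inner (trans_L2 h u) v = inner u (trans_L2 (- h) v)"
  using cinner_trans[of h u "trans_L2 (- h) v"] by (simp add: inner_L2_def trans_trans)

lemma norm_trans: "norm (trans_L2 h u) = norm u"
  using cinner_trans[of h u u] by (simp add: norm_eq_sqrt_inner inner_L2_def)

section \<open>Test functions\<close>

lemma has_derivative_partial_deriv:
  assumes "f differentiable (at x)"
  shows "((\<lambda>s. f (x + s *\<^sub>R axis i 1)) has_vector_derivative partial_deriv i f x) (at 0)"
proof -
  have "(f has_derivative frechet_derivative f (at x)) (at (x + 0 *\<^sub>R axis i 1))"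
    using assms by (simp add: frechet_derivative_works)
  moreover have "((\<lambda>s. x + s *\<^sub>R axis i 1) has_derivative (\<lambda>s. s *\<^sub>R axis i 1)) (at (0::real))"
    by (auto intro!: derivative_eq_intros)
  ultimately have "(f \<circ> (\<lambda>s. x + s *\<^sub>R axis i 1) has_derivative frechet_derivative f (at x) \<circ> (\<lambda>s. s *\<^sub>R axis i 1)) (at 0)"
    by (rule diff_chain_at[rotated])
  then show ?thesis
    using linear_scale[OF linear_frechet_derivative[OF assms]]
    by (simp add: has_vector_derivative_def partial_deriv_def comp_def)
qed

lemma has_derivative_partial_deriv_line:
  assumes "\<And>x. f differentiable (at x)"
  shows "((\<lambda>s. f (x + s *\<^sub>R axis i 1)) has_vector_derivative partial_deriv i f (x + s *\<^sub>R axis i 1)) (at s)"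
proof -
  have "((\<lambda>t. f ((x + s *\<^sub>R axis i 1) + t *\<^sub>R axis i 1)) has_vector_derivative partial_deriv i f (x + s *\<^sub>R axis i 1)) (at (s - s))"
    using has_derivative_partial_deriv[OF assms, of "x + s *\<^sub>R axis i 1" i] by simp
  moreover have "((\<lambda>t. t - s) has_vector_derivative 1) (at s)"
    unfolding has_vector_derivative_def by (auto intro!: derivative_eq_intros)
  ultimately have "((\<lambda>t. f ((x + s *\<^sub>R axis i 1) + (t - s) *\<^sub>R axis i 1)) has_vector_derivative partial_deriv i f (x + s *\<^sub>R axis i 1)) (at s)"
    using vector_diff_chain_at[of "\<lambda>t. t - s" 1 s] by (fastforce simp: comp_def)
  then show ?thesis by (simp add: algebra_simps)
qed

lemma partial_derivI:
  assumes "(f has_derivative f') (at x)"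
  shows "partial_deriv i f x = f' (axis i 1)"
  using frechet_derivative_at[OF assms] by (simp add: partial_deriv_def)

lemma differentiable_linear_shift:
  assumes L: "bounded_linear L" and f: "f differentiable (at (x + h))"
  shows "((\<lambda>x. L (f (x + h))) has_derivative (\<lambda>v. L (frechet_derivative f (at (x + h)) v))) (at x)"
proof -
  have "((\<lambda>x. x + h) has_derivative (\<lambda>v. v)) (at x)" by (auto intro!: derivative_eq_intros)
  moreover have "(f has_derivative frechet_derivative f (at (x + h))) (at (x + h))"
    using f by (simp add: frechet_derivative_works)
  ultimately have "((\<lambda>x. f (x + h)) has_derivative frechet_derivative f (at (x + h))) (at x)"
    using diff_chain_at[of "\<lambda>x. x + h" "\<lambda>v. v" x f] by (simp add: comp_def)
  then show ?thesis by (rule bounded_linear.has_derivative[OF L])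
qed

text \<open>Covers translations, multiplication with constants and complex conjugation at once.\<close>

lemma iterated_partial_linear_shift:
  assumes L: "bounded_linear L" and f: "\<And>\<alpha> x. iterated_partial \<alpha> f differentiable (at x)"
  shows "iterated_partial \<alpha> (\<lambda>x. L (f (x + h))) = (\<lambda>x. L (iterated_partial \<alpha> f (x + h)))"
proof (induction \<alpha>)
  case (Cons i \<alpha>)
  have "partial_deriv i (\<lambda>x. L (iterated_partial \<alpha> f (x + h))) x = L (partial_deriv i (iterated_partial \<alpha> f) (x + h))" for x
    using partial_derivI[OF differentiable_linear_shift[OF L f]] by (simp add: partial_deriv_def)
  then show ?case by (simp add: Cons)
qed simp

lemma iterated_partial_add:
  assumes f: "\<And>\<alpha> x. iterated_partial \<alpha> f differentiable (at x)" and g: "\<And>\<alpha> x. iterated_partial \<alpha> g differentiable (at x)"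
  shows "iterated_partial \<alpha> (\<lambda>x. f x + g x) = (\<lambda>x. iterated_partial \<alpha> f x + iterated_partial \<alpha> g x)"
proof (induction \<alpha>)
  case (Cons i \<alpha>)
  have "partial_deriv i (\<lambda>x. iterated_partial \<alpha> f x + iterated_partial \<alpha> g x) x = partial_deriv i (iterated_partial \<alpha> f) x + partial_deriv i (iterated_partial \<alpha> g) x" for x
    using partial_derivI[OF has_derivative_add[OF f[unfolded frechet_derivative_works] g[unfolded frechet_derivative_works]]]
    by (simp add: partial_deriv_def)
  then show ?case by (simp add: Cons)
qed simp

lemma iterated_partial_append: "iterated_partial (\<alpha> @ \<beta>) f = iterated_partial \<alpha> (iterated_partial \<beta> f)"
  by (induction \<alpha>) auto

lemma test_function_differentiable: "test_function \<phi> \<Longrightarrow> iterated_partial \<alpha> \<phi> differentiable (at x)"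
  by (simp add: test_function_def differentiable_on_def)

lemma test_function_support:
  assumes "test_function \<phi>"
  obtains r where "r > 0" "\<And>\<alpha> x. norm x > r \<Longrightarrow> iterated_partial \<alpha> \<phi> x = 0"
proof -
  have "bounded {x. \<phi> x \<noteq> 0}" using assms by (simp add: test_function_def)
  then obtain r where r: "r > 0" "\<And>x. \<phi> x \<noteq> 0 \<Longrightarrow> norm x \<le> r"
    unfolding bounded_pos by blast
  have op: "open {x::real^'a. norm x > r}" by (intro open_Collect_less continuous_intros)
  have "\<forall>x. norm x > r \<longrightarrow> iterated_partial \<alpha> \<phi> x = 0" for \<alpha>
  proof (induction \<alpha>)
    case Nil
    then show ?case using r(2) by force
  next
    case (Cons i \<alpha>)
    have "partial_deriv i (iterated_partial \<alpha> \<phi>) x = 0" if x: "norm x > r" for x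
    proof -
      have "((\<lambda>x. 0) has_derivative (\<lambda>x. 0)) (at x)" by simp
      then have "(iterated_partial \<alpha> \<phi> has_derivative (\<lambda>x. 0)) (at x)"
        by (rule has_derivative_transform_within_open[OF _ op]) (use x Cons in auto)
      then show ?thesis by (simp add: partial_derivI)
    qed
    then show ?case by simp
  qed
  then show thesis using that[of r] r(1) by blast
qed

lemma test_functionI:
  assumes "\<And>\<alpha> x. iterated_partial \<alpha> \<phi> differentiable (at x)" "\<And>x. norm x > r \<Longrightarrow> \<phi> x = 0"
  shows "test_function \<phi>"
proof -
  have "{x. \<phi> x \<noteq> 0} \<subseteq> cball 0 r" using assms(2) by force
  then have "bounded {x. \<phi> x \<noteq> 0}" using bounded_cball bounded_subset by blast
  then show ?thesis using assms(1) by (simp add: test_function_def differentiable_on_def)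
qed

lemma test_function_iterated_partial:
  assumes "test_function \<phi>" shows "test_function (iterated_partial \<beta> \<phi>)"
proof -
  obtain r where "\<And>\<alpha> x. norm x > r \<Longrightarrow> iterated_partial \<alpha> \<phi> x = 0" using test_function_support[OF assms] by metis
  then show ?thesis
    using test_function_differentiable[OF assms]
    by (intro test_functionI[of _ r]) (auto simp: iterated_partial_append[symmetric])
qed

lemma test_function_partial_deriv: "test_function \<phi> \<Longrightarrow> test_function (partial_deriv i \<phi>)"
  using test_function_iterated_partial[of \<phi> "[i]"] by simp

lemma test_function_linear_shift:
  assumes L: "bounded_linear L" and \<phi>: "test_function \<phi>"
  shows "test_function (\<lambda>x. L (\<phi> (x + h)))"
proof -
  obtain r where r: "\<And>\<alpha> x. norm x > r \<Longrightarrow> iterated_partial \<alpha> \<phi> x = 0" using test_function_support[OF \<phi>] by metis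
  note d = test_function_differentiable[OF \<phi>]
  show ?thesis
  proof (rule test_functionI[of _ "r + norm h"])
    show "iterated_partial \<alpha> (\<lambda>x. L (\<phi> (x + h))) differentiable at x" for \<alpha> x
      unfolding iterated_partial_linear_shift[OF L d]
      using differentiable_linear_shift[OF L d] by (auto simp: differentiable_def)
    show "L (\<phi> (x + h)) = 0" if "norm x > r + norm h" for x
    proof -
      have "norm x \<le> norm (x + h) + norm h" using norm_triangle_ineq4[of "x + h" h] by simp
      then have "norm (x + h) > r" using that by linarith
      then show ?thesis using r[of "x + h" "[]"] linear_0[OF bounded_linear.linear[OF L]] by simp
    qed
  qed
qed

lemma test_function_add:
  assumes \<phi>: "test_function \<phi>" and \<psi>: "test_function \<psi>"
  shows "test_function (\<lambda>x. \<phi> x + \<psi> x)"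
proof -
  obtain r where r: "\<And>\<alpha> x. norm x > r \<Longrightarrow> iterated_partial \<alpha> \<phi> x = 0" using test_function_support[OF \<phi>] by metis
  obtain s where s: "\<And>\<alpha> x. norm x > s \<Longrightarrow> iterated_partial \<alpha> \<psi> x = 0" using test_function_support[OF \<psi>] by metis
  note d = test_function_differentiable[OF \<phi>] test_function_differentiable[OF \<psi>]
  show ?thesis
  proof (rule test_functionI[of _ "max r s"])
    show "iterated_partial \<alpha> (\<lambda>x. \<phi> x + \<psi> x) differentiable at x" for \<alpha> x
      unfolding iterated_partial_add[OF d] by (intro differentiable_add d)
    show "\<phi> x + \<psi> x = 0" if "norm x > max r s" for x
      using r[of x "[]"] s[of x "[]"] that by simp
  qed
qed

lemma continuous_compact_support:
  fixes f :: "real ^ 'n::finite \<Rightarrow> complex"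
  assumes c: "continuous_on UNIV f" and r: "\<And>x. norm x > r \<Longrightarrow> f x = 0"
  shows "\<exists>B. \<forall>x. cmod (f x) \<le> B" and "square_integrable f"
proof -
  have "bounded (f ` cball 0 r)"
    by (intro compact_imp_bounded compact_continuous_image) (auto intro: continuous_on_subset[OF c])
  then obtain B where B: "0 < B" "\<And>x. norm x \<le> r \<Longrightarrow> cmod (f x) \<le> B" unfolding bounded_pos by auto
  have Bx: "cmod (f x) \<le> B" for x using B r[of x] by (cases "norm x \<le> r") auto
  then show "\<exists>B. \<forall>x. cmod (f x) \<le> B" by blast
  have m [measurable]: "f \<in> borel_measurable borel" by (rule borel_measurable_continuous_onI[OF c])
  have "integrable lborel (\<lambda>x. (cmod (f x))\<^sup>2)"
  proof (rule Bochner_Integration.integrable_bound)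
    have "emeasure lborel (cball (0::real^'n) r) < \<infinity>" by (rule emeasure_lborel_cball_finite)
    then show "integrable lborel (\<lambda>x::real^'n. B\<^sup>2 * indicator (cball 0 r) x)"
      by (intro integrable_mult_right integrable_real_indicator) auto
    have "norm ((cmod (f x))\<^sup>2) \<le> norm (B\<^sup>2 * indicator (cball 0 r) x)" for x
      using Bx[of x] r[of x] by (cases "norm x \<le> r") (auto intro: power_mono)
    then show "AE x in lborel. norm ((cmod (f x))\<^sup>2) \<le> norm (B\<^sup>2 * indicator (cball 0 r) x)" by simp
  qed measurable
  then show "square_integrable f" using m by (simp add: square_integrable_def)
qed

lemma test_function_continuous: "test_function \<phi> \<Longrightarrow> continuous_on UNIV \<phi>"
  using test_function_differentiable[of \<phi> "[]"]
  by (auto intro!: continuous_at_imp_continuous_on differentiable_imp_continuous_within)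

lemma test_function_bounded: "test_function \<phi> \<Longrightarrow> \<exists>B. \<forall>x. cmod (\<phi> x) \<le> B"
  using test_function_support[of \<phi>] continuous_compact_support(1)[OF test_function_continuous]
  by (metis iterated_partial.simps(1))

lemma test_function_square_integrable: "test_function \<phi> \<Longrightarrow> square_integrable \<phi>"
  using test_function_support[of \<phi>] continuous_compact_support(2)[OF test_function_continuous]
  by (metis iterated_partial.simps(1))

section \<open>Difference quotients\<close>

text \<open>At \<open>s = 0\<close> the value is 0, which does no harm: all limits are taken at 0 or along nonzero sequences.\<close>

definition diff_quot :: "'n::finite \<Rightarrow> real \<Rightarrow> 'n L2 \<Rightarrow> 'n L2" where
  "diff_quot i s u = (1 / s) *\<^sub>R (trans_L2 (s *\<^sub>R axis i 1) u - u)"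

lemma diff_quot_adjoint: "inner (diff_quot i s u) v = - inner u (diff_quot i (- s) v)"
  by (simp add: diff_quot_def inner_diff inner_trans scaleR_minus_left)

lemma mean_value_bound:
  assumes d: "\<And>x. f differentiable (at x)" and B: "\<And>x. cmod (partial_deriv i f x) \<le> B"
  shows "cmod (f (x + s *\<^sub>R axis i 1) - f x) \<le> B * \<bar>s\<bar>"
proof -
  let ?g = "\<lambda>s. f (x + s *\<^sub>R axis i 1)"
  have "norm (?g s - ?g 0) \<le> B * norm (s - 0)"
  proof (rule differentiable_bound[of UNIV])
    show "(?g has_derivative (\<lambda>t. t *\<^sub>R partial_deriv i f (x + s *\<^sub>R axis i 1))) (at s within UNIV)" for s
      using has_derivative_partial_deriv_line[OF d] by (simp add: has_vector_derivative_def)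
    show "onorm (\<lambda>t. t *\<^sub>R partial_deriv i f (x + s *\<^sub>R axis i 1)) \<le> B" for s
      using B[of "x + s *\<^sub>R axis i 1"] by (intro onorm_le) (simp add: mult.commute[of B] mult_left_mono)
  qed auto
  then show ?thesis by simp
qed

text \<open>The quotients converge pointwise. By the mean value theorem they are bounded by the supremum of the
derivative, and for small \<open>s\<close> their supports lie in one ball, so dominated convergence applies.\<close>

lemma diff_quot_test_function:
  assumes \<phi>: "test_function \<phi>"
  shows "((\<lambda>s. diff_quot i s (abs_L2 \<phi>)) \<longlongrightarrow> abs_L2 (partial_deriv i \<phi>)) (at 0)"
  unfolding tendsto_at_iff_sequentially
proof (intro allI impI)
  fix S :: "nat \<Rightarrow> real" assume S0: "\<forall>k. S k \<in> UNIV - {0}" and S: "S \<longlonglongrightarrow> 0"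
  note sq = test_function_square_integrable
  note [simp] = sq[OF \<phi>]
  have sqd: "square_integrable (partial_deriv i \<phi>)" by (intro sq test_function_partial_deriv \<phi>)
  have d: "\<phi> differentiable at x" for x using test_function_differentiable[OF \<phi>, of "[]"] by simp
  have [measurable]: "\<phi> \<in> borel_measurable borel" "partial_deriv i \<phi> \<in> borel_measurable borel"
    using sq[OF \<phi>] sqd by (auto simp: square_integrable_def)
  let ?e = "axis i 1 :: real ^ 'a"
  let ?q = "\<lambda>k x. complex_of_real (1 / S k) * (\<phi> (x + S k *\<^sub>R ?e) - \<phi> x) - partial_deriv i \<phi> x"
  have sqs: "square_integrable (\<lambda>x. \<phi> (x + h))" for h by (rule square_integrable_translation) simp
  have eq: "diff_quot i (S k) (abs_L2 \<phi>) - abs_L2 (partial_deriv i \<phi>) = abs_L2 (?q k)" for k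
    unfolding diff_quot_def trans_abs_L2[OF sq[OF \<phi>]] minus_abs_L2[OF sqs sq[OF \<phi>]]
      scaleR_abs_L2[OF square_integrable_diff[OF sqs sq[OF \<phi>]]]
    by (rule minus_abs_L2[OF square_integrable_scale[OF square_integrable_diff[OF sqs sq[OF \<phi>]]] sqd])
  have sqq: "square_integrable (?q k)" for k
    by (rule square_integrable_diff[OF square_integrable_scale[OF square_integrable_diff[OF sqs sq[OF \<phi>]]] sqd])
  obtain r where r: "r > 0" "\<And>\<alpha> x. norm x > r \<Longrightarrow> iterated_partial \<alpha> \<phi> x = 0" using test_function_support[OF \<phi>] by metis
  obtain B where B: "\<And>x. cmod (partial_deriv i \<phi> x) \<le> B"
    using test_function_bounded[OF test_function_partial_deriv[OF \<phi>]] by metis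
  have qB: "cmod (?q k x) \<le> 2 * B" for k x
  proof -
    have "cmod (complex_of_real (1 / S k) * (\<phi> (x + S k *\<^sub>R ?e) - \<phi> x)) \<le> B"
      using mean_value_bound[OF d B, of x "S k"] S0[rule_format, of k]
      by (simp add: norm_mult norm_divide field_simps)
    then show ?thesis using norm_triangle_ineq4[of "complex_of_real (1 / S k) * (\<phi> (x + S k *\<^sub>R ?e) - \<phi> x)" "partial_deriv i \<phi> x"] B[of x] by linarith
  qed
  obtain k0 where k0: "\<And>k. k \<ge> k0 \<Longrightarrow> \<bar>S k\<bar> < 1"
    using S unfolding LIMSEQ_def by (metis dist_real_def diff_zero zero_less_one)
  have q0: "?q k x = 0" if "k \<ge> k0" "norm x > r + 1" for k x
  proof -
    have "norm x \<le> norm (x + S k *\<^sub>R ?e) + norm (S k *\<^sub>R ?e)" using norm_triangle_ineq4[of "x + S k *\<^sub>R ?e" "S k *\<^sub>R ?e"] by simp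
    then have "norm (x + S k *\<^sub>R ?e) > r" using that k0[OF that(1)] by simp
    then show ?thesis using r(2)[of _ "[]"] r(2)[of _ "[i]"] that by simp
  qed
  have lim0: "(\<lambda>k. LINT x|lborel. (cmod (?q (k + k0) x))\<^sup>2) \<longlonglongrightarrow> (LINT x|(lborel :: (real^'a) measure). 0)"
  proof (rule integral_dominated_convergence)
    show "integrable lborel (\<lambda>x::real^'a. (2 * B)\<^sup>2 * indicator (cball 0 (r + 1)) x)"
    proof -
      have "emeasure lborel (cball (0::real^'a) (r + 1)) < \<infinity>" by (rule emeasure_lborel_cball_finite)
      then show ?thesis by (intro integrable_mult_right integrable_real_indicator) auto
    qed
    have "norm ((cmod (?q (k + k0) x))\<^sup>2) \<le> (2 * B)\<^sup>2 * indicator (cball 0 (r + 1)) x" for k x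
    proof (cases "norm x \<le> r + 1")
      case True
      then show ?thesis using power_mono[OF qB norm_ge_zero, of "k + k0" x 2] by simp
    next
      case False
      then show ?thesis using q0[of "k + k0" x] by simp
    qed
    then show "AE x in lborel. norm ((cmod (?q (k + k0) x))\<^sup>2) \<le> (2 * B)\<^sup>2 * indicator (cball 0 (r + 1)) x" for k
      by simp
    have "(\<lambda>k. ?q (k + k0) x) \<longlonglongrightarrow> 0" for x
    proof -
      have quot: "cmod ((\<phi> (x + s *\<^sub>R ?e) - \<phi> x) /\<^sub>R s - partial_deriv i \<phi> x)
          = cmod (\<phi> (x + s *\<^sub>R ?e) - \<phi> x - s *\<^sub>R partial_deriv i \<phi> x) / \<bar>s\<bar>" if "s \<noteq> 0" for s
      proof -
        have "(\<phi> (x + s *\<^sub>R ?e) - \<phi> x) /\<^sub>R s - partial_deriv i \<phi> x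
            = (\<phi> (x + s *\<^sub>R ?e) - \<phi> x - s *\<^sub>R partial_deriv i \<phi> x) /\<^sub>R s"
          using that by (simp add: scaleR_diff_right)
        then show ?thesis by (simp add: divide_inverse mult.commute)
      qed
      have lim: "\<forall>e>0. \<exists>d>0. \<forall>s. s \<noteq> 0 \<and> \<bar>s\<bar> < d \<longrightarrow>
          cmod (\<phi> (x + s *\<^sub>R ?e) - \<phi> x - s *\<^sub>R partial_deriv i \<phi> x) / \<bar>s\<bar> < e"
        using has_derivative_partial_deriv[OF d, of x i]
        unfolding has_vector_derivative_def has_derivative_at' by simp
      have "((\<lambda>s. (\<phi> (x + s *\<^sub>R ?e) - \<phi> x) /\<^sub>R s) \<longlongrightarrow> partial_deriv i \<phi> x) (at 0)"
        unfolding tendsto_iff eventually_at dist_norm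
      proof (intro allI impI)
        fix e :: real assume "0 < e"
        with lim obtain \<delta> where "\<delta> > 0" "\<And>s. s \<noteq> 0 \<Longrightarrow> \<bar>s\<bar> < \<delta> \<Longrightarrow>
          cmod (\<phi> (x + s *\<^sub>R ?e) - \<phi> x - s *\<^sub>R partial_deriv i \<phi> x) / \<bar>s\<bar> < e" by blast
        then show "\<exists>d>0. \<forall>s\<in>UNIV. s \<noteq> 0 \<and> norm (s - 0) < d \<longrightarrow>
          cmod ((\<phi> (x + s *\<^sub>R ?e) - \<phi> x) /\<^sub>R s - partial_deriv i \<phi> x) < e"
          by (intro exI[of _ \<delta>]) (auto simp: quot)
      qed
      then have "(\<lambda>k. (\<phi> (x + S (k + k0) *\<^sub>R ?e) - \<phi> x) /\<^sub>R S (k + k0)) \<longlonglongrightarrow> partial_deriv i \<phi> x"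
        unfolding tendsto_at_iff_sequentially using S0 LIMSEQ_ignore_initial_segment[OF S, of k0] by (auto simp: comp_def)
      moreover have "z /\<^sub>R s = complex_of_real (1 / s) * z" for z s
        by (simp add: scaleR_conv_of_real inverse_eq_divide)
      ultimately have "(\<lambda>k. complex_of_real (1 / S (k + k0)) * (\<phi> (x + S (k + k0) *\<^sub>R ?e) - \<phi> x)) \<longlonglongrightarrow> partial_deriv i \<phi> x"
        by (simp only:)
      then show ?thesis by (rule LIM_zero)
    qed
    then have "(\<lambda>k. (cmod (?q (k + k0) x))\<^sup>2) \<longlonglongrightarrow> 0" for x
      by (intro tendsto_null_power tendsto_norm_zero) simp_all
    then show "AE x in lborel. (\<lambda>k. (cmod (?q (k + k0) x))\<^sup>2) \<longlonglongrightarrow> 0" by simp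
  qed measurable
  then have "(\<lambda>k. (norm (diff_quot i (S (k + k0)) (abs_L2 \<phi>) - abs_L2 (partial_deriv i \<phi>)))\<^sup>2) \<longlonglongrightarrow> 0"
    unfolding eq norm_abs_L2[OF sqq] by simp
  then have "(\<lambda>k. sqrt ((norm (diff_quot i (S (k + k0)) (abs_L2 \<phi>) - abs_L2 (partial_deriv i \<phi>)))\<^sup>2)) \<longlonglongrightarrow> sqrt 0"
    by (rule tendsto_real_sqrt)
  then have "(\<lambda>k. diff_quot i (S (k + k0)) (abs_L2 \<phi>) - abs_L2 (partial_deriv i \<phi>)) \<longlonglongrightarrow> 0"
    by (simp add: tendsto_norm_zero_iff)
  then have "(\<lambda>k. diff_quot i (S (k + k0)) (abs_L2 \<phi>)) \<longlonglongrightarrow> abs_L2 (partial_deriv i \<phi>)"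
    by (simp add: LIM_zero_iff)
  then show "((\<lambda>s. diff_quot i s (abs_L2 \<phi>)) \<circ> S) \<longlonglongrightarrow> abs_L2 (partial_deriv i \<phi>)"
    using LIMSEQ_offset[of "\<lambda>k. diff_quot i (S k) (abs_L2 \<phi>)" k0] by (simp add: comp_def)
qed

section \<open>Smooth bump functions\<close>

text \<open>The function \<open>exp (- 1 / t)\<close> for \<open>t > 0\<close>, continued by 0, multiplied with a polynomial in \<open>1 / t\<close>.
This class is closed under differentiation, which makes its members smooth.\<close>

definition flat_exp :: "real poly \<Rightarrow> real \<Rightarrow> real" where
  "flat_exp p t = (if t > 0 then poly p (inverse t) * exp (- inverse t) else 0)"

lemma poly_times_exp_minus_at_top: "((\<lambda>x. poly p x * exp (- x)) \<longlongrightarrow> (0::real)) at_top"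
proof -
  have "((\<lambda>x. \<Sum>i\<le>degree p. coeff p i * (x ^ i / exp x)) \<longlongrightarrow> (\<Sum>i\<le>degree p. coeff p i * 0)) at_top"
    by (intro tendsto_intros tendsto_power_div_exp_0)
  then show ?thesis by (simp add: poly_altdef sum_distrib_right exp_minus divide_inverse mult.assoc)
qed

lemma flat_exp_at_right_0: "(flat_exp p \<longlongrightarrow> 0) (at_right 0)"
proof -
  have "((\<lambda>t. poly p (inverse t) * exp (- inverse t)) \<longlongrightarrow> 0) (at_right 0)"
    using filterlim_compose[OF poly_times_exp_minus_at_top filterlim_inverse_at_top_right] .
  then show ?thesis
  proof (rule Lim_transform_eventually)
    show "\<forall>\<^sub>F t in at_right 0. poly p (inverse t) * exp (- inverse t) = flat_exp p t"
      by (simp add: eventually_at_right_less flat_exp_def eventually_at_filter)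
  qed
qed

lemma DERIV_flat_exp: "(flat_exp p has_field_derivative flat_exp ([:0, 0, 1:] * (p - pderiv p)) t) (at t)"
proof -
  consider "t > 0" | "t < 0" | "t = 0" by linarith
  then show ?thesis
  proof cases
    case 1
    have "((\<lambda>t. poly p (inverse t) * exp (- inverse t)) has_field_derivative
       (poly (pderiv p) (inverse t) * (- (inverse t * inverse t)) * exp (- inverse t)
        + poly p (inverse t) * (exp (- inverse t) * (inverse t * inverse t)))) (at t)"
      using 1 by (auto intro!: derivative_eq_intros simp: power2_eq_square field_simps)
    then have "(flat_exp p has_field_derivative
       (poly (pderiv p) (inverse t) * (- (inverse t * inverse t)) * exp (- inverse t)
        + poly p (inverse t) * (exp (- inverse t) * (inverse t * inverse t)))) (at t)"
      by (rule has_field_derivative_transform_within_open[of _ _ _ "{0<..}"]) (use 1 in \<open>auto simp: flat_exp_def\<close>)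
    then show ?thesis using 1 by (simp add: flat_exp_def algebra_simps)
  next
    case 2
    have "((\<lambda>t. 0) has_field_derivative 0) (at t)" by simp
    then have "(flat_exp p has_field_derivative 0) (at t)"
      by (rule has_field_derivative_transform_within_open[of _ _ _ "{..<0}"]) (use 2 in \<open>auto simp: flat_exp_def\<close>)
    then show ?thesis using 2 by (simp add: flat_exp_def)
  next
    case 3
    have "((\<lambda>h. (flat_exp p (0 + h) - flat_exp p 0) / h) \<longlongrightarrow> 0) (at 0)"
    proof (rule filterlim_split_at)
      show "((\<lambda>h. (flat_exp p (0 + h) - flat_exp p 0) / h) \<longlongrightarrow> 0) (at_left 0)"
        by (rule tendsto_eventually) (auto simp: eventually_at_filter flat_exp_def)
      have "(flat_exp ([:0, 1:] * p) \<longlongrightarrow> 0) (at_right 0)" by (rule flat_exp_at_right_0)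
      then show "((\<lambda>h. (flat_exp p (0 + h) - flat_exp p 0) / h) \<longlongrightarrow> 0) (at_right 0)"
        by (rule Lim_transform_eventually) (auto simp: eventually_at_filter flat_exp_def field_simps)
    qed
    then show ?thesis using 3 by (simp add: DERIV_def flat_exp_def)
  qed
qed

text \<open>Contains the bumps that are supported in the interval from \<open>a\<close> to \<open>b\<close> and is closed under
differentiation. The parameter \<open>k\<close> controls how steep they are.\<close>

inductive bump_class :: "real \<Rightarrow> real \<Rightarrow> real \<Rightarrow> (real \<Rightarrow> real) \<Rightarrow> bool" for k a b where
  base: "bump_class k a b (\<lambda>t. flat_exp p (k * (t - a)) * flat_exp q (k * (b - t)))"
| add: "bump_class k a b f \<Longrightarrow> bump_class k a b g \<Longrightarrow> bump_class k a b (\<lambda>t. f t + g t)"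
| scale: "bump_class k a b f \<Longrightarrow> bump_class k a b (\<lambda>t. c * f t)"

lemma bump_class_deriv:
  "bump_class k a b f \<Longrightarrow> \<exists>f'. bump_class k a b f' \<and> (\<forall>t. (f has_field_derivative f' t) (at t))"
proof (induction rule: bump_class.induct)
  case (base p q)
  let ?D = "\<lambda>p. [:0, 0, 1:] * (p - pderiv p)"
  let ?f' = "\<lambda>t. k * (flat_exp (?D p) (k * (t - a)) * flat_exp q (k * (b - t)))
     + (- k) * (flat_exp p (k * (t - a)) * flat_exp (?D q) (k * (b - t)))"
  have "bump_class k a b ?f'" by (intro bump_class.add bump_class.scale bump_class.base)
  moreover have "((\<lambda>t. flat_exp p (k * (t - a)) * flat_exp q (k * (b - t))) has_field_derivative ?f' t) (at t)" for t
  proof -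
    have 1: "((\<lambda>t. flat_exp p (k * (t - a))) has_field_derivative flat_exp (?D p) (k * (t - a)) * k) (at t)"
      by (rule DERIV_chain2[OF DERIV_flat_exp]) (auto intro!: derivative_eq_intros)
    have 2: "((\<lambda>t. flat_exp q (k * (b - t))) has_field_derivative flat_exp (?D q) (k * (b - t)) * (- k)) (at t)"
      by (rule DERIV_chain2[OF DERIV_flat_exp]) (auto intro!: derivative_eq_intros)
    show ?thesis by (rule DERIV_cong[OF DERIV_mult[OF 1 2]]) (simp add: algebra_simps)
  qed
  ultimately show ?case by blast
next
  case (add f g)
  then obtain f' g' where "bump_class k a b f'" "bump_class k a b g'"
    "\<And>t. (f has_field_derivative f' t) (at t)" "\<And>t. (g has_field_derivative g' t) (at t)" by blast
  then show ?case by (intro exI[of _ "\<lambda>t. f' t + g' t"]) (auto intro: bump_class.add DERIV_add)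
next
  case (scale f c)
  then obtain f' where "bump_class k a b f'" "\<And>t. (f has_field_derivative f' t) (at t)" by blast
  then show ?case by (intro exI[of _ "\<lambda>t. c * f' t"]) (auto intro: bump_class.scale DERIV_cmult)
qed

lemma bump_class_vanishes:
  assumes "bump_class k a b f" "k > 0" "t \<le> a \<or> b \<le> t" shows "f t = 0"
  using assms by (induction rule: bump_class.induct) (auto simp: flat_exp_def zero_less_mult_iff)

text \<open>A partial derivative changes a single factor, so products of smooth functions of one variable stay in
this form under repeated differentiation.\<close>

definition coord_product :: "('n::finite \<Rightarrow> real \<Rightarrow> real) \<Rightarrow> real ^ 'n \<Rightarrow> complex" where
  "coord_product g x = complex_of_real (\<Prod>i\<in>UNIV. g i (x $ i))"

lemma coord_product_has_derivative:
  fixes g g' :: "'n::finite \<Rightarrow> real \<Rightarrow> real"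
  assumes "\<And>i t. (g i has_field_derivative g' i t) (at t)"
  shows "(coord_product g has_derivative
    (\<lambda>y. complex_of_real (\<Sum>i\<in>UNIV. (g' i (x $ i) * y $ i) * (\<Prod>j\<in>UNIV - {i}. g j (x $ j))))) (at x)"
proof -
  have "((\<lambda>x. g i (x $ i)) has_derivative (\<lambda>y. g' i (x $ i) * y $ i)) (at x)" for i
  proof -
    have "((\<lambda>x. x $ i) has_derivative (\<lambda>y. y $ i)) (at x)" by (rule bounded_linear_imp_has_derivative) (rule bounded_linear_vec_nth)
    moreover have "(g i has_derivative (*) (g' i (x $ i))) (at (x $ i))"
      using assms[of i "x $ i"] by (simp add: has_field_derivative_def)
    ultimately show ?thesis using diff_chain_at[of "\<lambda>x. x $ i" "\<lambda>y. y $ i" x "g i"] by (simp add: comp_def)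
  qed
  then have "((\<lambda>x. \<Prod>i\<in>UNIV. g i (x $ i)) has_derivative
      (\<lambda>y. \<Sum>i\<in>UNIV. (g' i (x $ i) * y $ i) * (\<Prod>j\<in>UNIV - {i}. g j (x $ j)))) (at x)"
    by (intro has_derivative_prod) auto
  then show ?thesis unfolding coord_product_def[abs_def] by (rule has_derivative_of_real)
qed

lemma partial_deriv_coord_product:
  assumes "\<And>i t. (g i has_field_derivative g' i t) (at t)"
  shows "partial_deriv i (coord_product g) = coord_product (g(i := g' i))"
proof
  fix x
  have "partial_deriv i (coord_product g) x =
    complex_of_real (\<Sum>l\<in>UNIV. (g' l (x $ l) * axis i 1 $ l) * (\<Prod>j\<in>UNIV - {l}. g j (x $ j)))"
    by (rule partial_derivI[OF coord_product_has_derivative[OF assms]])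
  also have "(\<Sum>l\<in>UNIV. (g' l (x $ l) * axis i 1 $ l) * (\<Prod>j\<in>UNIV - {l}. g j (x $ j)))
     = (\<Sum>l\<in>UNIV. if l = i then g' i (x $ i) * (\<Prod>j\<in>UNIV - {i}. g j (x $ j)) else 0)"
    by (intro sum.cong) (auto simp: axis_def)
  also have "\<dots> = g' i (x $ i) * (\<Prod>j\<in>UNIV - {i}. g j (x $ j))" by simp
  also have "\<dots> = (\<Prod>j\<in>UNIV. (g(i := g' i)) j (x $ j))"
    by (subst (2) prod.remove[of _ i]) (auto intro!: prod.cong)
  finally show "partial_deriv i (coord_product g) x = coord_product (g(i := g' i)) x"
    unfolding coord_product_def[of "g(i := g' i)" x] .
qed

lemma test_function_coord_product:
  fixes a b :: "real ^ 'n::finite"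
  assumes k: "k > 0" and g: "\<And>i. bump_class k (a $ i) (b $ i) (g i)"
  shows "test_function (coord_product g)"
proof -
  have it: "\<exists>g'. (\<forall>i. bump_class k (a $ i) (b $ i) (g' i)) \<and> iterated_partial \<alpha> (coord_product g) = coord_product g'" for \<alpha>
  proof (induction \<alpha>)
    case Nil
    then show ?case using g by auto
  next
    case (Cons i \<alpha>)
    then obtain h where h: "\<And>i. bump_class k (a $ i) (b $ i) (h i)" "iterated_partial \<alpha> (coord_product g) = coord_product h" by blast
    obtain h' where h': "\<And>i. bump_class k (a $ i) (b $ i) (h' i)" "\<And>i t. (h i has_field_derivative h' i t) (at t)"
      using bump_class_deriv[OF h(1)] by metis
    show ?case
    proof (intro exI[of _ "h(i := h' i)"] conjI allI)
      show "bump_class k (a $ l) (b $ l) ((h(i := h' i)) l)" for l using h(1) h'(1) by simp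
      show "iterated_partial (i # \<alpha>) (coord_product g) = coord_product (h(i := h' i))"
        by (simp only: iterated_partial.simps h(2) partial_deriv_coord_product[OF h'(2)])
    qed
  qed
  obtain r where r: "\<And>x. x \<in> cbox a b \<Longrightarrow> norm x \<le> r"
    using bounded_cbox[of a b] unfolding bounded_iff by blast
  show ?thesis
  proof (rule test_functionI[of _ r])
    show "iterated_partial \<alpha> (coord_product g) differentiable at x" for \<alpha> x
    proof -
      obtain h where h: "\<And>i. bump_class k (a $ i) (b $ i) (h i)" "iterated_partial \<alpha> (coord_product g) = coord_product h" using it by blast
      obtain h' where h': "\<And>i t. (h i has_field_derivative h' i t) (at t)"
        using bump_class_deriv[OF h(1)] by metis
      show ?thesis unfolding h(2) using coord_product_has_derivative[of h h', OF h'] unfolding differentiable_def by blast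
    qed
    show "coord_product g x = 0" if "norm x > r" for x
    proof -
      have "x \<notin> cbox a b" using r[of x] that by auto
      then obtain i where "\<not> (a $ i \<le> x $ i \<and> x $ i \<le> b $ i)" by (auto simp: mem_box_cart)
      then have "g i (x $ i) = 0" using bump_class_vanishes[OF g k] by auto
      then show ?thesis unfolding coord_product_def by (metis (mono_tags, lifting) UNIV_I finite prod_zero_iff of_real_0)
    qed
  qed
qed

definition box_bump :: "real ^ 'n::finite \<Rightarrow> real ^ 'n \<Rightarrow> nat \<Rightarrow> real ^ 'n \<Rightarrow> complex" where
  "box_bump a b n = coord_product (\<lambda>i t. flat_exp 1 (real (Suc n) * (t - a $ i)) * flat_exp 1 (real (Suc n) * (b $ i - t)))"

lemma test_function_box_bump: "test_function (box_bump a b n)"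
  unfolding box_bump_def by (rule test_function_coord_product[of "real (Suc n)" a b]) (auto intro: bump_class.base)

lemma flat_exp_1_bounds: "0 \<le> flat_exp 1 t" "flat_exp 1 t \<le> 1"
  by (auto simp: flat_exp_def)

lemma flat_exp_1_limit: "(\<lambda>n. flat_exp 1 (real (Suc n) * s)) \<longlonglongrightarrow> (if s > 0 then 1 else 0)"
proof (cases "s > 0")
  case True
  have "(\<lambda>n. inverse (real (Suc n)) * inverse s) \<longlonglongrightarrow> 0 * inverse s"
    by (intro tendsto_intros LIMSEQ_inverse_real_of_nat)
  then have "(\<lambda>n. exp (- (inverse (real (Suc n)) * inverse s))) \<longlonglongrightarrow> exp (- 0)"
    by (intro tendsto_intros) simp
  then show ?thesis using True by (simp add: flat_exp_def zero_less_mult_iff)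
next
  case False
  then have "flat_exp 1 (real (Suc n) * s) = 0" for n by (auto simp: flat_exp_def zero_less_mult_iff)
  then show ?thesis using False by simp
qed

text \<open>The bumps are real valued and lie below the indicator of the box. Together with their pointwise convergence
to the indicator this allows dominated convergence.\<close>

lemma box_bump_real: "\<exists>r. box_bump a b n x = complex_of_real r \<and> 0 \<le> r \<and> r \<le> indicator (box a b) x"
proof -
  let ?g = "\<lambda>i. flat_exp 1 (real (Suc n) * (x $ i - a $ i)) * flat_exp 1 (real (Suc n) * (b $ i - x $ i))"
  have g: "0 \<le> ?g i" "?g i \<le> 1" for i
    using flat_exp_1_bounds by (auto intro!: mult_nonneg_nonneg mult_le_one)
  have "0 \<le> (\<Prod>i\<in>UNIV. ?g i)" using g by (intro prod_nonneg) auto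
  moreover have "(\<Prod>i\<in>UNIV. ?g i) \<le> indicator (box a b) x"
  proof (cases "x \<in> box a b")
    case True
    then show ?thesis using g by (simp add: prod_le_1)
  next
    case False
    then obtain i where "\<not> (a $ i < x $ i \<and> x $ i < b $ i)" by (auto simp: mem_box_cart)
    then have "?g i = 0" by (auto simp: flat_exp_def zero_less_mult_iff)
    then have z: "(\<Prod>i\<in>UNIV. ?g i) = 0" by (intro prod_zero) auto
    show ?thesis unfolding z by (rule indicator_pos_le)
  qed
  ultimately show ?thesis unfolding box_bump_def coord_product_def by blast
qed

lemma box_bump_limit: "(\<lambda>n. box_bump a b n x) \<longlonglongrightarrow> indicator (box a b) x"
proof -
  have "(\<lambda>n. \<Prod>i\<in>UNIV. flat_exp 1 (real (Suc n) * (x $ i - a $ i)) * flat_exp 1 (real (Suc n) * (b $ i - x $ i)))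
     \<longlonglongrightarrow> (\<Prod>i\<in>UNIV. (if x $ i - a $ i > 0 then 1 else 0) * (if b $ i - x $ i > 0 then 1 else 0))"
    by (intro tendsto_prod tendsto_mult flat_exp_1_limit)
  moreover have "(\<Prod>i\<in>UNIV. (if x $ i - a $ i > 0 then 1 else 0) * (if b $ i - x $ i > 0 then 1 else 0)) = (indicator (box a b) x :: real)"
  proof (cases "x \<in> box a b")
    case True
    then show ?thesis by (simp add: mem_box_cart)
  next
    case False
    then obtain i where "\<not> (a $ i < x $ i \<and> x $ i < b $ i)" by (auto simp: mem_box_cart)
    then have "(\<Prod>i\<in>UNIV. (if x $ i - a $ i > 0 then 1 else 0) * (if b $ i - x $ i > 0 then 1 else 0)) = (0::real)"
      by (intro prod_zero) auto
    then show ?thesis using False by simp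
  qed
  ultimately have "(\<lambda>n. complex_of_real (\<Prod>i\<in>UNIV. flat_exp 1 (real (Suc n) * (x $ i - a $ i)) * flat_exp 1 (real (Suc n) * (b $ i - x $ i))))
     \<longlonglongrightarrow> complex_of_real (indicator (box a b) x)"
    by (intro tendsto_of_real) simp
  then show ?thesis by (simp add: box_bump_def coord_product_def of_real_indicator)
qed

section \<open>Density of test functions\<close>

text \<open>The measures with densities \<open>max 0 w\<close> and \<open>max 0 (- w)\<close> agree on boxes, hence on all Borel sets, in
particular on \<open>{w > 0}\<close> and \<open>{w < 0}\<close>.\<close>

lemma AE_zero_if_box_integrals_zero:
  fixes w :: "'a::euclidean_space \<Rightarrow> real"
  assumes w [measurable]: "w \<in> borel_measurable borel"
    and int: "\<And>a b. integrable lborel (\<lambda>x. indicator (box a b) x * w x)"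
    and zero: "\<And>a b. (LINT x|lborel. indicator (box a b) x * w x) = 0"
  shows "AE x in lborel. w x = 0"
proof -
  define N1 where "N1 = density lborel (\<lambda>x. ennreal (w x))"
  define N2 where "N2 = density lborel (\<lambda>x. ennreal (- w x))"
  let ?E = "range (\<lambda>(a, b). box a b::'a set)"
  have e: "emeasure N1 (box a b) = (\<integral>\<^sup>+x. ennreal (indicator (box a b) x * w x) \<partial>lborel)"
       "emeasure N2 (box a b) = (\<integral>\<^sup>+x. ennreal (- (indicator (box a b) x * w x)) \<partial>lborel)" for a b
    unfolding N1_def N2_def by (auto simp: emeasure_density indicator_def intro!: nn_integral_cong)
  have fin: "emeasure N1 (box a b) \<noteq> \<infinity>" "emeasure N2 (box a b) \<noteq> \<infinity>" for a b
  proof -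
    have "(\<integral>\<^sup>+x. ennreal (norm (indicator (box a b) x * w x)) \<partial>lborel) < \<infinity>"
      using int[of a b] by (simp add: integrable_iff_bounded)
    then show "emeasure N1 (box a b) \<noteq> \<infinity>" "emeasure N2 (box a b) \<noteq> \<infinity>"
      unfolding e using nn_integral_mono[of lborel "\<lambda>x. ennreal (indicator (box a b) x * w x)" "\<lambda>x. ennreal (norm (indicator (box a b) x * w x))"]
        nn_integral_mono[of lborel "\<lambda>x. ennreal (- (indicator (box a b) x * w x))" "\<lambda>x. ennreal (norm (indicator (box a b) x * w x))"]
      by (auto simp: ennreal_leI abs_le_iff top_unique)
  qed
  have eq: "emeasure N1 (box a b) = emeasure N2 (box a b)" for a b
  proof -
    have "enn2real (emeasure N1 (box a b)) - enn2real (emeasure N2 (box a b)) = 0"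
      using real_lebesgue_integral_def[OF int[of a b]] zero[of a b] by (simp add: e)
    then have "ennreal (enn2real (emeasure N1 (box a b))) = ennreal (enn2real (emeasure N2 (box a b)))" by simp
    moreover have "ennreal (enn2real (emeasure N1 (box a b))) = emeasure N1 (box a b)"
      "ennreal (enn2real (emeasure N2 (box a b))) = emeasure N2 (box a b)"
      using fin[of a b] by (auto intro!: ennreal_enn2real simp: less_top)
    ultimately show ?thesis by (simp only:)
  qed
  have "N1 = N2"
  proof (rule measure_eqI_generator_eq)
    show "Int_stable ?E" by (auto simp: Int_stable_def box_Int_box)
    show "?E \<subseteq> Pow UNIV" "sets N1 = sigma_sets UNIV ?E" "sets N2 = sigma_sets UNIV ?E"
      by (simp_all add: borel_eq_box N1_def N2_def)
    let ?A = "\<lambda>n::nat. box (- (real n *\<^sub>R One)) (real n *\<^sub>R One) :: 'a set"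
    show "range ?A \<subseteq> ?E" "(\<Union>i. ?A i) = UNIV"
      unfolding UN_box_eq_UNIV by auto
    show "emeasure N1 (?A i) \<noteq> \<infinity>" for i by (rule fin)
    show "emeasure N1 X = emeasure N2 X" if "X \<in> ?E" for X using that eq by auto
  qed
  have "AE x in lborel. \<not> w x > 0"
  proof -
    have "emeasure N2 {x. w x > 0} = (\<integral>\<^sup>+x. ennreal (- w x) * indicator {x. w x > 0} x \<partial>lborel)"
      unfolding N2_def by (subst emeasure_density) auto
    also have "\<dots> = (\<integral>\<^sup>+x. 0 \<partial>(lborel :: 'a measure))"
      by (intro nn_integral_cong) (auto simp: indicator_def ennreal_neg)
    finally have "emeasure N2 {x. w x > 0} = 0" by simp
    then have "emeasure N1 {x. w x > 0} = 0" by (simp add: \<open>N1 = N2\<close>)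
    then have "(\<integral>\<^sup>+x. ennreal (w x) * indicator {x. w x > 0} x \<partial>lborel) = 0"
      unfolding N1_def by (subst (asm) emeasure_density) auto
    then have "AE x in lborel. ennreal (w x) * indicator {x. w x > 0} x = 0"
      by (subst (asm) nn_integral_0_iff_AE) auto
    then show ?thesis by eventually_elim (auto simp: indicator_def split: if_splits)
  qed
  moreover have "AE x in lborel. \<not> w x < 0"
  proof -
    have "emeasure N1 {x. w x < 0} = (\<integral>\<^sup>+x. ennreal (w x) * indicator {x. w x < 0} x \<partial>lborel)"
      unfolding N1_def by (subst emeasure_density) auto
    also have "\<dots> = (\<integral>\<^sup>+x. 0 \<partial>(lborel :: 'a measure))"
      by (intro nn_integral_cong) (auto simp: indicator_def ennreal_neg)
    finally have "emeasure N1 {x. w x < 0} = 0" by simp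
    then have "emeasure N2 {x. w x < 0} = 0" by (simp add: \<open>N1 = N2\<close>)
    then have "(\<integral>\<^sup>+x. ennreal (- w x) * indicator {x. w x < 0} x \<partial>lborel) = 0"
      unfolding N2_def by (subst (asm) emeasure_density) auto
    then have "AE x in lborel. ennreal (- w x) * indicator {x. w x < 0} x = 0"
      by (subst (asm) nn_integral_0_iff_AE) auto
    then show ?thesis by eventually_elim (auto simp: indicator_def split: if_splits)
  qed
  ultimately show ?thesis by eventually_elim auto
qed

lemma integrable_box_rep_L2:
  "integrable lborel (\<lambda>x. indicator (box a b) x * cmod (rep_L2 u x))"
proof (rule Bochner_Integration.integrable_bound)
  have "integrable lborel (indicator (box a b) :: real^'a \<Rightarrow> real)"
    using emeasure_lborel_box_finite[of a b] by (intro integrable_real_indicator) auto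
  then show "integrable lborel (\<lambda>x. indicator (box a b) x + (cmod (rep_L2 u x))\<^sup>2)"
    by (intro Bochner_Integration.integrable_add integrable_rep_L2)
  have "z \<le> 1 + z\<^sup>2" if "0 \<le> z" for z :: real using sum_squares_bound[of 1 z] that by simp
  then show "AE x in lborel. norm (indicator (box a b) x * cmod (rep_L2 u x)) \<le> norm (indicator (box a b) x + (cmod (rep_L2 u x))\<^sup>2)"
    by (auto simp: indicator_def)
qed measurable

lemma box_integral_zero:
  assumes orth: "\<And>\<phi>. test_function \<phi> \<Longrightarrow> inner (abs_L2 \<phi>) u = 0"
  shows "(LINT x|lborel. indicator (box a b) x * Re (rep_L2 u x)) = 0"
proof -
  have "(\<lambda>n. LINT x|lborel. Re (cnj (box_bump a b n x) * rep_L2 u x)) \<longlonglongrightarrow> (LINT x|lborel. indicator (box a b) x * Re (rep_L2 u x))"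
  proof (rule integral_dominated_convergence[OF _ _ integrable_box_rep_L2])
    have [measurable]: "box_bump a b n \<in> borel_measurable borel" for n
      using test_function_square_integrable[OF test_function_box_bump] by (auto simp: square_integrable_def)
    show "(\<lambda>x. Re (cnj (box_bump a b n x) * rep_L2 u x)) \<in> borel_measurable lborel" for n by measurable
    show "(\<lambda>x. indicator (box a b) x * Re (rep_L2 u x)) \<in> borel_measurable lborel" by measurable
    have "(\<lambda>n. Re (cnj (box_bump a b n x) * rep_L2 u x)) \<longlonglongrightarrow> Re (cnj (indicator (box a b) x) * rep_L2 u x)" for x
      by (intro tendsto_intros box_bump_limit)
    moreover have "Re (cnj (indicator (box a b) x) * rep_L2 u x) = indicator (box a b) x * Re (rep_L2 u x)" for x
      by (auto simp: indicator_def)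
    ultimately show "AE x in lborel. (\<lambda>n. Re (cnj (box_bump a b n x) * rep_L2 u x)) \<longlonglongrightarrow> indicator (box a b) x * Re (rep_L2 u x)"
      by simp
    have "norm (Re (cnj (box_bump a b n x) * rep_L2 u x)) \<le> indicator (box a b) x * cmod (rep_L2 u x)" for n x
    proof -
      obtain r where r: "box_bump a b n x = complex_of_real r" "0 \<le> r" "r \<le> indicator (box a b) x" using box_bump_real by blast
      have "norm (Re (cnj (box_bump a b n x) * rep_L2 u x)) = r * \<bar>Re (rep_L2 u x)\<bar>" using r by (simp add: abs_mult)
      also have "\<dots> \<le> indicator (box a b) x * cmod (rep_L2 u x)"
        using r abs_Re_le_cmod[of "rep_L2 u x"] by (intro mult_mono) auto
      finally show ?thesis .
    qed
    then show "AE x in lborel. norm (Re (cnj (box_bump a b n x) * rep_L2 u x)) \<le> indicator (box a b) x * cmod (rep_L2 u x)" for n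
      by simp
  qed
  moreover have "(LINT x|lborel. Re (cnj (box_bump a b n x) * rep_L2 u x)) = 0" for n
    using orth[OF test_function_box_bump, of a b n]
      inner_abs_L2[OF test_function_square_integrable[OF test_function_box_bump] square_integrable_rep, of a b n u]
    by (simp add: abs_rep_L2)
  ultimately show ?thesis by (simp add: LIMSEQ_const_iff)
qed

lemma test_function_scale: "test_function \<phi> \<Longrightarrow> test_function (\<lambda>x. c * \<phi> x)"
  using test_function_linear_shift[OF bounded_linear_mult_right, of \<phi> c 0] by simp

lemma AE_Re_zero:
  assumes orth: "\<And>\<phi>. test_function \<phi> \<Longrightarrow> inner (abs_L2 \<phi>) u = 0"
  shows "AE x in lborel. Re (rep_L2 u x) = 0"
proof (rule AE_zero_if_box_integrals_zero[OF _ _ box_integral_zero[OF orth]])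
  show "integrable lborel (\<lambda>x. indicator (box a b) x * Re (rep_L2 u x))" for a b
  proof (rule Bochner_Integration.integrable_bound[OF integrable_box_rep_L2[of a b u]])
    show "AE x in lborel. norm (indicator (box a b) x * Re (rep_L2 u x)) \<le> norm (indicator (box a b) x * cmod (rep_L2 u x))"
      by (auto simp: indicator_def abs_Re_le_cmod)
  qed measurable
qed measurable

text \<open>Testing against bumps that converge to a box gives vanishing integrals of the real part over boxes. The
imaginary part is the real part of a multiple of \<open>u\<close>.\<close>

lemma zero_if_orthogonal_to_test_functions:
  assumes orth: "\<And>\<phi>. test_function \<phi> \<Longrightarrow> inner (abs_L2 \<phi>) u = 0"
  shows "u = 0"
proof -
  have "AE x in lborel. Re (rep_L2 u x) = 0" by (rule AE_Re_zero[OF orth])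
  moreover have "AE x in lborel. Re (rep_L2 (\<J> u) x) = 0"
  proof (rule AE_Re_zero)
    fix \<phi> :: "real ^ 'a \<Rightarrow> complex" assume \<phi>: "test_function \<phi>"
    have "inner (abs_L2 \<phi>) (\<J> u) = - inner (\<J> (abs_L2 \<phi>)) u" by (simp add: inner_J_left)
    also have "\<J> (abs_L2 \<phi>) = abs_L2 (\<lambda>x. \<i> * \<phi> x)" by (rule scaleC_abs_L2[OF test_function_square_integrable[OF \<phi>]])
    finally show "inner (abs_L2 \<phi>) (\<J> u) = 0" using orth[OF test_function_scale[OF \<phi>]] by simp
  qed
  moreover have "AE x in lborel. rep_L2 (\<J> u) x = \<i> * rep_L2 u x"
    using rep_abs_L2[OF square_integrable_scale[OF square_integrable_rep], of \<i> u]
      scaleC_abs_L2[OF square_integrable_rep, of \<i> u] by (simp add: abs_rep_L2)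
  ultimately have "AE x in lborel. rep_L2 u x = 0" by eventually_elim (simp add: complex_eq_iff)
  then have "abs_L2 (rep_L2 u) = abs_L2 (\<lambda>x. 0)"
    by (subst abs_L2_eq_iff) (auto simp: square_integrable_rep square_integrable_zero)
  then show ?thesis by (simp add: abs_rep_L2 zero_L2_def)
qed

definition test_vectors :: "'n::finite L2 set" where "test_vectors = {abs_L2 \<phi> |\<phi>. test_function \<phi>}"

lemma dense_test_vectors: "closure test_vectors = UNIV"
proof (rule dense_if_orthogonal_complement_trivial)
  note sq = test_function_square_integrable
  have "test_function (\<lambda>x::real^'a. 0)"
    using test_function_scale[OF test_function_box_bump, of 0 0 0 0] by simp
  then show "subspace (test_vectors :: 'a L2 set)"
    unfolding subspace_def test_vectors_def
    by (auto simp: zero_L2_def plus_abs_L2[OF sq sq] scaleR_abs_L2[OF sq] intro!: test_function_add test_function_scale)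
  show "x = 0" if "\<And>s. s \<in> test_vectors \<Longrightarrow> inner s x = 0" for x :: "'a L2"
    using that by (intro zero_if_orthogonal_to_test_functions) (auto simp: test_vectors_def)
qed

section \<open>Multiplication operators\<close>

lemma square_integrable_mult_bounded:
  assumes V: "V \<in> borel_measurable borel" "\<And>x. \<bar>V x\<bar> \<le> B" and f: "square_integrable f"
  shows "square_integrable (\<lambda>x. complex_of_real (V x) * f x)"
proof -
  have [measurable]: "f \<in> borel_measurable borel" "V \<in> borel_measurable borel" using f V by (auto simp: square_integrable_def)
  have "integrable lborel (\<lambda>x. (cmod (complex_of_real (V x) * f x))\<^sup>2)"
  proof (rule Bochner_Integration.integrable_bound)
    show "integrable lborel (\<lambda>x. B\<^sup>2 * (cmod (f x))\<^sup>2)" using f by (simp add: square_integrable_def)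
    have "norm ((cmod (complex_of_real (V x) * f x))\<^sup>2) \<le> norm (B\<^sup>2 * (cmod (f x))\<^sup>2)" for x
    proof -
      have "\<bar>V x\<bar>\<^sup>2 * (cmod (f x))\<^sup>2 \<le> B\<^sup>2 * (cmod (f x))\<^sup>2"
        using V(2)[of x] by (intro mult_right_mono power_mono) auto
      then show ?thesis by (simp add: norm_mult power_mult_distrib)
    qed
    then show "AE x in lborel. norm ((cmod (complex_of_real (V x) * f x))\<^sup>2) \<le> norm (B\<^sup>2 * (cmod (f x))\<^sup>2)" by simp
  qed measurable
  then show ?thesis by (simp add: square_integrable_def)
qed

locale bounded_multiplier =
  fixes V :: "real ^ 'n::finite \<Rightarrow> real" and B :: real
  assumes V_measurable: "V \<in> borel_measurable borel" and V_bounded: "\<bar>V x\<bar> \<le> B"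
begin

lemma square_integrable_mult: "square_integrable f \<Longrightarrow> square_integrable (\<lambda>x. complex_of_real (V x) * f x)"
  by (rule square_integrable_mult_bounded[OF V_measurable V_bounded])

lemma mult_operator_abs:
  assumes f: "square_integrable f"
  shows "mult_operator V (abs_L2 f) = abs_L2 (\<lambda>x. complex_of_real (V x) * f x)"
proof -
  have "AE x in lborel. complex_of_real (V x) * rep_L2 (abs_L2 f) x = complex_of_real (V x) * f x"
    using rep_abs_L2[OF f] by eventually_elim simp
  then show ?thesis unfolding mult_operator_def
    using abs_L2_eq_iff[OF square_integrable_mult[OF square_integrable_rep] square_integrable_mult[OF f]] by blast
qed

lemma mult_operator_add: "mult_operator V (u + v) = mult_operator V u + mult_operator V v"
proof -
  obtain f where f: "square_integrable f" "u = abs_L2 f" by (rule L2_cases)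
  obtain g where g: "square_integrable g" "v = abs_L2 g" by (rule L2_cases)
  show ?thesis
    unfolding f(2) g(2) plus_abs_L2[OF f(1) g(1)] mult_operator_abs[OF f(1)] mult_operator_abs[OF g(1)]
      mult_operator_abs[OF square_integrable_add[OF f(1) g(1)]]
      plus_abs_L2[OF square_integrable_mult[OF f(1)] square_integrable_mult[OF g(1)]]
    by (simp only: distrib_left)
qed

lemma mult_operator_scaleC: "mult_operator V (scaleC c u) = scaleC c (mult_operator V u)"
proof -
  obtain f where f: "square_integrable f" "u = abs_L2 f" by (rule L2_cases)
  show ?thesis
    unfolding f(2) scaleC_abs_L2[OF f(1)] mult_operator_abs[OF f(1)] mult_operator_abs[OF square_integrable_scale[OF f(1)]]
      scaleC_abs_L2[OF square_integrable_mult[OF f(1)]]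
    by (simp only: mult.left_commute)
qed

lemma mult_operator_scaleR: "mult_operator V (r *\<^sub>R u) = r *\<^sub>R mult_operator V u"
  unfolding scaleR_L2_def by (rule mult_operator_scaleC)

lemma norm_mult_operator: "norm (mult_operator V u) \<le> norm u * \<bar>B\<bar>"
proof -
  obtain f where f: "square_integrable f" "u = abs_L2 f" by (rule L2_cases)
  have "(norm (mult_operator V u))\<^sup>2 = (LINT x|lborel. (cmod (complex_of_real (V x) * f x))\<^sup>2)"
    unfolding f(2) mult_operator_abs[OF f(1)] by (rule norm_abs_L2[OF square_integrable_mult[OF f(1)]])
  also have "\<dots> \<le> (LINT x|lborel. B\<^sup>2 * (cmod (f x))\<^sup>2)"
  proof (rule integral_mono)
    show "integrable lborel (\<lambda>x. (cmod (complex_of_real (V x) * f x))\<^sup>2)"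
      using square_integrable_mult[OF f(1)] by (simp add: square_integrable_def)
    show "integrable lborel (\<lambda>x. B\<^sup>2 * (cmod (f x))\<^sup>2)" using f(1) by (simp add: square_integrable_def)
    fix x
    have "\<bar>V x\<bar>\<^sup>2 * (cmod (f x))\<^sup>2 \<le> B\<^sup>2 * (cmod (f x))\<^sup>2"
      using V_bounded[of x] by (intro mult_right_mono power_mono) auto
    then show "(cmod (complex_of_real (V x) * f x))\<^sup>2 \<le> B\<^sup>2 * (cmod (f x))\<^sup>2"
      by (simp add: norm_mult power_mult_distrib)
  qed
  also have "\<dots> = (norm u * \<bar>B\<bar>)\<^sup>2" by (simp add: f(2) norm_abs_L2[OF f(1)] power_mult_distrib)
  finally show ?thesis by (rule power2_le_imp_le) simp
qed

lemma bounded_linear_mult_operator: "bounded_linear (mult_operator V)"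
  by (rule bounded_linear_intro[OF mult_operator_add mult_operator_scaleR norm_mult_operator])

lemma inner_mult_operator:
  "inner u (mult_operator V v) = (LINT x|lborel. V x * Re (cnj (rep_L2 u x) * rep_L2 v x))"
  using inner_abs_L2[OF square_integrable_rep[of u] square_integrable_mult[OF square_integrable_rep[of v]]]
  unfolding abs_rep_L2 mult_operator_def
  by (simp add: mult.left_commute algebra_simps)

lemma mult_operator_sym: "inner (mult_operator V u) v = inner u (mult_operator V v)"
  unfolding inner_commute[of "mult_operator V u"] inner_mult_operator by (simp add: algebra_simps)

lemma inner_mult_operator_self: "inner u (mult_operator V u) = (LINT x|lborel. V x * (cmod (rep_L2 u x))\<^sup>2)"
  unfolding inner_mult_operator by (simp add: cmod_def power2_eq_square)

end

section \<open>Weak partial derivatives\<close>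

text \<open>The weak derivative in a single direction, stated with the real inner product. Since test functions may be
multiplied with the imaginary unit, nothing is lost.\<close>

definition weak_partial :: "'n::finite \<Rightarrow> 'n L2 \<Rightarrow> 'n L2 \<Rightarrow> bool" where
  "weak_partial i u v \<longleftrightarrow> (\<forall>\<phi>. test_function \<phi> \<longrightarrow> inner (abs_L2 (partial_deriv i \<phi>)) u = - inner (abs_L2 \<phi>) v)"

lemmas sq_test = test_function_square_integrable

lemma test_function_cnj: "test_function \<phi> \<Longrightarrow> test_function (\<lambda>x. cnj (\<phi> x))"
  using test_function_linear_shift[OF bounded_linear_cnj, of \<phi> 0] by simp

lemma iterated_partial_cnj:
  "test_function \<phi> \<Longrightarrow> iterated_partial \<alpha> (\<lambda>x. cnj (\<phi> x)) = (\<lambda>x. cnj (iterated_partial \<alpha> \<phi> x))"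
  using iterated_partial_linear_shift[OF bounded_linear_cnj test_function_differentiable, of \<phi> \<alpha> 0] by simp

lemma iterated_partial_scale:
  "test_function \<phi> \<Longrightarrow> iterated_partial \<alpha> (\<lambda>x. c * \<phi> x) = (\<lambda>x. c * iterated_partial \<alpha> \<phi> x)"
  using iterated_partial_linear_shift[OF bounded_linear_mult_right test_function_differentiable, of \<phi> \<alpha> c 0] by simp

lemma integral_rep_mult_test:
  assumes "test_function \<phi>"
  shows "(LINT x|lborel. rep_L2 u x * \<phi> x) = cinner (abs_L2 (\<lambda>x. cnj (\<phi> x))) u"
  using cinner_abs_L2[OF sq_test[OF test_function_cnj[OF assms]] square_integrable_rep[of u]]
  by (simp add: abs_rep_L2 mult.commute)

lemma weak_derivative_iff:
  "weak_derivative \<alpha> u v \<longleftrightarrow>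
    (\<forall>\<phi>. test_function \<phi> \<longrightarrow> inner (abs_L2 (iterated_partial \<alpha> \<phi>)) u = (- 1) ^ length \<alpha> * inner (abs_L2 \<phi>) v)"
    (is "_ \<longleftrightarrow> ?R")
proof
  assume w: "weak_derivative \<alpha> u v"
  show ?R
  proof (intro allI impI)
    fix \<phi> :: "real ^ 'a \<Rightarrow> complex" assume \<phi>: "test_function \<phi>"
    note c = test_function_cnj[OF \<phi>]
    have "cinner (abs_L2 (iterated_partial \<alpha> \<phi>)) u = (- 1) ^ length \<alpha> * cinner (abs_L2 \<phi>) v"
      using w[unfolded weak_derivative_def, rule_format, OF c]
      unfolding integral_rep_mult_test[OF c] integral_rep_mult_test[OF test_function_iterated_partial[OF c]]
      by (simp add: iterated_partial_cnj[OF \<phi>])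
    then have "Re (cinner (abs_L2 (iterated_partial \<alpha> \<phi>)) u) = Re (complex_of_real ((- 1) ^ length \<alpha>) * cinner (abs_L2 \<phi>) v)" by simp
    then show "inner (abs_L2 (iterated_partial \<alpha> \<phi>)) u = (- 1) ^ length \<alpha> * inner (abs_L2 \<phi>) v"
    proof -
      have "Re (complex_of_real r * z) = r * Re z" for r z by simp
      then show ?thesis using \<open>Re _ = Re _\<close> unfolding inner_L2_def by (simp only:)
    qed
  qed
next
  assume R: ?R
  show "weak_derivative \<alpha> u v"
    unfolding weak_derivative_def
  proof (intro allI impI)
    fix \<psi> :: "real ^ 'a \<Rightarrow> complex" assume \<psi>: "test_function \<psi>"
    define \<phi> where "\<phi> = (\<lambda>x. cnj (\<psi> x))"
    have \<phi>: "test_function \<phi>" unfolding \<phi>_def by (rule test_function_cnj[OF \<psi>])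
    have 1: "inner (abs_L2 (iterated_partial \<alpha> \<phi>)) u = (- 1) ^ length \<alpha> * inner (abs_L2 \<phi>) v" using R \<phi> by blast
    have "inner (\<J> (abs_L2 (iterated_partial \<alpha> \<phi>))) u = (- 1) ^ length \<alpha> * inner (\<J> (abs_L2 \<phi>)) v"
      using R[rule_format, OF test_function_scale[OF \<phi>, of \<i>]]
      unfolding iterated_partial_scale[OF \<phi>] scaleC_abs_L2[OF sq_test[OF \<phi>]]
        scaleC_abs_L2[OF sq_test[OF test_function_iterated_partial[OF \<phi>]]] .
    then have 2: "inner (abs_L2 (iterated_partial \<alpha> \<phi>)) (\<J> u) = (- 1) ^ length \<alpha> * inner (abs_L2 \<phi>) (\<J> v)"
      unfolding inner_J_left by simp
    have "cinner (abs_L2 (iterated_partial \<alpha> \<phi>)) u = (- 1) ^ length \<alpha> * cinner (abs_L2 \<phi>) v"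
      unfolding cinner_eq 1 2 by (simp add: algebra_simps)
    then show "(LINT x|lborel. rep_L2 u x * iterated_partial \<alpha> \<psi> x) = (- 1) ^ length \<alpha> * (LINT x|lborel. rep_L2 v x * \<psi> x)"
      unfolding integral_rep_mult_test[OF \<psi>] integral_rep_mult_test[OF test_function_iterated_partial[OF \<psi>]]
      by (simp only: \<phi>_def iterated_partial_cnj[OF \<psi>])
  qed
qed

lemma weak_partial_iff_weak_derivative: "weak_partial i u v \<longleftrightarrow> weak_derivative [i] u v"
  by (simp add: weak_partial_def weak_derivative_iff)

lemma eq_if_inner_test_eq:
  assumes "\<And>\<phi>. test_function \<phi> \<Longrightarrow> inner (abs_L2 \<phi>) v = inner (abs_L2 \<phi>) w"
  shows "v = w"
  using zero_if_orthogonal_to_test_functions[of "v - w"] assms by (simp add: inner_diff_right)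

lemma weak_derivative_unique: "weak_derivative \<alpha> u v \<Longrightarrow> weak_derivative \<alpha> u w \<Longrightarrow> v = w"
  unfolding weak_derivative_iff by (rule eq_if_inner_test_eq) (metis mult_cancel_left power_eq_0_iff neg_equal_0_iff_equal one_neq_zero)

lemma weak_partial_unique: "weak_partial i u v \<Longrightarrow> weak_partial i u w \<Longrightarrow> v = w"
  unfolding weak_partial_iff_weak_derivative by (rule weak_derivative_unique)

lemma weak_partial_add: "weak_partial i u u' \<Longrightarrow> weak_partial i v v' \<Longrightarrow> weak_partial i (u + v) (u' + v')"
  by (simp add: weak_partial_def inner_add_right)

lemma weak_partial_scale: "weak_partial i u u' \<Longrightarrow> weak_partial i (r *\<^sub>R u) (r *\<^sub>R u')"
  by (simp add: weak_partial_def)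

lemma weak_partial_0: "weak_partial i 0 0"
  by (simp add: weak_partial_def)

lemma weak_partial_J:
  assumes "weak_partial i u u'" shows "weak_partial i (\<J> u) (\<J> u')"
  unfolding weak_partial_def
proof (intro allI impI)
  fix \<phi> :: "real ^ 'a \<Rightarrow> complex" assume \<phi>: "test_function \<phi>"
  have "inner (abs_L2 (partial_deriv i (\<lambda>x. \<i> * \<phi> x))) u = - inner (abs_L2 (\<lambda>x. \<i> * \<phi> x)) u'"
    using assms test_function_scale[OF \<phi>, of \<i>] unfolding weak_partial_def by blast
  moreover have "partial_deriv i (\<lambda>x. \<i> * \<phi> x) = (\<lambda>x. \<i> * partial_deriv i \<phi> x)"
    using iterated_partial_scale[OF \<phi>, of "[i]" \<i>] by simp
  ultimately have "inner (\<J> (abs_L2 (partial_deriv i \<phi>))) u = - inner (\<J> (abs_L2 \<phi>)) u'"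
    unfolding scaleC_abs_L2[OF sq_test[OF \<phi>]] scaleC_abs_L2[OF sq_test[OF test_function_partial_deriv[OF \<phi>]]] by simp
  then show "inner (abs_L2 (partial_deriv i \<phi>)) (\<J> u) = - inner (abs_L2 \<phi>) (\<J> u')"
    unfolding inner_J_left by simp
qed

lemma weak_partial_trans:
  assumes "weak_partial i u u'" shows "weak_partial i (trans_L2 h u) (trans_L2 h u')"
  unfolding weak_partial_def
proof (intro allI impI)
  fix \<phi> :: "real ^ 'a \<Rightarrow> complex" assume \<phi>: "test_function \<phi>"
  let ?\<psi> = "\<lambda>x. \<phi> (x + (- h))"
  have \<psi>: "test_function ?\<psi>" using test_function_linear_shift[OF bounded_linear_ident \<phi>, of "- h"] .
  have "partial_deriv i ?\<psi> = (\<lambda>x. partial_deriv i \<phi> (x + (- h)))"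
    using iterated_partial_linear_shift[OF bounded_linear_ident test_function_differentiable[OF \<phi>], of "[i]" "- h"] by simp
  then have "inner (abs_L2 (\<lambda>x. partial_deriv i \<phi> (x + (- h)))) u = - inner (abs_L2 ?\<psi>) u'"
    using assms \<psi> unfolding weak_partial_def by metis
  then have "inner (trans_L2 (- h) (abs_L2 (partial_deriv i \<phi>))) u = - inner (trans_L2 (- h) (abs_L2 \<phi>)) u'"
    unfolding trans_abs_L2[OF sq_test[OF \<phi>]] trans_abs_L2[OF sq_test[OF test_function_partial_deriv[OF \<phi>]]] .
  then show "inner (abs_L2 (partial_deriv i \<phi>)) (trans_L2 h u) = - inner (abs_L2 \<phi>) (trans_L2 h u')"
    by (simp add: inner_trans)
qed

lemma weak_partial_diff: "weak_partial i u u' \<Longrightarrow> weak_partial i v v' \<Longrightarrow> weak_partial i (u - v) (u' - v')"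
  by (simp add: weak_partial_def inner_diff_right)

lemma weak_partial_diff_quot: "weak_partial i u u' \<Longrightarrow> weak_partial i (diff_quot j s u) (diff_quot j s u')"
  unfolding diff_quot_def by (intro weak_partial_scale weak_partial_diff weak_partial_trans)

lemma weak_partial_limit:
  assumes "\<And>n. weak_partial i (u n) (v n)" "u \<longlonglongrightarrow> u'" "v \<longlonglongrightarrow> v'"
  shows "weak_partial i u' v'"
  unfolding weak_partial_def
proof (intro allI impI)
  fix \<phi> :: "real ^ 'a \<Rightarrow> complex" assume \<phi>: "test_function \<phi>"
  have "(\<lambda>n. inner (abs_L2 (partial_deriv i \<phi>)) (u n)) \<longlonglongrightarrow> inner (abs_L2 (partial_deriv i \<phi>)) u'"
    by (intro tendsto_intros assms)
  moreover have "(\<lambda>n. - inner (abs_L2 \<phi>) (v n)) \<longlonglongrightarrow> - inner (abs_L2 \<phi>) v'"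
    by (intro tendsto_intros assms)
  moreover have "inner (abs_L2 (partial_deriv i \<phi>)) (u n) = - inner (abs_L2 \<phi>) (v n)" for n
    using assms(1) \<phi> unfolding weak_partial_def by blast
  ultimately show "inner (abs_L2 (partial_deriv i \<phi>)) u' = - inner (abs_L2 \<phi>) v'"
    using LIMSEQ_unique by simp
qed

lemma diff_quot_test_seq:
  assumes \<phi>: "test_function \<phi>" and S: "\<And>n. S n \<noteq> 0" "S \<longlonglongrightarrow> 0"
  shows "(\<lambda>n. diff_quot i (S n) (abs_L2 \<phi>)) \<longlonglongrightarrow> abs_L2 (partial_deriv i \<phi>)"
  using diff_quot_test_function[OF \<phi>, of i] S unfolding tendsto_at_iff_sequentially by (auto simp: comp_def)

definition unit_fraction :: "nat \<Rightarrow> real" where "unit_fraction n = inverse (real (Suc n))"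

lemma unit_fraction_seq: "unit_fraction n \<noteq> 0" "unit_fraction \<longlonglongrightarrow> 0" "- unit_fraction n \<noteq> 0" "(\<lambda>n. - unit_fraction n) \<longlonglongrightarrow> 0"
proof -
  show "unit_fraction \<longlonglongrightarrow> 0" unfolding unit_fraction_def by (rule LIMSEQ_inverse_real_of_nat)
  from tendsto_minus[OF this] show "(\<lambda>n. - unit_fraction n) \<longlonglongrightarrow> 0" by simp
qed (auto simp: unit_fraction_def)

lemma weak_partial_test:
  assumes \<psi>: "test_function \<psi>" shows "weak_partial i (abs_L2 \<psi>) (abs_L2 (partial_deriv i \<psi>))"
  unfolding weak_partial_def
proof (intro allI impI)
  fix \<phi> :: "real ^ 'a \<Rightarrow> complex" assume \<phi>: "test_function \<phi>"
  have "(\<lambda>n. inner (diff_quot i (unit_fraction n) (abs_L2 \<phi>)) (abs_L2 \<psi>)) \<longlonglongrightarrow> inner (abs_L2 (partial_deriv i \<phi>)) (abs_L2 \<psi>)"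
    by (intro tendsto_inner tendsto_const diff_quot_test_seq \<phi> unit_fraction_seq)
  moreover have "(\<lambda>n. - inner (abs_L2 \<phi>) (diff_quot i (- unit_fraction n) (abs_L2 \<psi>))) \<longlonglongrightarrow> - inner (abs_L2 \<phi>) (abs_L2 (partial_deriv i \<psi>))"
    by (intro tendsto_minus tendsto_inner tendsto_const diff_quot_test_seq \<psi> unit_fraction_seq)
  ultimately show "inner (abs_L2 (partial_deriv i \<phi>)) (abs_L2 \<psi>) = - inner (abs_L2 \<phi>) (abs_L2 (partial_deriv i \<psi>))"
    unfolding diff_quot_adjoint by (rule LIMSEQ_unique)
qed

lemma diff_quot_test_minus:
  assumes \<phi>: "test_function \<phi>"
  shows "((\<lambda>t. diff_quot i (- t) (abs_L2 \<phi>)) \<longlongrightarrow> abs_L2 (partial_deriv i \<phi>)) (at 0)"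
proof -
  have "filterlim (\<lambda>t::real. - t) (at 0) (at 0)"
    unfolding filterlim_at by (auto intro!: tendsto_eq_intros simp: eventually_at_filter)
  from filterlim_compose[OF diff_quot_test_function[OF \<phi>] this] show ?thesis .
qed

text \<open>For a test function \<open>\<phi>\<close> the function \<open>s \<mapsto> \<langle>\<phi>, u(\<cdot> + s e)\<rangle>\<close> is differentiable with derivative
\<open>\<langle>\<phi>, v(\<cdot> + s e)\<rangle>\<close>, which is at most \<open>\<parallel>\<phi>\<parallel> \<parallel>v\<parallel>\<close>. The mean value theorem and the density of test
functions give the bound.\<close>

lemma norm_diff_quot_le:
  assumes w: "weak_partial i u v"
  shows "norm (diff_quot i s u) \<le> norm v"
proof (cases "s = 0")
  case True
  then show ?thesis by (simp add: diff_quot_def)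
next
  case False
  let ?U = "\<lambda>s. trans_L2 (s *\<^sub>R axis i 1)"
  have "norm (?U s u - u) \<le> \<bar>s\<bar> * norm v"
  proof (rule norm_le_if_inner_le_on_dense[OF dense_test_vectors])
    fix x :: "'a L2" assume "x \<in> test_vectors"
    then obtain \<phi> where \<phi>: "test_function \<phi>" "x = abs_L2 \<phi>" by (auto simp: test_vectors_def)
    let ?f = "\<lambda>s. inner x (?U s u)"
    have d: "(?f has_field_derivative inner x (?U s v)) (at s within UNIV)" for s
      unfolding DERIV_def
    proof -
      have "((\<lambda>t. - inner (diff_quot i (- t) x) (?U s u)) \<longlongrightarrow> - inner (abs_L2 (partial_deriv i \<phi>)) (?U s u)) (at 0)"
        unfolding \<phi>(2) by (intro tendsto_intros diff_quot_test_minus \<phi>)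
      moreover have "- inner (abs_L2 (partial_deriv i \<phi>)) (?U s u) = inner x (?U s v)"
        using weak_partial_trans[OF w, of "s *\<^sub>R axis i 1"] \<phi> by (simp add: weak_partial_def)
      moreover have "- inner (diff_quot i (- t) x) (?U s u) = (?f (s + t) - ?f s) / t" for t
      proof -
        have "?U (s + t) u = trans_L2 (t *\<^sub>R axis i 1) (?U s u)"
          by (simp add: trans_trans scaleR_add_left add.commute)
        then show ?thesis unfolding diff_quot_adjoint by (simp add: diff_quot_def inner_diff_right)
      qed
      ultimately show "((\<lambda>t. (?f (s + t) - ?f s) / t) \<longlongrightarrow> inner x (?U s v)) (at 0)" by (simp only:)
    qed
    have "norm (?f s - ?f 0) \<le> (norm x * norm v) * norm (s - 0)"
    proof (rule field_differentiable_bound[OF convex_UNIV d])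
      show "norm (inner x (?U z v)) \<le> norm x * norm v" for z
        using Cauchy_Schwarz_ineq2[of x "?U z v"] by (simp add: norm_trans)
    qed auto
    then show "inner x (?U s u - u) \<le> \<bar>s\<bar> * norm v * norm x"
      by (simp add: inner_diff_right mult_ac)
  qed simp
  then show ?thesis unfolding diff_quot_def norm_scaleR using False by (simp add: pos_divide_le_eq mult.commute)
qed

text \<open>Against test functions the difference quotients converge. Being bounded, they have a weak limit, which is
the derivative.\<close>

lemma weak_partial_exists_if_diff_quot_bounded:
  assumes "\<And>n. norm (diff_quot i (unit_fraction n) v) \<le> C"
  shows "\<exists>w. weak_partial i v w"
proof -
  have lim: "(\<lambda>n. inner (abs_L2 \<phi>) (diff_quot i (unit_fraction n) v)) \<longlonglongrightarrow> - inner (abs_L2 (partial_deriv i \<phi>)) v"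
    if \<phi>: "test_function \<phi>" for \<phi>
  proof -
    have "(\<lambda>n. - inner (diff_quot i (- unit_fraction n) (abs_L2 \<phi>)) v) \<longlonglongrightarrow> - inner (abs_L2 (partial_deriv i \<phi>)) v"
      by (intro tendsto_intros diff_quot_test_seq \<phi> unit_fraction_seq)
    then show ?thesis unfolding diff_quot_adjoint by simp
  qed
  have "convergent (\<lambda>n. inner s (diff_quot i (unit_fraction n) v))" if "s \<in> test_vectors" for s
    using lim that by (auto simp: test_vectors_def convergent_def)
  then obtain w where w: "\<And>x. (\<lambda>n. inner x (diff_quot i (unit_fraction n) v)) \<longlonglongrightarrow> inner x w"
    using weak_limit_if_convergent_on_dense[of test_vectors "\<lambda>n. diff_quot i (unit_fraction n) v" C]
      dense_test_vectors assms by blast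
  have "weak_partial i v w"
    unfolding weak_partial_def
  proof (intro allI impI)
    fix \<phi> :: "real ^ 'a \<Rightarrow> complex" assume "test_function \<phi>"
    from LIMSEQ_unique[OF lim[OF this] w] show "inner (abs_L2 (partial_deriv i \<phi>)) v = - inner (abs_L2 \<phi>) w" by simp
  qed
  then show ?thesis ..
qed

lemma diff_quot_weakly_tendsto:
  assumes w: "weak_partial i u v" and S: "\<And>n. S n \<noteq> 0" "S \<longlonglongrightarrow> 0"
  shows "(\<lambda>n. inner x (diff_quot i (S n) u)) \<longlonglongrightarrow> inner x v"
proof (rule tendsto_inner_if_weakly_on_dense[OF dense_test_vectors norm_diff_quot_le[OF w]])
  fix s :: "'a L2" assume "s \<in> test_vectors"
  then obtain \<phi> where \<phi>: "test_function \<phi>" "s = abs_L2 \<phi>" by (auto simp: test_vectors_def)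
  have S': "- S n \<noteq> 0" "(\<lambda>n. - S n) \<longlonglongrightarrow> 0" for n using S tendsto_minus[OF S(2)] by auto
  have "(\<lambda>n. - inner (diff_quot i (- S n) s) u) \<longlonglongrightarrow> - inner (abs_L2 (partial_deriv i \<phi>)) u"
    unfolding \<phi>(2) by (intro tendsto_intros diff_quot_test_seq \<phi> S')
  moreover have "- inner (abs_L2 (partial_deriv i \<phi>)) u = inner s v" using w \<phi> by (simp add: weak_partial_def)
  ultimately show "(\<lambda>n. inner s (diff_quot i (S n) u)) \<longlonglongrightarrow> inner s v"
    unfolding diff_quot_adjoint by simp
qed

text \<open>Integration by parts is exact for difference quotients, and both sides pass to the weak limit.\<close>

lemma weak_partial_integration_by_parts:
  assumes u: "weak_partial i u u'" and v: "weak_partial i v v'"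
  shows "inner u' v = - inner u v'"
proof -
  have "(\<lambda>n. inner v (diff_quot i (unit_fraction n) u)) \<longlonglongrightarrow> inner v u'"
    by (rule diff_quot_weakly_tendsto[OF u unit_fraction_seq(1,2)])
  moreover have "(\<lambda>n. - inner u (diff_quot i (- unit_fraction n) v)) \<longlonglongrightarrow> - inner u v'"
    by (intro tendsto_minus diff_quot_weakly_tendsto[OF v unit_fraction_seq(3,4)])
  moreover have "inner v (diff_quot i (unit_fraction n) u) = - inner u (diff_quot i (- unit_fraction n) v)" for n
    unfolding inner_commute[of v] by (rule diff_quot_adjoint)
  ultimately show ?thesis using LIMSEQ_unique by (simp add: inner_commute)
qed

definition sobolev1 :: "'n::finite L2 set" where "sobolev1 = {u. \<forall>i. \<exists>v. weak_partial i u v}"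

definition weak_grad :: "'n::finite \<Rightarrow> 'n L2 \<Rightarrow> 'n L2" where "weak_grad i u = (THE v. weak_partial i u v)"

lemma weak_grad_eq: "weak_partial i u v \<Longrightarrow> weak_grad i u = v"
  unfolding weak_grad_def using weak_partial_unique by blast

lemma weak_partial_grad: "u \<in> sobolev1 \<Longrightarrow> weak_partial i u (weak_grad i u)"
  unfolding sobolev1_def using weak_grad_eq by fastforce

lemma sobolev1I: "(\<And>i. weak_partial i u (f i)) \<Longrightarrow> u \<in> sobolev1"
  unfolding sobolev1_def by blast

lemma test_in_sobolev1: "test_function \<phi> \<Longrightarrow> abs_L2 \<phi> \<in> sobolev1"
  by (rule sobolev1I) (rule weak_partial_test)

text \<open>By the bound on difference quotients, \<open>u\<close> is invariant under translations in the direction \<open>i\<close>. So its inner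
product with a test function does not change when the test function is moved to infinity, where it
tends weakly to 0.\<close>

lemma constant_weakly_imp_zero:
  assumes "weak_partial i u 0" shows "u = 0"
proof (rule zero_if_orthogonal_to_test_functions)
  fix \<phi> :: "real ^ 'a \<Rightarrow> complex" assume \<phi>: "test_function \<phi>"
  let ?U = "\<lambda>n. trans_L2 (- (real n *\<^sub>R axis i 1))"
  have inv: "trans_L2 (real n *\<^sub>R axis i 1) u = u" for n
  proof (cases "n = 0")
    case False
    then show ?thesis using norm_diff_quot_le[OF assms, of "real n"] by (simp add: diff_quot_def divide_le_0_iff)
  qed simp
  have "(\<lambda>n. inner u (?U n (abs_L2 \<phi>))) \<longlonglongrightarrow> inner u 0"
  proof (rule tendsto_inner_if_weakly_on_dense[OF dense_test_vectors, where C = "norm (abs_L2 \<phi>)"])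
    show "norm (?U n (abs_L2 \<phi>)) \<le> norm (abs_L2 \<phi>)" for n by (simp add: norm_trans)
    fix s :: "'a L2" assume "s \<in> test_vectors"
    then obtain \<psi> where \<psi>: "test_function \<psi>" "s = abs_L2 \<psi>" by (auto simp: test_vectors_def)
    obtain r where r: "r > 0" "\<And>\<alpha> x. norm x > r \<Longrightarrow> iterated_partial \<alpha> \<phi> x = 0" using test_function_support[OF \<phi>] by metis
    obtain r' where r': "r' > 0" "\<And>\<alpha> x. norm x > r' \<Longrightarrow> iterated_partial \<alpha> \<psi> x = 0" using test_function_support[OF \<psi>(1)] by metis
    obtain N where N: "r + r' < real N" using reals_Archimedean2 by blast
    have "inner s (?U n (abs_L2 \<phi>)) = 0" if "n \<ge> N" for n
    proof -
      have z: "cnj (\<psi> x) * \<phi> (x + - (real n *\<^sub>R axis i 1)) = 0" for x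
      proof (cases "norm x > r'")
        case True
        then show ?thesis using r'(2)[of x "[]"] by simp
      next
        case False
        have "real n = norm (real n *\<^sub>R (axis i 1 :: real ^ 'a))" by simp
        also have "\<dots> \<le> norm (x + - (real n *\<^sub>R axis i 1)) + norm x"
          using norm_triangle_ineq4[of x "x + - (real n *\<^sub>R axis i 1)"] by simp
        finally have "norm (x + - (real n *\<^sub>R axis i 1)) > r"
          using False that N by linarith
        then show ?thesis using r(2)[of "x + - (real n *\<^sub>R axis i 1)" "[]"] by simp
      qed
      show ?thesis
        unfolding \<psi>(2) trans_abs_L2[OF sq_test[OF \<phi>]]
          inner_abs_L2[OF sq_test[OF \<psi>(1)] square_integrable_translation[OF sq_test[OF \<phi>]]] z
        by simp
    qed
    then have "\<forall>\<^sub>F n in sequentially. inner s (?U n (abs_L2 \<phi>)) = 0" by (auto simp: eventually_sequentially)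
    then show "(\<lambda>n. inner s (?U n (abs_L2 \<phi>))) \<longlonglongrightarrow> inner s 0" by (simp add: tendsto_eventually)
  qed
  moreover have "inner u (?U n (abs_L2 \<phi>)) = inner (abs_L2 \<phi>) u" for n
    using inner_trans[of "real n *\<^sub>R axis i 1" u "abs_L2 \<phi>"] by (simp add: inv inner_commute)
  ultimately show "inner (abs_L2 \<phi>) u = 0" by (simp add: LIMSEQ_const_iff)
qed

section \<open>Regularity and the resolvent\<close>

lemma sobolev1_add: "u \<in> sobolev1 \<Longrightarrow> v \<in> sobolev1 \<Longrightarrow> u + v \<in> sobolev1"
  by (rule sobolev1I) (rule weak_partial_add[OF weak_partial_grad weak_partial_grad])

lemma sobolev1_scale: "u \<in> sobolev1 \<Longrightarrow> r *\<^sub>R u \<in> sobolev1"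
  by (rule sobolev1I) (rule weak_partial_scale[OF weak_partial_grad])

lemma sobolev1_J: "u \<in> sobolev1 \<Longrightarrow> \<J> u \<in> sobolev1"
  by (rule sobolev1I) (rule weak_partial_J[OF weak_partial_grad])

lemma sobolev1_diff_quot: "u \<in> sobolev1 \<Longrightarrow> diff_quot j s u \<in> sobolev1"
  by (rule sobolev1I) (rule weak_partial_diff_quot[OF weak_partial_grad])

lemma sobolev1_0: "0 \<in> sobolev1"
  by (rule sobolev1I) (rule weak_partial_0)

lemma weak_grad_add: "u \<in> sobolev1 \<Longrightarrow> v \<in> sobolev1 \<Longrightarrow> weak_grad i (u + v) = weak_grad i u + weak_grad i v"
  by (intro weak_grad_eq weak_partial_add weak_partial_grad)

lemma weak_grad_scale: "u \<in> sobolev1 \<Longrightarrow> weak_grad i (r *\<^sub>R u) = r *\<^sub>R weak_grad i u"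
  by (intro weak_grad_eq weak_partial_scale weak_partial_grad)

lemma weak_grad_J: "u \<in> sobolev1 \<Longrightarrow> weak_grad i (\<J> u) = \<J> (weak_grad i u)"
  by (intro weak_grad_eq weak_partial_J weak_partial_grad)

lemma weak_grad_diff_quot: "u \<in> sobolev1 \<Longrightarrow> weak_grad i (diff_quot j s u) = diff_quot j s (weak_grad i u)"
  by (intro weak_grad_eq weak_partial_diff_quot weak_partial_grad)

lemma weak_grad_0: "weak_grad i 0 = 0"
  by (intro weak_grad_eq weak_partial_0)

text \<open>Nirenberg's difference quotients. Insert \<open>\<psi> = D\<^sup>* D u\<close>, for a difference quotient \<open>D\<close> in direction \<open>k\<close>
with adjoint \<open>D\<^sup>*\<close>, into the weak form of \<open>u - \<triangle>u = g\<close>. This gives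
\<open>\<Sum>\<^sub>l \<parallel>D \<partial>\<^sub>l u\<parallel>\<^sup>2 \<le> \<parallel>\<psi>\<parallel> \<parallel>g\<parallel> \<le> \<parallel>D \<partial>\<^sub>k u\<parallel> \<parallel>g\<parallel>\<close>, a bound that does not depend on the step.\<close>

lemma elliptic_regularity:
  assumes u: "u \<in> sobolev1"
    and eq: "\<And>\<psi>. \<psi> \<in> sobolev1 \<Longrightarrow> inner \<psi> u + (\<Sum>i\<in>UNIV. inner (weak_grad i \<psi>) (weak_grad i u)) = inner \<psi> g"
  shows "weak_grad i u \<in> sobolev1"
proof -
  have "norm (diff_quot k (unit_fraction n) (weak_grad i u)) \<le> norm g" for k n
  proof -
    let ?s = "unit_fraction n"
    let ?D = "diff_quot k ?s" and ?D' = "diff_quot k (- ?s)"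
    define \<psi> where "\<psi> = (-1) *\<^sub>R ?D' (?D u)"
    have Du: "?D u \<in> sobolev1" by (rule sobolev1_diff_quot[OF u])
    have adj: "inner ((-1) *\<^sub>R ?D' x) y = inner x (?D y)" for x y
      using diff_quot_adjoint[of k "- ?s" x y] by simp
    have \<psi>: "\<psi> \<in> sobolev1" unfolding \<psi>_def by (intro sobolev1_scale sobolev1_diff_quot u)
    have "weak_grad l \<psi> = (-1) *\<^sub>R ?D' (?D (weak_grad l u))" for l
      unfolding \<psi>_def by (simp only: weak_grad_scale[OF sobolev1_diff_quot[OF Du]] weak_grad_diff_quot[OF Du] weak_grad_diff_quot[OF u])
    then have "(norm (?D u))\<^sup>2 + (\<Sum>l\<in>UNIV. (norm (?D (weak_grad l u)))\<^sup>2) = inner \<psi> g"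
      using eq[OF \<psi>] by (simp only: \<psi>_def adj power2_norm_eq_inner)
    also have "\<dots> \<le> norm \<psi> * norm g" by (rule norm_cauchy_schwarz)
    also have "norm \<psi> \<le> norm (?D (weak_grad k u))"
      using norm_diff_quot_le[OF weak_partial_diff_quot[OF weak_partial_grad[OF u]], of k "- ?s" k ?s] by (simp add: \<psi>_def)
    finally have le: "(norm (?D u))\<^sup>2 + (\<Sum>l\<in>UNIV. (norm (?D (weak_grad l u)))\<^sup>2) \<le> norm (?D (weak_grad k u)) * norm g"
      by (simp add: mult_right_mono)
    have single: "(norm (?D (weak_grad l u)))\<^sup>2 \<le> norm (?D (weak_grad k u)) * norm g" for l
    proof -
      have "(norm (?D (weak_grad l u)))\<^sup>2 \<le> (\<Sum>l\<in>UNIV. (norm (?D (weak_grad l u)))\<^sup>2)" by (rule member_le_sum) auto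
      moreover have "0 \<le> (norm (?D u))\<^sup>2" by simp
      ultimately show ?thesis using le by linarith
    qed
    have "norm (?D (weak_grad k u)) \<le> norm g"
    proof (cases "norm (?D (weak_grad k u)) = 0")
      case False
      have "norm (?D (weak_grad k u)) * norm (?D (weak_grad k u)) \<le> norm (?D (weak_grad k u)) * norm g"
        using single[of k] by (simp only: power2_eq_square)
      then show ?thesis using False by (simp only: mult_le_cancel_left_pos[of "norm (?D (weak_grad k u))"] norm_ge_zero less_le simp_thms eq_commute)
    qed (simp only: norm_ge_zero)
    then have "norm (?D (weak_grad k u)) * norm g \<le> norm g * norm g" by (rule mult_right_mono) simp
    then have "(norm (?D (weak_grad i u)))\<^sup>2 \<le> (norm g)\<^sup>2" using single[of i] by (simp add: power2_eq_square)
    then show ?thesis by (rule power2_le_imp_le) simp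
  qed
  then have "\<forall>k. \<exists>w. weak_partial k (weak_grad i u) w" by (intro allI weak_partial_exists_if_diff_quot_bounded)
  then show ?thesis by (simp add: sobolev1_def)
qed

lemma sobolev_2_iff: "u \<in> sobolev 2 \<longleftrightarrow> u \<in> sobolev1 \<and> (\<forall>i. weak_grad i u \<in> sobolev1)"
proof
  assume u: "u \<in> sobolev 2"
  then have ex: "\<And>\<alpha>. length \<alpha> \<le> 2 \<Longrightarrow> \<exists>v. weak_derivative \<alpha> u v" by (simp add: sobolev_def)
  have u1: "u \<in> sobolev1" unfolding sobolev1_def weak_partial_iff_weak_derivative using ex by simp
  moreover have "weak_grad i u \<in> sobolev1" for i
    unfolding sobolev1_def
  proof (intro CollectI allI)
    fix j
    obtain w where w: "weak_derivative [i, j] u w" using ex[of "[i, j]"] by auto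
    have "weak_partial j (weak_grad i u) w"
      unfolding weak_partial_def
    proof (intro allI impI)
      fix \<phi> :: "real ^ 'a \<Rightarrow> complex" assume \<phi>: "test_function \<phi>"
      have "inner (abs_L2 (partial_deriv i (partial_deriv j \<phi>))) u = inner (abs_L2 \<phi>) w"
        using w \<phi> by (simp add: weak_derivative_iff)
      moreover have "inner (abs_L2 (partial_deriv i (partial_deriv j \<phi>))) u = - inner (abs_L2 (partial_deriv j \<phi>)) (weak_grad i u)"
        using weak_partial_grad[OF u1, of i] test_function_partial_deriv[OF \<phi>] unfolding weak_partial_def by blast
      ultimately show "inner (abs_L2 (partial_deriv j \<phi>)) (weak_grad i u) = - inner (abs_L2 \<phi>) w" by simp
    qed
    then show "\<exists>v. weak_partial j (weak_grad i u) v" ..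
  qed
  ultimately show "u \<in> sobolev1 \<and> (\<forall>i. weak_grad i u \<in> sobolev1)" by blast
next
  assume u: "u \<in> sobolev1 \<and> (\<forall>i. weak_grad i u \<in> sobolev1)"
  show "u \<in> sobolev 2"
    unfolding sobolev_def
  proof (intro CollectI allI impI)
    fix \<alpha> :: "'a list" assume "length \<alpha> \<le> 2"
    then consider "\<alpha> = []" | i where "\<alpha> = [i]" | i j where "\<alpha> = [i, j]"
      by (cases \<alpha>; cases "tl \<alpha>"; cases "tl (tl \<alpha>)") auto
    then show "\<exists>v. weak_derivative \<alpha> u v"
    proof cases
      case 1
      then show ?thesis by (auto simp: weak_derivative_iff)
    next
      case 2
      then show ?thesis using weak_partial_grad[of u] u weak_partial_iff_weak_derivative by blast
    next
      case 3
      have "weak_derivative [i, j] u (weak_grad j (weak_grad i u))"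
        unfolding weak_derivative_iff
      proof (intro allI impI)
        fix \<phi> :: "real ^ 'a \<Rightarrow> complex" assume \<phi>: "test_function \<phi>"
        have "inner (abs_L2 (partial_deriv i (partial_deriv j \<phi>))) u = - inner (abs_L2 (partial_deriv j \<phi>)) (weak_grad i u)"
          using weak_partial_grad[of u i] u test_function_partial_deriv[OF \<phi>] unfolding weak_partial_def by blast
        also have "\<dots> = inner (abs_L2 \<phi>) (weak_grad j (weak_grad i u))"
          using weak_partial_grad[of "weak_grad i u" j] u \<phi> unfolding weak_partial_def by simp
        finally show "inner (abs_L2 (iterated_partial [i, j] \<phi>)) u = (- 1) ^ length [i, j] * inner (abs_L2 \<phi>) (weak_grad j (weak_grad i u))"
          by simp
      qed
      then show ?thesis using 3 by blast
    qed
  qed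
qed

lemma laplacian_eq:
  assumes "u \<in> sobolev 2" shows "laplacian u = (\<Sum>i\<in>UNIV. weak_grad i (weak_grad i u))"
  unfolding laplacian_def
proof (rule sum.cong[OF refl])
  fix i
  have u: "u \<in> sobolev1" "weak_grad i u \<in> sobolev1" using assms by (auto simp: sobolev_2_iff)
  have "weak_derivative [i, i] u (weak_grad i (weak_grad i u))"
    unfolding weak_derivative_iff
  proof (intro allI impI)
    fix \<phi> :: "real ^ 'a \<Rightarrow> complex" assume \<phi>: "test_function \<phi>"
    have "inner (abs_L2 (partial_deriv i (partial_deriv i \<phi>))) u = - inner (abs_L2 (partial_deriv i \<phi>)) (weak_grad i u)"
      using weak_partial_grad[OF u(1), of i] test_function_partial_deriv[OF \<phi>] unfolding weak_partial_def by blast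
    also have "\<dots> = inner (abs_L2 \<phi>) (weak_grad i (weak_grad i u))"
      using weak_partial_grad[OF u(2), of i] \<phi> unfolding weak_partial_def by simp
    finally show "inner (abs_L2 (iterated_partial [i, i] \<phi>)) u = (- 1) ^ length [i, i] * inner (abs_L2 \<phi>) (weak_grad i (weak_grad i u))"
      by simp
  qed
  then show "(THE v. weak_derivative [i, i] u v) = weak_grad i (weak_grad i u)"
    using weak_derivative_unique by blast
qed

locale schroedinger_potential =
  fixes V :: "real ^ 'n::finite \<Rightarrow> real" and a :: real
  assumes V_potential: "V \<in> potentials a"
begin

lemma potential_bounds: "V \<in> borel_measurable borel" "- a \<le> V x" "V x \<le> 0"
  using V_potential by (auto simp: potentials_def)

lemma V_multiplier: "bounded_multiplier V a"
proof unfold_locales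
  show "\<bar>V x\<bar> \<le> a" for x using potential_bounds(2,3)[of x] by linarith
qed (rule potential_bounds)

lemma W_multiplier: "bounded_multiplier (\<lambda>x. sqrt (- V x)) (sqrt a)"
proof unfold_locales
  have [measurable]: "V \<in> borel_measurable borel" by (rule potential_bounds)
  show "(\<lambda>x. sqrt (- V x)) \<in> borel_measurable borel" by measurable
  show "\<bar>sqrt (- V x)\<bar> \<le> sqrt a" for x using potential_bounds(2,3)[of x] by simp
qed

abbreviation "MV \<equiv> mult_operator V"
abbreviation "MW \<equiv> mult_operator (\<lambda>x. sqrt (- V x))"

lemmas MV_add = bounded_multiplier.mult_operator_add[OF V_multiplier]
lemmas MV_scaleR = bounded_multiplier.mult_operator_scaleR[OF V_multiplier]
lemmas MV_scaleC = bounded_multiplier.mult_operator_scaleC[OF V_multiplier]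
lemmas MV_sym = bounded_multiplier.mult_operator_sym[OF V_multiplier]
lemmas MW_add = bounded_multiplier.mult_operator_add[OF W_multiplier]
lemmas MW_scaleR = bounded_multiplier.mult_operator_scaleR[OF W_multiplier]
lemmas MW_sym = bounded_multiplier.mult_operator_sym[OF W_multiplier]
lemmas MW_bounded_linear = bounded_multiplier.bounded_linear_mult_operator[OF W_multiplier]

text \<open>The square root of \<open>- V\<close> makes the contribution of the potential to the form a square, so that the
form is an inner product on the graph below.\<close>

lemma MW_MW: "MW (MW u) = - MV u"
proof -
  obtain f where f: "square_integrable f" "u = abs_L2 f" by (rule L2_cases)
  have "complex_of_real (sqrt (- V x)) * (complex_of_real (sqrt (- V x)) * f x) = - (complex_of_real (V x) * f x)" for x
  proof -
    have "sqrt (- V x) * sqrt (- V x) = - V x" using potential_bounds(3)[of x] by simp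
    then show ?thesis by (metis mult.assoc mult_minus_left of_real_minus of_real_mult)
  qed
  then show ?thesis
    unfolding f(2) bounded_multiplier.mult_operator_abs[OF V_multiplier f(1)] bounded_multiplier.mult_operator_abs[OF W_multiplier f(1)]
      bounded_multiplier.mult_operator_abs[OF W_multiplier bounded_multiplier.square_integrable_mult[OF W_multiplier f(1)]]
      uminus_abs_L2[OF bounded_multiplier.square_integrable_mult[OF V_multiplier f(1)]] by (simp only:)
qed

lemma inner_MW_MW: "inner (MW u) (MW v) = - inner u (MV v)"
  unfolding MW_sym MW_MW by simp

lemma inner_MV_nonpos: "inner u (MV u) \<le> 0"
  using inner_MW_MW[of u u] inner_ge_zero[of "MW u"] by simp

text \<open>Project \<open>(f, 0, 0)\<close> orthogonally onto the closed subspace of all triples \<open>(u, \<nabla>u, sqrt (- V) u)\<close>. That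
the remainder is orthogonal to this subspace is the weak equation.\<close>

lemma weak_solution:
  obtains u where "u \<in> sobolev1"
    "\<And>\<psi>. \<psi> \<in> sobolev1 \<Longrightarrow> inner \<psi> u + (\<Sum>i\<in>UNIV. inner (weak_grad i \<psi>) (weak_grad i u)) - inner \<psi> (MV u) = inner \<psi> f"
proof -
  define g where "g u = (u, (\<chi> i. weak_grad i u), MW u)" for u
  define G where "G = g ` sobolev1"
  have "subspace G"
    unfolding subspace_def
  proof (intro conjI ballI allI)
    have "MW 0 = 0" by (rule linear_0[OF bounded_linear.linear[OF MW_bounded_linear]])
    then have "g 0 = 0" by (simp add: g_def weak_grad_0 zero_prod_def vec_eq_iff)
    then show "0 \<in> G" unfolding G_def using sobolev1_0 by (metis imageI)
  next
    fix x y assume "x \<in> G" "y \<in> G"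
    then obtain u v where uv: "u \<in> sobolev1" "v \<in> sobolev1" "x = g u" "y = g v" by (auto simp: G_def)
    then have "x + y = g (u + v)" by (simp add: g_def weak_grad_add MW_add vec_eq_iff)
    then show "x + y \<in> G" using uv sobolev1_add by (auto simp: G_def)
  next
    fix c :: real and x assume "x \<in> G"
    then obtain u where u: "u \<in> sobolev1" "x = g u" by (auto simp: G_def)
    then have "c *\<^sub>R x = g (c *\<^sub>R u)" by (simp add: g_def weak_grad_scale MW_scaleR vec_eq_iff)
    then show "c *\<^sub>R x \<in> G" using u sobolev1_scale by (auto simp: G_def)
  qed
  moreover have "closed G"
    unfolding closed_sequential_limits
  proof (intro allI impI, elim conjE)
    fix x l assume x: "\<forall>n. x n \<in> G" and l: "x \<longlonglongrightarrow> l"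
    then have "\<forall>n. \<exists>u. u \<in> sobolev1 \<and> x n = g u" by (auto simp: G_def)
    then obtain u where u: "\<And>n. u n \<in> sobolev1" "\<And>n. x n = g (u n)" by metis
    have l1: "u \<longlonglongrightarrow> fst l" using tendsto_fst[OF l] by (simp add: u(2) g_def)
    have l2: "(\<lambda>n. weak_grad i (u n)) \<longlonglongrightarrow> fst (snd l) $ i" for i
      using tendsto_vec_nth[OF tendsto_fst[OF tendsto_snd[OF l]], of i] by (simp add: u(2) g_def)
    have l3: "(\<lambda>n. MW (u n)) \<longlonglongrightarrow> snd (snd l)"
      using tendsto_snd[OF tendsto_snd[OF l]] by (simp add: u(2) g_def)
    have w: "weak_partial i (fst l) (fst (snd l) $ i)" for i
      by (rule weak_partial_limit[OF weak_partial_grad[OF u(1)] l1 l2])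
    have "snd (snd l) = MW (fst l)"
      using LIMSEQ_unique[OF l3 bounded_linear.tendsto[OF MW_bounded_linear l1]] .
    moreover have "fst (snd l) = (\<chi> i. weak_grad i (fst l))" using weak_grad_eq[OF w] by (simp add: vec_eq_iff)
    ultimately have "l = g (fst l)" by (simp add: g_def prod_eq_iff)
    moreover have "fst l \<in> sobolev1" by (rule sobolev1I) (rule w)
    ultimately show "l \<in> G" unfolding G_def by (metis imageI)
  qed
  ultimately obtain p where p: "p \<in> G" "\<And>s. s \<in> G \<Longrightarrow> inner ((f, 0, 0) - p) s = 0"
    using closed_subspace_projection[of G "(f, 0, 0)"] by blast
  then obtain u where u: "u \<in> sobolev1" "p = g u" by (auto simp: G_def)
  show thesis
  proof (rule that[OF u(1)])
    fix \<psi> :: "'n L2" assume "\<psi> \<in> sobolev1"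
    then have "inner ((f, 0, 0) - g u) (g \<psi>) = 0" using p(2)[of "g \<psi>"] u(2) by (simp add: G_def)
    then have "inner (f - u) \<psi> - (\<Sum>i\<in>UNIV. inner (weak_grad i u) (weak_grad i \<psi>)) - inner (MW u) (MW \<psi>) = 0"
      by (simp add: g_def inner_vec_def sum_negf)
    then show "inner \<psi> u + (\<Sum>i\<in>UNIV. inner (weak_grad i \<psi>) (weak_grad i u)) - inner \<psi> (MV u) = inner \<psi> f"
    proof -
      have e: "inner (MW u) (MW \<psi>) = - inner \<psi> (MV u)"
        using inner_MW_MW[of \<psi> u] by (simp only: inner_commute[of "MW u" "MW \<psi>"])
      show ?thesis using \<open>inner (f - u) \<psi> - _ - _ = 0\<close> unfolding e
        by (simp add: inner_diff_left inner_diff_right inner_commute)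
    qed
  qed
qed

abbreviation "H \<equiv> schroedinger V"

lemma H_form:
  assumes u: "u \<in> sobolev 2" and \<psi>: "\<psi> \<in> sobolev1"
  shows "inner \<psi> (H u) = - (\<Sum>i\<in>UNIV. inner (weak_grad i \<psi>) (weak_grad i u)) + inner \<psi> (MV u)"
proof -
  have "inner \<psi> (weak_grad i (weak_grad i u)) = - inner (weak_grad i \<psi>) (weak_grad i u)" for i
    using weak_partial_integration_by_parts[OF weak_partial_grad[OF \<psi>, of i] weak_partial_grad[of "weak_grad i u" i]] u by (simp add: sobolev_2_iff)
  then show ?thesis
    by (simp add: schroedinger_def laplacian_eq[OF u] inner_add_right inner_sum_right sum_negf)
qed

lemma H_sym:
  assumes "u \<in> sobolev 2" "v \<in> sobolev 2" shows "inner u (H v) = inner (H u) v"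
proof -
  have s: "u \<in> sobolev1" "v \<in> sobolev1" using assms by (auto simp: sobolev_2_iff)
  have "inner v (MV u) = inner u (MV v)" using MV_sym[of u v] by (simp only: inner_commute[of v])
  then show ?thesis
    unfolding inner_commute[of "H u"] H_form[OF assms(2) s(1)] H_form[OF assms(1) s(2)]
    by (simp add: inner_commute[of "weak_grad _ u"])
qed

lemma H_quadratic:
  assumes u: "u \<in> sobolev 2"
  shows "inner u (H u) = - (\<Sum>i\<in>UNIV. (norm (weak_grad i u))\<^sup>2) + (LINT x|lborel. V x * (cmod (rep_L2 u x))\<^sup>2)"
  using H_form[OF u, of u] u
  by (simp add: sobolev_2_iff power2_norm_eq_inner bounded_multiplier.inner_mult_operator_self[OF V_multiplier])

lemma H_nonpos:
  assumes u: "u \<in> sobolev 2" shows "inner u (H u) \<le> 0"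
proof -
  have "0 \<le> (\<Sum>i\<in>UNIV. inner (weak_grad i u) (weak_grad i u))" by (intro sum_nonneg) simp
  then show ?thesis using H_form[OF u, of u] u inner_MV_nonpos[of u] by (simp add: sobolev_2_iff)
qed

text \<open>Both terms of the form have the same sign, so the gradient vanishes.\<close>

lemma H_form_zero_imp_zero:
  assumes u: "u \<in> sobolev 2" and z: "inner u (H u) = 0" shows "u = 0"
proof -
  have "u \<in> sobolev1" using u by (simp add: sobolev_2_iff)
  have s: "(\<Sum>i\<in>UNIV. inner (weak_grad i u) (weak_grad i u)) = 0"
    using H_form[OF u \<open>u \<in> sobolev1\<close>] z inner_MV_nonpos[of u] sum_nonneg[of UNIV "\<lambda>i. inner (weak_grad i u) (weak_grad i u)"] by simp
  obtain i :: 'n where True by blast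
  have "weak_grad i u = 0"
    using s by (subst (asm) sum_nonneg_eq_0_iff) auto
  then have "weak_partial i u 0" using weak_partial_grad[OF \<open>u \<in> sobolev1\<close>, of i] by simp
  then show ?thesis by (rule constant_weakly_imp_zero)
qed

lemma H_add: "u \<in> sobolev 2 \<Longrightarrow> v \<in> sobolev 2 \<Longrightarrow> u + v \<in> sobolev 2 \<and> H (u + v) = H u + H v"
proof -
  assume u: "u \<in> sobolev 2" and v: "v \<in> sobolev 2"
  then have uv: "u + v \<in> sobolev 2" by (simp add: sobolev_2_iff sobolev1_add weak_grad_add)
  moreover have "H (u + v) = H u + H v"
    unfolding schroedinger_def laplacian_eq[OF u] laplacian_eq[OF v] laplacian_eq[OF uv]
    using u v by (simp add: sobolev_2_iff weak_grad_add MV_add sum.distrib)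
  ultimately show ?thesis by blast
qed

lemma H_scaleR: "u \<in> sobolev 2 \<Longrightarrow> r *\<^sub>R u \<in> sobolev 2 \<and> H (r *\<^sub>R u) = r *\<^sub>R H u"
proof -
  assume u: "u \<in> sobolev 2"
  then have ru: "r *\<^sub>R u \<in> sobolev 2" by (simp add: sobolev_2_iff sobolev1_scale weak_grad_scale)
  moreover have "H (r *\<^sub>R u) = r *\<^sub>R H u"
    unfolding schroedinger_def laplacian_eq[OF u] laplacian_eq[OF ru]
    using u by (simp add: sobolev_2_iff weak_grad_scale MV_scaleR scaleR_right_distrib scaleR_sum_right)
  ultimately show ?thesis by blast
qed

lemma H_J: "u \<in> sobolev 2 \<Longrightarrow> \<J> u \<in> sobolev 2 \<and> H (\<J> u) = \<J> (H u)"
proof -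
  assume u: "u \<in> sobolev 2"
  then have ju: "\<J> u \<in> sobolev 2" by (simp add: sobolev_2_iff sobolev1_J weak_grad_J)
  moreover have "H (\<J> u) = \<J> (H u)"
    unfolding schroedinger_def laplacian_eq[OF u] laplacian_eq[OF ju]
    using u by (simp add: sobolev_2_iff weak_grad_J MV_scaleC scaleC_add_right linear_sum[OF bounded_linear.linear[OF bounded_linear_J]])
  ultimately show ?thesis by blast
qed

lemma sobolev_2_0: "0 \<in> sobolev 2"
  by (simp add: sobolev_2_iff sobolev1_0 weak_grad_0)

lemma subspace_sobolev_2: "subspace (sobolev 2 :: 'n L2 set)"
  using sobolev_2_0 H_add H_scaleR by (simp add: subspace_def)

lemma H_0: "H 0 = 0"
  using H_scaleR[OF sobolev_2_0, of 0] by simp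

lemma linear_operator_H: "linear_operator_on (sobolev 2) H"
  by (rule linear_operator_onI[OF subspace_sobolev_2]) (use H_add H_scaleR H_J in auto)

lemma resolvent_exists: "\<exists>u\<in>sobolev 2. u - H u = f"
proof -
  obtain u where u: "u \<in> sobolev1"
    "\<And>\<psi>. \<psi> \<in> sobolev1 \<Longrightarrow> inner \<psi> u + (\<Sum>i\<in>UNIV. inner (weak_grad i \<psi>) (weak_grad i u)) - inner \<psi> (MV u) = inner \<psi> f"
    using weak_solution[of f] by blast
  have "weak_grad i u \<in> sobolev1" for i
    by (rule elliptic_regularity[OF u(1), of "f + MV u"]) (use u(2) in \<open>force simp: inner_add_right\<close>)
  then have u2: "u \<in> sobolev 2" using u(1) by (simp add: sobolev_2_iff)
  have "u - H u = f"
  proof (rule eq_if_inner_test_eq)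
    fix \<phi> :: "real ^ 'n \<Rightarrow> complex" assume "test_function \<phi>"
    then have \<phi>: "abs_L2 \<phi> \<in> sobolev1" by (rule test_in_sobolev1)
    show "inner (abs_L2 \<phi>) (u - H u) = inner (abs_L2 \<phi>) f"
      unfolding inner_diff_right H_form[OF u2 \<phi>] using u(2)[OF \<phi>] by simp
  qed
  with u2 show ?thesis by blast
qed

lemma resolvent_bound:
  assumes u: "u \<in> sobolev 2" shows "norm u \<le> norm (u - H u)"
proof (cases "u = 0")
  case False
  have "norm u * norm u \<le> inner u (u - H u)"
    using H_nonpos[OF u] by (simp add: inner_diff_right dot_square_norm power2_eq_square)
  also have "\<dots> \<le> norm u * norm (u - H u)" by (rule norm_cauchy_schwarz)
  finally show ?thesis by (rule mult_left_le_imp_le) (use False in simp)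
qed (simp add: H_0)

definition resolvent :: "'n L2 \<Rightarrow> 'n L2" where "resolvent f = (SOME u. u \<in> sobolev 2 \<and> u - H u = f)"

lemma resolvent_solves: "resolvent f \<in> sobolev 2" "resolvent f - H (resolvent f) = f"
  using someI_ex[of "\<lambda>u. u \<in> sobolev 2 \<and> u - H u = f"] resolvent_exists[of f] by (auto simp: resolvent_def)

lemma resolvent_eq:
  assumes u: "u \<in> sobolev 2" shows "resolvent (u - H u) = u"
proof -
  let ?d = "resolvent (u - H u) + (-1) *\<^sub>R u"
  have 1: "(-1) *\<^sub>R u \<in> sobolev 2" "H ((-1) *\<^sub>R u) = (-1) *\<^sub>R H u" using H_scaleR[OF u] by blast+
  have 2: "?d \<in> sobolev 2" "H ?d = H (resolvent (u - H u)) + H ((-1) *\<^sub>R u)" using H_add[OF resolvent_solves(1) 1(1)] by blast+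
  have "?d - H ?d = 0" unfolding 2(2) 1(2) using resolvent_solves(2)[of "u - H u"] by (simp add: algebra_simps)
  then have "norm ?d \<le> 0" using resolvent_bound[OF 2(1)] by simp
  then show ?thesis by simp
qed

text \<open>Symmetry and sign are those of the form of \<open>H\<close>, read at \<open>u = resolvent f\<close> with \<open>f = u - H u\<close>.\<close>

lemma resolvent_positive_contraction: "positive_contraction resolvent"
proof (rule positive_contraction.intro)
  have add: "resolvent (f + g) = resolvent f + resolvent g" for f g
  proof -
    have "resolvent f + resolvent g \<in> sobolev 2" "H (resolvent f + resolvent g) = H (resolvent f) + H (resolvent g)"
      using H_add[OF resolvent_solves(1) resolvent_solves(1)] by blast+
    then show ?thesis using resolvent_eq[of "resolvent f + resolvent g"] resolvent_solves(2)[of f] resolvent_solves(2)[of g] by (simp add: add_diff_add)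
  qed
  have scale: "resolvent (r *\<^sub>R f) = r *\<^sub>R resolvent f" for r f
  proof -
    have "r *\<^sub>R resolvent f \<in> sobolev 2" "H (r *\<^sub>R resolvent f) = r *\<^sub>R H (resolvent f)" using H_scaleR[OF resolvent_solves(1)] by blast+
    then show ?thesis using resolvent_eq[of "r *\<^sub>R resolvent f"] resolvent_solves(2)[of f] by (metis scaleR_diff_right)
  qed
  have bound: "norm (resolvent f) \<le> norm f" for f using resolvent_bound[OF resolvent_solves(1)] resolvent_solves(2) by metis
  show "bounded_linear resolvent" by (rule bounded_linear_intro[where K = 1]) (auto simp: add scale bound)
  show "inner (resolvent f) g = inner f (resolvent g)" for f g
  proof -
    have "inner (resolvent f) (resolvent g - H (resolvent g)) = inner (resolvent f - H (resolvent f)) (resolvent g)"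
      using H_sym[OF resolvent_solves(1)[of f] resolvent_solves(1)[of g]] by (simp add: inner_diff)
    then show ?thesis by (simp only: resolvent_solves(2))
  qed
  show "0 \<le> inner f (resolvent f)" for f
  proof -
    have "0 \<le> inner (resolvent f - H (resolvent f)) (resolvent f)"
    proof -
      have "inner (H (resolvent f)) (resolvent f) \<le> 0"
        using H_nonpos[OF resolvent_solves(1)[of f]] by (simp only: inner_commute[of "H (resolvent f)"])
      moreover have "0 \<le> inner (resolvent f) (resolvent f)" by (rule inner_ge_zero)
      ultimately show ?thesis unfolding inner_diff_left by linarith
    qed
    then show ?thesis by (simp only: resolvent_solves(2))
  qed
  show "inner f (resolvent f) \<le> inner f f" for f
  proof -
    have "inner f (resolvent f) \<le> norm f * norm (resolvent f)" by (rule norm_cauchy_schwarz)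
    also have "\<dots> \<le> norm f * norm f" using bound by (intro mult_left_mono) auto
    also have "\<dots> = inner f f" by (simp add: dot_square_norm power2_eq_square)
    finally show ?thesis .
  qed
qed

lemma resolvent_J: "resolvent (\<J> f) = \<J> (resolvent f)"
proof -
  have "\<J> (resolvent f) \<in> sobolev 2" "H (\<J> (resolvent f)) = \<J> (H (resolvent f))" using H_J[OF resolvent_solves(1)] by blast+
  moreover have "\<J> (resolvent f) - \<J> (H (resolvent f)) = \<J> f"
    using resolvent_solves(2)[of f] by (metis linear_diff[OF bounded_linear.linear[OF bounded_linear_J]])
  ultimately show ?thesis using resolvent_eq[of "\<J> (resolvent f)"] by simp
qed

lemma resolvent_inj: "resolvent f = 0 \<Longrightarrow> f = 0"
  using resolvent_solves(2)[of f] by (simp add: H_0)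

end

section \<open>Spectral measures\<close>

lemma orthogonal_projectionI:
  assumes add: "\<And>u v. P (u + v) = P u + P v" and scale: "\<And>r u. P (r *\<^sub>R u) = r *\<^sub>R P u"
    and J: "\<And>u. P (\<J> u) = \<J> (P u)" and idem: "\<And>u. P (P u) = P u"
    and sym: "\<And>u v. inner u (P v) = inner (P u) v"
  shows "orthogonal_projection P"
  unfolding orthogonal_projection_def
proof (intro conjI allI idem)
  show "linear_operator_on UNIV P" by (rule linear_operator_onI) (auto simp: add scale J)
  show "cinner u (P v) = cinner (P u) v" for u v
    unfolding cinner_eq J[symmetric] sym ..
qed

context positive_contraction
begin

lemma fun_calc_add_fun:
  assumes f: "square_int (\<mu> u) f" and g: "square_int (\<mu> u) g"
  shows "fun_calc (\<lambda>x. f x + g x) u = fun_calc f u + fun_calc g u"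
proof -
  have fg: "square_int (\<mu> u) (\<lambda>x. f x + g x)" by (rule square_int_add[OF \<mu>_sets f g])
  obtain P where P: "approximates u f P" using approximates_exists[OF f] .
  obtain Q where Q: "approximates u g Q" using approximates_exists[OF g] .
  have "approximates u (\<lambda>x. f x + g x) (\<lambda>n. P n + Q n)"
    unfolding approximates_def
  proof (rule tendsto_sandwich[OF _ _ tendsto_const])
    show "(\<lambda>n. 2 * (LINT x|\<mu> u. (poly (P n) x - f x)\<^sup>2) + 2 * (LINT x|\<mu> u. (poly (Q n) x - g x)\<^sup>2)) \<longlonglongrightarrow> 0"
      using P Q unfolding approximates_def by (intro tendsto_add_zero tendsto_mult_right_zero)
    show "\<forall>\<^sub>F n in sequentially. (LINT x|\<mu> u. (poly (P n + Q n) x - (f x + g x))\<^sup>2)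
        \<le> 2 * (LINT x|\<mu> u. (poly (P n) x - f x)\<^sup>2) + 2 * (LINT x|\<mu> u. (poly (Q n) x - g x)\<^sup>2)"
    proof (intro always_eventually allI)
      fix n
      have z: "square_int (\<mu> u) (\<lambda>x. 0)" by (simp add: square_int_def)
      have "(LINT x|\<mu> u. ((poly (P n) x - f x) - (g x - poly (Q n) x))\<^sup>2)
        \<le> 2 * (LINT x|\<mu> u. ((poly (P n) x - f x) - 0)\<^sup>2) + 2 * (LINT x|\<mu> u. (0 - (g x - poly (Q n) x))\<^sup>2)"
        by (rule integral_square_diff_triangle[OF \<mu>_sets square_int_diff[OF \<mu>_sets square_int_poly[OF \<mu>_unit] f] z
              square_int_diff[OF \<mu>_sets g square_int_poly[OF \<mu>_unit]]])
      then show "(LINT x|\<mu> u. (poly (P n + Q n) x - (f x + g x))\<^sup>2)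
        \<le> 2 * (LINT x|\<mu> u. (poly (P n) x - f x)\<^sup>2) + 2 * (LINT x|\<mu> u. (poly (Q n) x - g x)\<^sup>2)"
        by (simp add: algebra_simps)
    qed
  qed (auto intro!: always_eventually)
  from fun_calc_limit[OF fg this] have 1: "(\<lambda>n. poly_op (P n) u + poly_op (Q n) u) \<longlonglongrightarrow> fun_calc (\<lambda>x. f x + g x) u"
    by (simp only: poly_op_add)
  have 2: "(\<lambda>n. poly_op (P n) u + poly_op (Q n) u) \<longlonglongrightarrow> fun_calc f u + fun_calc g u"
    by (intro tendsto_add fun_calc_limit f g P Q)
  show ?thesis by (rule LIMSEQ_unique[OF 1 2])
qed

lemma square_int_indicator:
  assumes "B \<in> sets borel" shows "square_int (\<mu> u) (indicator B)"
  by (rule square_int_bounded[OF \<mu>_unit, where B = 1]) (use assms in \<open>auto simp: indicator_def\<close>)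

lemma inner_fun_calc_indicator:
  assumes "B \<in> sets borel"
  shows "inner u (fun_calc (indicator B) u) = measure (\<mu> u) B"
proof -
  have one: "square_int (\<mu> u) (\<lambda>x. 1)" by (rule square_int_bounded[OF \<mu>_unit, where B = 1]) auto
  have "inner (fun_calc (\<lambda>x. 1) u) (fun_calc (indicator B) u) = (LINT x|\<mu> u. 1 * indicator B x)"
    by (rule inner_fun_calc[OF one square_int_indicator[OF assms]])
  then show ?thesis using assms by (simp add: fun_calc_1)
qed

text \<open>In \<open>L\<^sup>2(\<mu>\<^sub>u)\<close> the indicators of the partial unions converge by dominated convergence.\<close>

lemma fun_calc_indicator_sums:
  assumes B: "\<And>n. B n \<in> sets borel" and dis: "disjoint_family B"
  shows "(\<lambda>n. fun_calc (indicator (B n)) u) sums fun_calc (indicator (\<Union>n. B n)) u"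
proof -
  note B' [measurable] = B
  have Bn: "(\<Union>i<n. B i) \<in> sets borel" for n :: nat by auto
  have BU: "(\<Union>n. B n) \<in> sets borel" by auto
  have fin: "(\<Sum>i<n. fun_calc (indicator (B i)) u) = fun_calc (indicator (\<Union>i<n. B i)) u" for n
  proof (induction n)
    case 0
    have "(indicator (\<Union>i<0. B i) :: real \<Rightarrow> real) = (\<lambda>x. 0)" by (auto simp: fun_eq_iff)
    then show ?case by (simp add: fun_calc_0)
  next
    case (Suc n)
    have "B n \<inter> B i = {}" if "i < n" for i
      using dis that by (intro disjoint_family_onD[of B UNIV]) auto
    then have "B n \<inter> (\<Union>i<n. B i) = {}" by blast
    then have "(\<lambda>x. indicator (\<Union>i<n. B i) x + indicator (B n) x) = (indicator (\<Union>i<Suc n. B i) :: real \<Rightarrow> real)"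
      unfolding lessThan_Suc UN_insert by (auto simp: indicator_def fun_eq_iff)
    then show ?case
      using fun_calc_add_fun[OF square_int_indicator[OF Bn[of n]] square_int_indicator[OF B[of n]], of u] Suc by simp
  qed
  interpret finite_measure "\<mu> u" by (rule \<mu>_finite)
  have "(\<lambda>n. LINT x|\<mu> u. (indicator (\<Union>i<n. B i) x - indicator (\<Union>n. B n) x)\<^sup>2) \<longlonglongrightarrow> (LINT x|\<mu> u. (0::real))"
  proof (rule integral_dominated_convergence[where w = "\<lambda>x. 1"])
    have "(\<lambda>n. (indicator (\<Union>i<n. B i) x - indicator (\<Union>n. B n) x :: real)\<^sup>2) \<longlonglongrightarrow> (indicator (\<Union>n. B n) x - indicator (\<Union>n. B n) x)\<^sup>2" for x
      by (intro tendsto_intros LIMSEQ_indicator_UN)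
    then show "AE x in \<mu> u. (\<lambda>n. (indicator (\<Union>i<n. B i) x - indicator (\<Union>n. B n) x :: real)\<^sup>2) \<longlonglongrightarrow> 0" by simp
    show "AE x in \<mu> u. norm ((indicator (\<Union>i<n. B i) x - indicator (\<Union>n. B n) x :: real)\<^sup>2) \<le> 1" for n
      by (auto simp: indicator_def)
  qed auto
  then have "(\<lambda>n. (norm (fun_calc (indicator (\<Union>i<n. B i)) u - fun_calc (indicator (\<Union>n. B n)) u))\<^sup>2) \<longlonglongrightarrow> 0"
    unfolding norm_fun_calc_diff[OF square_int_indicator[OF Bn] square_int_indicator[OF BU]] by simp
  then have "(\<lambda>n. sqrt ((norm (fun_calc (indicator (\<Union>i<n. B i)) u - fun_calc (indicator (\<Union>n. B n)) u))\<^sup>2)) \<longlonglongrightarrow> sqrt 0" by (rule tendsto_real_sqrt)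
  then have "(\<lambda>n. fun_calc (indicator (\<Union>i<n. B i)) u - fun_calc (indicator (\<Union>n. B n)) u) \<longlonglongrightarrow> 0" by (simp add: tendsto_norm_zero_iff)
  then show ?thesis unfolding sums_def fin by (simp add: LIM_zero_iff)
qed

end

lemma emeasure_scalar_measure:
  assumes E: "projection_valued_measure E" and B: "B \<in> sets borel"
  shows "emeasure (scalar_measure E u) B = ennreal (inner u (E B u))"
  unfolding scalar_measure_def
proof (rule emeasure_measure_of_sigma[OF _ _ _ B])
  have proj: "orthogonal_projection (E B)" if "B \<in> sets borel" for B
    using E that by (auto simp: projection_valued_measure_def)
  have nonneg: "0 \<le> inner u (E B u)" if "B \<in> sets borel" for B
  proof -
    have "cinner u (E B (E B u)) = cinner (E B u) (E B u)" "E B (E B u) = E B u"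
      using proj[OF that] by (auto simp: orthogonal_projection_def)
    then have "inner u (E B u) = inner (E B u) (E B u)" by (simp add: inner_L2_def)
    then show ?thesis by simp
  qed
  show "sigma_algebra UNIV (sets (borel :: real measure))" using sets.sigma_algebra_axioms[of borel] by simp
  show "positive (sets borel) (\<lambda>B. ennreal (inner u (E B u)))"
    using E by (simp add: positive_def projection_valued_measure_def)
  show "countably_additive (sets borel) (\<lambda>B. ennreal (inner u (E B u)))"
  proof (rule countably_additiveI)
    fix A :: "nat \<Rightarrow> real set" assume A: "range A \<subseteq> sets borel" "disjoint_family A"
    then have "(\<lambda>n. E (A n) u) sums E (\<Union>n. A n) u"
      using E by (auto simp: projection_valued_measure_def)
    then have "(\<lambda>n. inner u (E (A n) u)) sums inner u (E (\<Union>n. A n) u)"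
      by (rule bounded_linear.sums[OF bounded_linear_inner_right])
    then show "(\<Sum>n. ennreal (inner u (E (A n) u))) = ennreal (inner u (E (\<Union>n. A n) u))"
      using A nonneg by (intro suminf_ennreal_eq) auto
  qed
qed

lemma sets_scalar_measure [simp, measurable_cong]: "sets (scalar_measure E u) = sets borel"
  unfolding scalar_measure_def using sets.sigma_sets_eq[of borel] by (simp add: sets_measure_of_conv)

lemma measurable_resolvent_map [measurable]: "(\<lambda>r. 1 - inverse r) \<in> borel_measurable (borel :: real measure)"
  by measurable

context schroedinger_potential
begin

interpretation P: positive_contraction resolvent
  by (rule resolvent_positive_contraction)

abbreviation \<rho> :: "real \<Rightarrow> real" where "\<rho> \<equiv> \<lambda>r. 1 - inverse r"

text \<open>Spectral projections of the operator via those of its resolvent: \<open>\<rho>\<close> inverts \<open>s \<mapsto> 1 / (1 - s)\<close>. The value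
\<open>\<rho> 0 = 1\<close> is meaningless, but \<open>0\<close> is a null set for all the measures by \<open>AE_nonzero\<close>.\<close>

definition resolvent_pvm :: "real set \<Rightarrow> 'n L2 \<Rightarrow> 'n L2" where
  "resolvent_pvm B u = P.fun_calc (indicator (\<rho> -` B)) u"

lemma vimage_borel: "B \<in> sets borel \<Longrightarrow> \<rho> -` B \<in> sets borel"
  using measurable_sets[OF measurable_resolvent_map, of B] by simp

lemma projection_valued_measure_resolvent_pvm: "projection_valued_measure resolvent_pvm"
  unfolding projection_valued_measure_def
proof (intro conjI ballI allI impI)
  have calc2: "P.fun_calc (indicator A) (P.fun_calc (indicator A') u) = P.fun_calc (indicator (A \<inter> A')) u"
    if "A \<in> sets borel" "A' \<in> sets borel" for A A' u
  proof -
    have "P.fun_calc (indicator A) (P.fun_calc (indicator A') u) = P.fun_calc (\<lambda>x. indicator A x * indicator A' x) u"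
      by (rule P.fun_calc_fun_calc[OF P.square_int_indicator[OF that(2)], where B = 1]) (use that in \<open>auto simp: indicator_def\<close>)
    then show ?thesis by (simp add: indicator_inter_arith[abs_def])
  qed
  show "orthogonal_projection (resolvent_pvm B)" if B: "B \<in> sets borel" for B
  proof (rule orthogonal_projectionI)
    note s = P.square_int_indicator[OF vimage_borel[OF B]]
    show "resolvent_pvm B (u + v) = resolvent_pvm B u + resolvent_pvm B v" for u v unfolding resolvent_pvm_def by (rule P.fun_calc_add[OF s s s])
    show "resolvent_pvm B (r *\<^sub>R u) = r *\<^sub>R resolvent_pvm B u" for r u
      unfolding resolvent_pvm_def by (rule P.fun_calc_commute[OF bounded_linear_scaleR_right P.R_scale s s])
    show "resolvent_pvm B (\<J> u) = \<J> (resolvent_pvm B u)" for u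
      unfolding resolvent_pvm_def by (rule P.fun_calc_commute[OF bounded_linear_J resolvent_J s s])
    show "resolvent_pvm B (resolvent_pvm B u) = resolvent_pvm B u" for u
      unfolding resolvent_pvm_def calc2[OF vimage_borel[OF B] vimage_borel[OF B]] by simp
    show "inner u (resolvent_pvm B v) = inner (resolvent_pvm B u) v" for u v
      unfolding resolvent_pvm_def by (rule P.fun_calc_sym[OF s s, symmetric])
  qed
  have e0: "(indicator {} :: real \<Rightarrow> real) = (\<lambda>x. 0)" by (auto simp: fun_eq_iff)
  show "resolvent_pvm {} = (\<lambda>u. 0)" by (rule ext) (simp add: resolvent_pvm_def e0 P.fun_calc_0)
  have e1: "(indicator UNIV :: real \<Rightarrow> real) = (\<lambda>x. 1)" by (auto simp: fun_eq_iff)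
  show "resolvent_pvm UNIV = (\<lambda>u. u)" by (rule ext) (simp add: resolvent_pvm_def e1 P.fun_calc_1)
  show "resolvent_pvm (B \<inter> C) = resolvent_pvm B \<circ> resolvent_pvm C" if "B \<in> sets borel" "C \<in> sets borel" for B C
    using calc2[OF vimage_borel[OF that(1)] vimage_borel[OF that(2)]] by (simp add: resolvent_pvm_def fun_eq_iff)
  show "(\<lambda>n. resolvent_pvm (B n) u) sums resolvent_pvm (\<Union>n. B n) u"
    if "range B \<subseteq> sets borel" "disjoint_family B" for B :: "nat \<Rightarrow> real set" and u
  proof -
    have "(\<lambda>n. P.fun_calc (indicator (\<rho> -` B n)) u) sums P.fun_calc (indicator (\<Union>n. \<rho> -` B n)) u"
    proof (rule P.fun_calc_indicator_sums)
      show "\<rho> -` B n \<in> sets borel" for n using that(1) by (intro vimage_borel) auto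
      show "disjoint_family (\<lambda>n. \<rho> -` B n)"
        unfolding disjoint_family_on_def
      proof (intro ballI impI)
        fix m n :: nat assume "m \<noteq> n"
        then have "B m \<inter> B n = {}" using that(2) by (intro disjoint_family_onD[of B UNIV]) auto
        then show "\<rho> -` B m \<inter> \<rho> -` B n = {}" by blast
      qed
    qed
    then show ?thesis by (simp add: resolvent_pvm_def vimage_UN)
  qed
qed

lemma scalar_measure_resolvent_pvm: "scalar_measure resolvent_pvm u = distr (P.\<mu> u) borel \<rho>"
proof (rule measure_eqI)
  fix B assume "B \<in> sets (scalar_measure resolvent_pvm u)"
  then have B: "B \<in> sets borel" by simp
  interpret finite_measure "P.\<mu> u" by (rule P.\<mu>_finite)
  have m: "\<rho> \<in> measurable (P.\<mu> u) borel" by measurable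
  have "emeasure (scalar_measure resolvent_pvm u) B = ennreal (measure (P.\<mu> u) (\<rho> -` B))"
    unfolding emeasure_scalar_measure[OF projection_valued_measure_resolvent_pvm B] resolvent_pvm_def
      P.inner_fun_calc_indicator[OF vimage_borel[OF B]] ..
  also have "\<dots> = emeasure (distr (P.\<mu> u) borel \<rho>) B"
    by (simp add: emeasure_distr[OF m B] emeasure_eq_measure)
  finally show "emeasure (scalar_measure resolvent_pvm u) B = emeasure (distr (P.\<mu> u) borel \<rho>) B" .
qed simp

text \<open>The resolvent is injective, and it maps the spectral projection of \<open>u\<close> at 0 to 0.\<close>

lemma AE_nonzero: "AE r in P.\<mu> u. r \<noteq> 0"
proof -
  interpret finite_measure "P.\<mu> u" by (rule P.\<mu>_finite)
  have s: "square_int (P.\<mu> u) (indicator {0})" by (rule P.square_int_indicator) simp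
  have "resolvent (P.fun_calc (indicator {0}) u) = P.fun_calc (\<lambda>x. x * indicator {0} x) u" by (rule P.R_fun_calc[OF s])
  also have "(\<lambda>x::real. x * indicator {0} x) = (\<lambda>x. 0)" by (auto simp: indicator_def)
  finally have "resolvent (P.fun_calc (indicator {0}) u) = 0" by (simp only: P.fun_calc_0)
  then have "P.fun_calc (indicator {0}) u = 0" by (rule resolvent_inj)
  then have "measure (P.\<mu> u) {0} = 0" using P.inner_fun_calc_indicator[of "{0}" u] by simp
  then have "emeasure (P.\<mu> u) {0} = 0" by (simp add: emeasure_eq_measure)
  then show ?thesis by (intro AE_I[of _ _ "{0}"]) auto
qed

lemma \<mu>_resolvent: "P.\<mu> (resolvent w) = density (P.\<mu> w) (\<lambda>r. ennreal (r\<^sup>2))"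
proof (rule measure_eqI)
  fix B assume "B \<in> sets (P.\<mu> (resolvent w))"
  then have B [measurable]: "B \<in> sets borel" by simp
  interpret R: finite_measure "P.\<mu> (resolvent w)" by (rule P.\<mu>_finite)
  have idf: "square_int (P.\<mu> w) (\<lambda>x. x)" by (rule square_int_bounded[OF P.\<mu>_unit, where B = 1]) auto
  have Bid: "square_int (P.\<mu> w) (\<lambda>x. indicator B x * x)"
    by (rule P.square_int_bounded_mult[OF idf, where B = 1]) (auto simp: indicator_def)
  have "emeasure (P.\<mu> (resolvent w)) B = ennreal (inner (resolvent w) (P.fun_calc (indicator B) (resolvent w)))"
    unfolding P.inner_fun_calc_indicator[OF B] by (rule R.emeasure_eq_measure)
  also have "P.fun_calc (indicator B) (resolvent w) = P.fun_calc (\<lambda>x. indicator B x * x) w"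
    unfolding P.fun_calc_id[of w, symmetric] by (rule P.fun_calc_fun_calc[OF idf, where B = 1]) (auto simp: indicator_def)
  also have "inner (resolvent w) (P.fun_calc (\<lambda>x. indicator B x * x) w) = (LINT x|P.\<mu> w. x * (indicator B x * x))"
    unfolding P.fun_calc_id[of w, symmetric] by (rule P.inner_fun_calc[OF idf Bid])
  also have "ennreal (LINT x|P.\<mu> w. x * (indicator B x * x)) = (\<integral>\<^sup>+x. ennreal (x * (indicator B x * x)) \<partial>P.\<mu> w)"
    by (rule nn_integral_eq_integral[symmetric, OF square_int_mult_integrable[OF P.\<mu>_sets idf Bid]])
       (auto simp: indicator_def)
  also have "\<dots> = (\<integral>\<^sup>+x. ennreal (x\<^sup>2) * indicator B x \<partial>P.\<mu> w)"
    by (intro nn_integral_cong) (auto simp: indicator_def power2_eq_square)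
  also have "\<dots> = emeasure (density (P.\<mu> w) (\<lambda>r. ennreal (r\<^sup>2))) B"
    by (rule emeasure_density[symmetric]) auto
  finally show "emeasure (P.\<mu> (resolvent w)) B = emeasure (density (P.\<mu> w) (\<lambda>r. ennreal (r\<^sup>2))) B" .
qed simp

lemma square_times_resolvent_map: "r\<^sup>2 * (\<rho> r)\<^sup>2 = (if r = 0 then 0 else (r - 1)\<^sup>2)" "r\<^sup>2 * \<rho> r = r * r - r"
  by (auto simp: power2_eq_square field_simps)

lemma H_complex_form_real:
  assumes u: "u \<in> sobolev 2" shows "cinner u (H u) = complex_of_real (inner u (H u))"
proof -
  have "inner u (\<J> (H u)) = inner (H u) (\<J> u)"
    using H_sym[OF u, of "\<J> u"] H_J[OF u] by simp
  also have "\<dots> = - inner u (\<J> (H u))"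
    using inner_J_left[of u "H u"] by (simp add: inner_commute)
  finally have "inner u (\<J> (H u)) = 0" by simp
  then show ?thesis unfolding cinner_eq by simp
qed

lemma resolvent_pvm_integrable_iff: "u \<in> spectral_integral_domain resolvent_pvm (\<lambda>s. s) \<longleftrightarrow> integrable (P.\<mu> u) (\<lambda>r. (\<rho> r)\<^sup>2)"
  unfolding spectral_integral_domain_def scalar_measure_resolvent_pvm
  by (simp add: integrable_distr_eq)

lemma sobolev_2_range: "u \<in> sobolev 2 \<longleftrightarrow> (\<exists>w. u = resolvent w)"
  using resolvent_solves(1) resolvent_eq by metis

text \<open>If \<open>u = R w\<close>, the measure of \<open>u\<close> is \<open>r\<^sup>2\<close> times that of \<open>w\<close>, and \<open>r\<^sup>2 (1 - 1 / r)\<^sup>2 = (r - 1)\<^sup>2\<close> is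
bounded. Conversely, if \<open>1 - 1 / r\<close> is square integrable for \<open>u\<close>, so is \<open>1 / r\<close>, and \<open>u\<close> is the
image under \<open>R\<close> of the vector \<open>R\<^sup>-\<^sup>1 u\<close> given by the functional calculus.\<close>

lemma resolvent_pvm_domain: "sobolev 2 = spectral_integral_domain resolvent_pvm (\<lambda>s. s)"
proof (intro set_eqI iffI)
  fix u :: "'n L2" assume "u \<in> sobolev 2"
  then obtain w where w: "u = resolvent w" by (auto simp: sobolev_2_range)
  interpret finite_measure "P.\<mu> w" by (rule P.\<mu>_finite)
  have "integrable (P.\<mu> w) (\<lambda>r. r\<^sup>2 * (\<rho> r)\<^sup>2)"
    unfolding square_times_resolvent_map
  proof (rule integrable_const_bound[where B = 1])
    show "AE r in P.\<mu> w. norm (if r = 0 then 0 else (r - 1)\<^sup>2) \<le> (1::real)"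
      using P.\<mu>_AE by eventually_elim (auto intro!: power2_le_imp_le simp: abs_square_le_1)
  qed measurable
  then have "integrable (density (P.\<mu> w) (\<lambda>r. ennreal (r\<^sup>2))) (\<lambda>r. (\<rho> r)\<^sup>2)"
    by (subst integrable_density) auto
  then show "u \<in> spectral_integral_domain resolvent_pvm (\<lambda>s. s)"
    unfolding resolvent_pvm_integrable_iff w \<mu>_resolvent .
next
  fix u :: "'n L2" assume "u \<in> spectral_integral_domain resolvent_pvm (\<lambda>s. s)"
  then have i: "square_int (P.\<mu> u) \<rho>" by (simp add: resolvent_pvm_integrable_iff square_int_def)
  have one: "square_int (P.\<mu> u) (\<lambda>x. 1)" by (rule square_int_bounded[OF P.\<mu>_unit, where B = 1]) auto
  have inv: "square_int (P.\<mu> u) inverse" using square_int_diff[OF P.\<mu>_sets one i] by simp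
  have x_inv: "square_int (P.\<mu> u) (\<lambda>x. x * inverse x)"
  proof (rule square_int_bounded[OF P.\<mu>_unit, where B = 1])
    show "\<bar>x * inverse x\<bar> \<le> 1" for x :: real by (cases "x = 0") auto
  qed measurable
  have "resolvent (P.fun_calc inverse u) = P.fun_calc (\<lambda>x. x * inverse x) u" by (rule P.R_fun_calc[OF inv])
  also have "\<dots> = P.fun_calc (\<lambda>x. 1) u"
  proof (rule P.fun_calc_cong_AE[OF x_inv one])
    show "AE x in P.\<mu> u. x * inverse x = 1" using AE_nonzero by eventually_elim simp
  qed
  finally show "u \<in> sobolev 2" unfolding sobolev_2_range P.fun_calc_1 by metis
qed

lemma has_spectral_integral_resolvent_pvm: "has_spectral_integral resolvent_pvm (\<lambda>s. s) (sobolev 2) H"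
  unfolding has_spectral_integral_def
proof (intro conjI ballI resolvent_pvm_domain linear_operator_H)
  fix u :: "'n L2" assume u: "u \<in> sobolev 2"
  then obtain w where w: "u = resolvent w" by (auto simp: sobolev_2_range)
  have idf: "square_int (P.\<mu> w) (\<lambda>x. x)" by (rule square_int_bounded[OF P.\<mu>_unit, where B = 1]) auto
  have one: "square_int (P.\<mu> w) (\<lambda>x. 1)" by (rule square_int_bounded[OF P.\<mu>_unit, where B = 1]) auto
  have "(LINT s|scalar_measure resolvent_pvm u. s) = (LINT r|P.\<mu> u. \<rho> r)"
    unfolding scalar_measure_resolvent_pvm by (rule integral_distr) auto
  also have "\<dots> = (LINT r|P.\<mu> w. r\<^sup>2 * \<rho> r)"
    unfolding w \<mu>_resolvent by (subst integral_density) auto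
  also have "\<dots> = (LINT r|P.\<mu> w. r * r - r * 1)" unfolding square_times_resolvent_map by simp
  also have "\<dots> = (LINT r|P.\<mu> w. r * r) - (LINT r|P.\<mu> w. r * 1)"
    using square_int_mult_integrable[OF P.\<mu>_sets idf idf] square_int_mult_integrable[OF P.\<mu>_sets idf one]
    by (rule Bochner_Integration.integral_diff)
  also have "\<dots> = inner (resolvent w) (resolvent w) - inner (resolvent w) w"
    unfolding P.inner_fun_calc[OF idf idf, symmetric] P.inner_fun_calc[OF idf one, symmetric] P.fun_calc_id P.fun_calc_1 ..
  also have "\<dots> = inner u (H u)"
  proof -
    have "H u = u - w" using resolvent_solves(2)[of w] w by (simp add: algebra_simps)
    then show ?thesis by (simp add: w inner_diff_right)
  qed
  finally show "cinner u (H u) = complex_of_real (LINT s|scalar_measure resolvent_pvm u. s)"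
    unfolding H_complex_form_real[OF u] by simp
qed

lemma spectral_measure_H:
  "projection_valued_measure (spectral_measure (sobolev 2) H)"
  "has_spectral_integral (spectral_measure (sobolev 2) H) (\<lambda>s. s) (sobolev 2) H"
proof -
  have "\<exists>E. projection_valued_measure E \<and> has_spectral_integral E (\<lambda>s. s) (sobolev 2) H"
    using projection_valued_measure_resolvent_pvm has_spectral_integral_resolvent_pvm by blast
  from someI_ex[OF this] show "projection_valued_measure (spectral_measure (sobolev 2) H)"
    "has_spectral_integral (spectral_measure (sobolev 2) H) (\<lambda>s. s) (sobolev 2) H"
    unfolding spectral_measure_def by auto
qed

end

section \<open>Bounded functions of a projection-valued measure\<close>

definition bin_digit :: "nat \<Rightarrow> real \<Rightarrow> bool" where
  "bin_digit k x \<longleftrightarrow> odd \<lfloor>2 ^ Suc k * x\<rfloor>"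

lemma binary_expansion_partial:
  assumes "0 \<le> x" "x < 1"
  shows "(\<Sum>k<n. (1/2) ^ Suc k * of_bool (bin_digit k x)) = real_of_int \<lfloor>2 ^ n * x\<rfloor> / 2 ^ n"
proof (induction n)
  case 0
  have "\<lfloor>x\<rfloor> = 0" using assms by (simp add: floor_eq_iff)
  then show ?case by simp
next
  case (Suc n)
  let ?m = "\<lfloor>2 ^ Suc n * x\<rfloor>"
  have "\<lfloor>2 ^ n * x\<rfloor> = \<lfloor>(2 ^ Suc n * x) / real_of_int 2\<rfloor>" by simp
  also have "\<dots> = ?m div 2" by (rule floor_divide_real_eq_div) simp
  finally have half: "\<lfloor>2 ^ n * x\<rfloor> = ?m div 2" .
  have "real_of_int m = 2 * real_of_int (m div 2) + of_bool (odd m)" for m :: int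
    by (cases "even m") (auto elim!: evenE oddE)
  from this[of ?m] have m: "real_of_int ?m = 2 * real_of_int \<lfloor>2 ^ n * x\<rfloor> + of_bool (odd ?m)"
    unfolding half .
  have "(2 * A + b) / 2 ^ Suc n = A / 2 ^ n + (1/2) ^ Suc n * b" for A b :: real
    by (simp add: add_divide_distrib power_one_over)
  from this[of "real_of_int \<lfloor>2 ^ n * x\<rfloor>" "of_bool (odd ?m)"]
  have "real_of_int ?m / 2 ^ Suc n = real_of_int \<lfloor>2 ^ n * x\<rfloor> / 2 ^ n + (1/2) ^ Suc n * of_bool (odd ?m)"
    unfolding m[symmetric] .
  then show ?case unfolding sum.lessThan_Suc Suc unfolding bin_digit_def by (rule sym)
qed

lemma binary_expansion_limit:
  assumes "0 \<le> x" "x < 1"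
  shows "(\<lambda>n. \<Sum>k<n. (1/2) ^ Suc k * of_bool (bin_digit k x)) \<longlonglongrightarrow> x"
    and "0 \<le> (\<Sum>k<n. (1/2::real) ^ Suc k * of_bool (bin_digit k x))"
    and "(\<Sum>k<n. (1/2) ^ Suc k * of_bool (bin_digit k x)) \<le> x"
proof -
  have b: "x - (1/2) ^ n \<le> real_of_int \<lfloor>2 ^ n * x\<rfloor> / 2 ^ n" "real_of_int \<lfloor>2 ^ n * x\<rfloor> / 2 ^ n \<le> x" for n
  proof -
    have "real_of_int \<lfloor>2 ^ n * x\<rfloor> \<le> 2 ^ n * x" by (rule of_int_floor_le)
    then show "real_of_int \<lfloor>2 ^ n * x\<rfloor> / 2 ^ n \<le> x" by (simp add: divide_le_eq mult.commute)
    have "2 ^ n * x - 1 \<le> real_of_int \<lfloor>2 ^ n * x\<rfloor>" by linarith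
    then have "(2 ^ n * x - 1) / 2 ^ n \<le> real_of_int \<lfloor>2 ^ n * x\<rfloor> / 2 ^ n" by (rule divide_right_mono) simp
    moreover have "(2 ^ n * x - 1) / 2 ^ n = x - (1/2) ^ n" by (simp add: diff_divide_distrib power_one_over)
    ultimately show "x - (1/2) ^ n \<le> real_of_int \<lfloor>2 ^ n * x\<rfloor> / 2 ^ n" by simp
  qed
  have l: "(\<lambda>n. x - (1/2) ^ n) \<longlonglongrightarrow> x - 0" by (intro tendsto_intros LIMSEQ_power_zero) simp
  show "(\<lambda>n. \<Sum>k<n. (1/2) ^ Suc k * of_bool (bin_digit k x)) \<longlonglongrightarrow> x"
    unfolding binary_expansion_partial[OF assms]
  proof (rule tendsto_sandwich[OF _ _ _ tendsto_const])
    show "(\<lambda>n. x - (1/2) ^ n) \<longlonglongrightarrow> x" using l by simp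
  qed (use b in \<open>auto intro!: always_eventually\<close>)
  show "(\<Sum>k<n. (1/2) ^ Suc k * of_bool (bin_digit k x)) \<le> x"
    unfolding binary_expansion_partial[OF assms] by (rule b)
  show "0 \<le> (\<Sum>k<n. (1/2::real) ^ Suc k * of_bool (bin_digit k x))" by (intro sum_nonneg) simp
qed

locale pvm =
  fixes E :: "real set \<Rightarrow> 'n::finite L2 \<Rightarrow> 'n L2"
  assumes pvm: "projection_valued_measure E"
begin

lemma E_projection: "B \<in> sets borel \<Longrightarrow> orthogonal_projection (E B)"
  using pvm by (auto simp: projection_valued_measure_def)

lemma E_linear:
  assumes "B \<in> sets borel"
  shows "E B (u + v) = E B u + E B v" "E B (scaleC c u) = scaleC c (E B u)" "E B (E B u) = E B u"
    "inner u (E B v) = inner (E B u) v"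
  using E_projection[OF assms] by (auto simp: orthogonal_projection_def linear_operator_on_def inner_L2_def)

lemma E_inter: "B \<in> sets borel \<Longrightarrow> C \<in> sets borel \<Longrightarrow> E B (E C u) = E (B \<inter> C) u"
  using pvm unfolding projection_valued_measure_def by (metis comp_apply)

lemma E_UNIV: "E UNIV u = u"
  using pvm by (simp add: projection_valued_measure_def)

lemma E_empty: "E {} u = 0"
  using pvm by (simp add: projection_valued_measure_def)

lemma inner_E_E:
  assumes "B \<in> sets borel" "C \<in> sets borel"
  shows "inner (E B u) (E C u) = inner u (E (B \<inter> C) u)"
  using E_linear(4)[OF assms(1), of u "E C u"] E_inter[OF assms, of u] by simp

lemma inner_E_self: "B \<in> sets borel \<Longrightarrow> inner u (E B u) = (norm (E B u))\<^sup>2"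
  using inner_E_E[of B B u] by (simp add: power2_norm_eq_inner)

lemma norm_E_le:
  assumes "B \<in> sets borel" shows "norm (E B u) \<le> norm u"
proof (cases "E B u = 0")
  case False
  have "norm (E B u) * norm (E B u) \<le> norm u * norm (E B u)"
    using norm_cauchy_schwarz[of u "E B u"] inner_E_self[OF assms, of u] by (simp add: power2_eq_square)
  then show ?thesis by (rule mult_right_le_imp_le) (use False in simp)
qed simp

abbreviation "\<nu> \<equiv> scalar_measure E"

lemma space_\<nu>: "space (\<nu> u) = UNIV"
  using sets_eq_imp_space_eq[OF sets_scalar_measure] by simp

lemma emeasure_\<nu>: "B \<in> sets borel \<Longrightarrow> emeasure (\<nu> u) B = ennreal (inner u (E B u))"
  by (rule emeasure_scalar_measure[OF pvm])

lemma finite_measure_\<nu>: "finite_measure (\<nu> u)"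
  by (rule finite_measureI) (simp add: space_\<nu> emeasure_\<nu>)

lemma measure_\<nu>: "B \<in> sets borel \<Longrightarrow> measure (\<nu> u) B = inner u (E B u)"
  unfolding measure_def emeasure_\<nu> by (simp add: inner_E_self)

lemma measure_\<nu>_UNIV: "measure (\<nu> u) UNIV = (norm u)\<^sup>2"
  by (simp add: measure_\<nu> E_UNIV power2_norm_eq_inner)

text \<open>A function \<open>h\<close> with values in \<open>[0, 1)\<close> is the sum of \<open>2\<^sup>-\<^sup>k\<^sup>-\<^sup>1\<close> times the indicator of its \<open>k\<close>-th digit
set. Hence \<open>\<integral> h dE\<close> is a norm convergent series of multiples of projections.\<close>

definition digit_set :: "(real \<Rightarrow> real) \<Rightarrow> nat \<Rightarrow> real set" where
  "digit_set h k = {s. bin_digit k (h s)}"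

definition dyadic_op :: "(real \<Rightarrow> real) \<Rightarrow> 'n L2 \<Rightarrow> 'n L2" where
  "dyadic_op h u = (\<Sum>k. (1/2) ^ Suc k *\<^sub>R E (digit_set h k) u)"

context
  fixes h :: "real \<Rightarrow> real"
  assumes h_measurable [measurable]: "h \<in> borel_measurable borel" and h_bounds: "\<And>s. 0 \<le> h s" "\<And>s. h s < 1"
begin

lemma digit_set_borel [measurable]: "digit_set h k \<in> sets borel"
  unfolding digit_set_def bin_digit_def by measurable

lemma dyadic_sums: "(\<lambda>k. (1/2) ^ Suc k *\<^sub>R E (digit_set h k) u) sums dyadic_op h u"
  unfolding dyadic_op_def
proof (rule summable_sums, rule summable_comparison_test'[where N = 0])
  have "summable (\<lambda>k. (1/2::real) ^ Suc k)" by (simp add: summable_Suc_iff summable_geometric)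
  then show "summable (\<lambda>k. (1/2) ^ Suc k * norm u)" by (rule summable_mult2)
  show "norm ((1/2) ^ Suc k *\<^sub>R E (digit_set h k) u) \<le> (1/2) ^ Suc k * norm u" for k
    unfolding norm_scaleR using norm_E_le[OF digit_set_borel, of k u] by (simp add: mult_left_mono)
qed

lemma dyadic_add: "dyadic_op h (u + v) = dyadic_op h u + dyadic_op h v"
proof -
  have "(\<lambda>k. (1/2) ^ Suc k *\<^sub>R E (digit_set h k) (u + v)) sums (dyadic_op h u + dyadic_op h v)"
    unfolding E_linear(1)[OF digit_set_borel] scaleR_right_distrib by (rule sums_add[OF dyadic_sums dyadic_sums])
  from sums_unique2[OF dyadic_sums this] show ?thesis .
qed

lemma dyadic_scaleC: "dyadic_op h (scaleC c u) = scaleC c (dyadic_op h u)"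
proof -
  have bl: "bounded_linear (scaleC c :: 'n L2 \<Rightarrow> _)"
    unfolding scaleC_decomp[of c, abs_def]
    by (intro bounded_linear_add bounded_linear_scaleR_right bounded_linear_compose[OF bounded_linear_scaleR_right bounded_linear_J])
  have "scaleC c ((1/2) ^ Suc k *\<^sub>R E (digit_set h k) u) = (1/2) ^ Suc k *\<^sub>R E (digit_set h k) (scaleC c u)" for k
    unfolding E_linear(2)[OF digit_set_borel] scaleR_L2_def scaleC_scaleC by (simp only: mult.commute)
  then have "(\<lambda>k. (1/2) ^ Suc k *\<^sub>R E (digit_set h k) (scaleC c u)) sums scaleC c (dyadic_op h u)"
    using bounded_linear.sums[OF bl dyadic_sums[of u]] by (simp only:)
  from sums_unique2[OF dyadic_sums this] show ?thesis .
qed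

lemma dyadic_integral_limit:
  assumes w [measurable]: "w \<in> borel_measurable borel" and wb: "\<And>s. \<bar>w s\<bar> \<le> 1"
  shows "(\<lambda>n. \<Sum>k<n. (1/2) ^ Suc k * (LINT s|\<nu> u. indicator (digit_set h k) s * w s)) \<longlonglongrightarrow> (LINT s|\<nu> u. h s * w s)"
proof -
  interpret finite_measure "\<nu> u" by (rule finite_measure_\<nu>)
  let ?p = "\<lambda>n s. \<Sum>k<n. (1/2) ^ Suc k * of_bool (bin_digit k (h s)) :: real"
  have eq: "(indicator (digit_set h k) s :: real) = of_bool (bin_digit k (h s))" for k s
    by (simp add: digit_set_def indicator_def)
  have i: "integrable (\<nu> u) (\<lambda>s. indicator (digit_set h k) s * w s)" for k
    by (rule integrable_const_bound[where B = 1]) (use wb in \<open>auto simp: indicator_def\<close>)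
  have "(\<Sum>k<n. (1/2) ^ Suc k * (LINT s|\<nu> u. indicator (digit_set h k) s * w s)) = (LINT s|\<nu> u. ?p n s * w s)" for n
  proof -
    have "(\<Sum>k<n. (1/2) ^ Suc k * (LINT s|\<nu> u. indicator (digit_set h k) s * w s))
       = (\<Sum>k<n. (LINT s|\<nu> u. (1/2) ^ Suc k * (indicator (digit_set h k) s * w s)))"
      by (intro sum.cong refl integral_mult_right_zero[symmetric])
    also have "\<dots> = (LINT s|\<nu> u. (\<Sum>k<n. (1/2) ^ Suc k * (indicator (digit_set h k) s * w s)))"
      by (rule Bochner_Integration.integral_sum[symmetric]) (intro integrable_mult_right i)
    also have "\<dots> = (LINT s|\<nu> u. ?p n s * w s)"
      unfolding eq sum_distrib_right by (simp only: mult.assoc)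
    finally show ?thesis .
  qed
  moreover have "(\<lambda>n. LINT s|\<nu> u. ?p n s * w s) \<longlonglongrightarrow> (LINT s|\<nu> u. h s * w s)"
  proof (rule integral_dominated_convergence[where w = "\<lambda>s. 1"])
    show "(\<lambda>s. ?p n s * w s) \<in> borel_measurable (\<nu> u)" for n unfolding eq[symmetric] by measurable
    show "AE s in \<nu> u. (\<lambda>n. ?p n s * w s) \<longlonglongrightarrow> h s * w s"
      by (intro AE_I2 tendsto_mult tendsto_const binary_expansion_limit(1) h_bounds)
    have "norm (?p n s * w s) \<le> 1" for n s
    proof -
      have "0 \<le> ?p n s" "?p n s \<le> 1"
        using binary_expansion_limit(2,3)[OF h_bounds(1)[of s] h_bounds(2)[of s], of n] h_bounds(2)[of s] by linarith+
      then show ?thesis unfolding norm_mult using wb[of s] by (simp add: mult_le_one)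
    qed
    then show "AE s in \<nu> u. norm (?p n s * w s) \<le> 1" for n by simp
  qed measurable
  ultimately show ?thesis by simp
qed

lemma inner_E_dyadic:
  assumes C: "C \<in> sets borel"
  shows "inner (E C u) (dyadic_op h u) = (LINT s|\<nu> u. h s * indicator C s)"
proof -
  have "(\<lambda>k. inner (E C u) ((1/2) ^ Suc k *\<^sub>R E (digit_set h k) u)) sums inner (E C u) (dyadic_op h u)"
    by (rule bounded_linear.sums[OF bounded_linear_inner_right dyadic_sums])
  moreover have "inner (E C u) ((1/2) ^ Suc k *\<^sub>R E (digit_set h k) u)
      = (1/2) ^ Suc k * (LINT s|\<nu> u. indicator (digit_set h k) s * indicator C s)" for k
  proof -
    have "(LINT s|\<nu> u. indicator (digit_set h k) s * indicator C s) = (LINT s|\<nu> u. (indicator (digit_set h k \<inter> C) s :: real))"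
      by (intro Bochner_Integration.integral_cong refl) (simp add: indicator_inter_arith)
    also have "\<dots> = inner u (E (C \<inter> digit_set h k) u)"
      using C by (simp add: measure_\<nu> Int_commute)
    finally show ?thesis by (simp add: inner_E_E[OF C digit_set_borel])
  qed
  ultimately have "(\<lambda>n. \<Sum>k<n. (1/2) ^ Suc k * (LINT s|\<nu> u. indicator (digit_set h k) s * indicator C s)) \<longlonglongrightarrow> inner (E C u) (dyadic_op h u)"
    unfolding sums_def by (simp only:)
  moreover have "(\<lambda>n. \<Sum>k<n. (1/2) ^ Suc k * (LINT s|\<nu> u. indicator (digit_set h k) s * indicator C s)) \<longlonglongrightarrow> (LINT s|\<nu> u. h s * indicator C s)"
    by (rule dyadic_integral_limit) (use C in \<open>auto simp: indicator_def\<close>)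
  ultimately show ?thesis by (rule LIMSEQ_unique)
qed

lemma inner_dyadic: "inner u (dyadic_op h u) = (LINT s|\<nu> u. h s)"
  using inner_E_dyadic[of UNIV u] by (simp add: E_UNIV)

text \<open>Expanding one of the two factors of \<open>\<langle>h(E) u, h(E) u\<rangle>\<close> in digits reduces the claim to
\<open>inner_E_dyadic\<close> and the digit series of \<open>h \<cdot> h\<close>.\<close>

lemma norm_dyadic: "(norm (dyadic_op h u))\<^sup>2 = (LINT s|\<nu> u. (h s)\<^sup>2)"
proof -
  have "(\<lambda>k. inner ((1/2) ^ Suc k *\<^sub>R E (digit_set h k) u) (dyadic_op h u)) sums inner (dyadic_op h u) (dyadic_op h u)"
    by (rule bounded_linear.sums[OF bounded_linear_inner_left dyadic_sums])
  moreover have "inner ((1/2) ^ Suc k *\<^sub>R E (digit_set h k) u) (dyadic_op h u)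
      = (1/2) ^ Suc k * (LINT s|\<nu> u. indicator (digit_set h k) s * h s)" for k
    unfolding inner_scaleR_left inner_E_dyadic[OF digit_set_borel] by (simp only: mult.commute)
  ultimately have "(\<lambda>n. \<Sum>k<n. (1/2) ^ Suc k * (LINT s|\<nu> u. indicator (digit_set h k) s * h s)) \<longlonglongrightarrow> inner (dyadic_op h u) (dyadic_op h u)"
    unfolding sums_def by (simp only:)
  moreover have "(\<lambda>n. \<Sum>k<n. (1/2) ^ Suc k * (LINT s|\<nu> u. indicator (digit_set h k) s * h s)) \<longlonglongrightarrow> (LINT s|\<nu> u. h s * h s)"
    by (rule dyadic_integral_limit) (use h_bounds in \<open>auto simp: abs_le_iff intro: less_imp_le order_trans[of _ 0]\<close>)
  ultimately have "inner (dyadic_op h u) (dyadic_op h u) = (LINT s|\<nu> u. h s * h s)" by (rule LIMSEQ_unique)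
  then show ?thesis unfolding power2_norm_eq_inner by (simp only: power2_eq_square)
qed

end

lemma inner_dyadic_J:
  assumes h: "h \<in> borel_measurable borel" "\<And>s. 0 \<le> h s" "\<And>s. h s < 1"
  shows "inner u (\<J> (dyadic_op h u)) = 0"
proof -

  have "(\<lambda>k. inner u (\<J> ((1/2) ^ Suc k *\<^sub>R E (digit_set h k) u))) sums inner u (\<J> (dyadic_op h u))"
    by (rule bounded_linear.sums[OF bounded_linear_inner_right bounded_linear.sums[OF bounded_linear_J dyadic_sums[OF h(1) h(2) h(3)]]])
  moreover have "inner u (\<J> ((1/2) ^ Suc k *\<^sub>R E (digit_set h k) u)) = 0" for k
  proof -
    have B: "digit_set h k \<in> sets borel" by (rule digit_set_borel[OF h])
    have "inner u (\<J> (E (digit_set h k) u)) = inner u (\<J> (E (digit_set h k) (E (digit_set h k) u)))"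
      by (simp only: E_linear(3)[OF B])
    also have "\<dots> = inner (E (digit_set h k) u) (\<J> (E (digit_set h k) u))"
      by (simp only: E_linear(2)[OF B, symmetric] E_linear(4)[OF B])
    also have "\<dots> = 0" by (rule inner_J_self)
    finally show ?thesis by (simp add: J_scaleR)
  qed
  ultimately show ?thesis using sums_unique2[OF sums_zero] by simp
qed

end

text \<open>Complex polarization: the form of the difference vanishes at \<open>u + v\<close> and at \<open>u + \<i> v\<close>.\<close>

lemma linear_operator_eq_if_form_eq:
  assumes A: "linear_operator_on UNIV A" and B: "linear_operator_on UNIV B"
    and eq: "\<And>u. cinner u (A u) = cinner u (B u)"
  shows "A = B"
proof
  fix v
  define D where "D u = A u - B u" for u
  have lin: "D (u + w) = D u + D w" "D (\<J> u) = \<J> (D u)" for u w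
    using A B by (auto simp: D_def linear_operator_on_def linear_diff[OF bounded_linear.linear[OF bounded_linear_J]])
  have r: "inner u (A u) = inner u (B u)" "inner u (\<J> (A u)) = inner u (\<J> (B u))" for u
  proof -
    show "inner u (A u) = inner u (B u)" using eq[of u] by (simp add: inner_L2_def)
    have "\<i> * cinner u (A u) = \<i> * cinner u (B u)" by (simp only: eq)
    then show "inner u (\<J> (A u)) = inner u (\<J> (B u))" unfolding inner_L2_def cinner_scaleC_right by (simp only:)
  qed
  have d: "inner u (D u) = 0" "inner u (\<J> (D u)) = 0" for u
    using r[of u] by (simp_all add: D_def inner_diff_right linear_diff[OF bounded_linear.linear[OF bounded_linear_J]])
  have "inner u (\<J> (D v)) = 0" for u
  proof -
    have 1: "inner u (D (\<J> v)) + inner (\<J> v) (D u) = 0"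
      using d(1)[of "u + \<J> v"] d(1)[of u] d(1)[of "\<J> v"] by (simp add: lin(1) inner_add)
    have 2: "inner u (\<J> (D v)) + inner v (\<J> (D u)) = 0"
      using d(2)[of "u + v"] d(2)[of u] d(2)[of v] by (simp add: lin(1) scaleC_add_right inner_add)
    have "inner (\<J> v) (D u) = - inner v (\<J> (D u))" by (rule inner_J_left)
    then show ?thesis using 1 2 by (simp add: lin(2))
  qed
  then have "\<J> (D v) = 0" by (metis inner_eq_zero_iff)
  then have "norm (D v) = 0" using norm_J[of "D v"] by simp
  then show "A v = B v" by (simp add: D_def)
qed

section \<open>The semigroup generated by a Schroedinger operator\<close>

context schroedinger_potential
begin

abbreviation "\<E> \<equiv> spectral_measure (sobolev 2) H"

interpretation E: pvm \<E>
  by unfold_locales (rule spectral_measure_H)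

lemma domain_iff: "u \<in> sobolev 2 \<longleftrightarrow> integrable (E.\<nu> u) (\<lambda>s. s\<^sup>2)"
  using spectral_measure_H(2) by (auto simp: has_spectral_integral_def spectral_integral_domain_def)

lemma H_form_integral: "u \<in> sobolev 2 \<Longrightarrow> inner u (H u) = (LINT s|E.\<nu> u. s)"
  using spectral_measure_H(2) by (auto simp: has_spectral_integral_def inner_L2_def)

lemma \<nu>_restrict:
  assumes A: "A \<in> sets borel" shows "AE s in E.\<nu> (\<E> A u). s \<in> A"
proof -
  have "emeasure (E.\<nu> (\<E> A u)) (- A) = 0"
  proof -
    have "\<E> (- A) (\<E> A u) = 0" using E.E_inter[of "- A" A u] A by (simp add: E.E_empty)
    moreover have "- A \<in> sets borel" using A by auto
    ultimately show ?thesis by (simp add: E.emeasure_\<nu>)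
  qed
  then show ?thesis using A by (intro AE_I[of _ _ "- A"]) auto
qed

lemma integrable_bounded_restrict:
  assumes A: "A \<in> sets borel" "\<And>s. s \<in> A \<Longrightarrow> \<bar>s\<bar> \<le> d"
  shows "integrable (E.\<nu> (\<E> A u)) (\<lambda>s. s)" "\<E> A u \<in> sobolev 2"
proof -
  interpret finite_measure "E.\<nu> (\<E> A u)" by (rule E.finite_measure_\<nu>)
  show "integrable (E.\<nu> (\<E> A u)) (\<lambda>s. s)"
  proof (rule integrable_const_bound[where B = d])
    show "AE s in E.\<nu> (\<E> A u). norm s \<le> d" using \<nu>_restrict[OF A(1), of u] by eventually_elim (simp add: A(2))
  qed measurable
  show "\<E> A u \<in> sobolev 2"
    unfolding domain_iff
  proof (rule integrable_const_bound[where B = "d\<^sup>2"])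
    show "AE s in E.\<nu> (\<E> A u). norm (s\<^sup>2) \<le> d\<^sup>2"
      using \<nu>_restrict[OF A(1), of u]
    proof eventually_elim
      case (elim s)
      have "\<bar>s\<bar>\<^sup>2 \<le> d\<^sup>2" using A(2)[OF elim] by (intro power_mono) auto
      then show ?case by simp
    qed
  qed measurable
qed

text \<open>On the range of \<open>E\<close> for a bounded interval to the right of \<open>- m + 1 / (n + 1)\<close> the form is at least
\<open>- m + 1 / (n + 1)\<close> times the squared norm, which contradicts the gap unless the range is 0.\<close>

lemma form_gap_imp_spectral_gap:
  assumes gap: "\<And>u. u \<in> sobolev 2 \<Longrightarrow> inner u (H u) \<le> - m * (norm u)\<^sup>2"
  shows "AE s in E.\<nu> u. s \<le> - m"
proof -
  define A where "A n = {- m + 1 / real (Suc n) .. real n}" for n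
  have A: "A n \<in> sets borel" for n by (simp add: A_def)
  have "\<E> (A n) u = 0" for n
  proof -
    let ?w = "\<E> (A n) u"
    interpret finite_measure "E.\<nu> ?w" by (rule E.finite_measure_\<nu>)
    have b: "\<bar>s\<bar> \<le> \<bar>m\<bar> + real n + 1" if "s \<in> A n" for s
    proof -
      have "- m \<le> s" "s \<le> real n" using that by (auto simp: A_def intro: order_trans[rotated])
      then show ?thesis by linarith
    qed
    note i = integrable_bounded_restrict[OF A b, of n u]
    have "(- m + 1 / real (Suc n)) * (norm ?w)\<^sup>2 = (LINT s|E.\<nu> ?w. - m + 1 / real (Suc n))"
      by (simp add: E.space_\<nu> E.measure_\<nu>_UNIV)
    also have "\<dots> \<le> (LINT s|E.\<nu> ?w. s)"
    proof (rule integral_mono_AE[OF integrable_const i(1)])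
      show "AE s in E.\<nu> ?w. - m + 1 / real (Suc n) \<le> s"
        using \<nu>_restrict[OF A, of n u] by eventually_elim (simp add: A_def)
    qed
    also have "\<dots> \<le> - m * (norm ?w)\<^sup>2" using gap[OF i(2)] H_form_integral[OF i(2)] by simp
    finally have "(1 / real (Suc n)) * (norm ?w)\<^sup>2 \<le> 0" by (simp add: algebra_simps)
    moreover have "0 < 1 / real (Suc n)" by simp
    ultimately have "(norm ?w)\<^sup>2 \<le> 0" by (metis mult_le_cancel_left_pos mult_zero_right)
    then show ?thesis by simp
  qed
  then have "emeasure (E.\<nu> u) (A n) = 0" for n by (simp add: E.emeasure_\<nu>[OF A])
  then have n: "(\<Union>n. A n) \<in> null_sets (E.\<nu> u)" by (intro null_sets_UN) (auto simp: A intro!: null_setsI)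
  show ?thesis
  proof (rule AE_I'[OF n])
    show "{s \<in> space (E.\<nu> u). \<not> s \<le> - m} \<subseteq> (\<Union>n. A n)"
    proof
      fix s assume "s \<in> {s \<in> space (E.\<nu> u). \<not> s \<le> - m}"
      then have s: "s + m > 0" by simp
      obtain k :: nat where k: "1 / (s + m) < real k" using reals_Archimedean2 by blast
      obtain l :: nat where l: "s < real l" using reals_Archimedean2 by blast
      have "1 / real (Suc (max k l)) \<le> s + m"
      proof -
        have "1 / (s + m) < real (Suc (max k l))" using k by linarith
        then have "1 < real (Suc (max k l)) * (s + m)" using s by (simp add: pos_divide_less_eq)
        then show ?thesis by (simp add: divide_le_eq mult.commute)
      qed
      then have "s \<in> A (max k l)" using l by (simp add: A_def)
      then show "s \<in> (\<Union>n. A n)" by blast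
    qed
  qed
qed

lemma AE_nonpos: "AE s in E.\<nu> u. s \<le> 0"
  using form_gap_imp_spectral_gap[of 0 u] H_nonpos by simp

text \<open>The projection of \<open>u\<close> at 0 lies in the domain and has vanishing form, hence is 0.\<close>

lemma AE_spectrum_nonzero: "AE s in E.\<nu> u. s \<noteq> 0"
proof -
  let ?w = "\<E> {0} u"
  have i: "?w \<in> sobolev 2" by (rule integrable_bounded_restrict[of "{0}" 0]) auto
  have "AE s in E.\<nu> ?w. s = 0" using \<nu>_restrict[of "{0}" u] by simp
  then have "(LINT s|E.\<nu> ?w. s) = 0" by (rule integral_eq_zero_AE)
  then have "?w = 0" using H_form_zero_imp_zero[OF i] H_form_integral[OF i] by simp
  then have "emeasure (E.\<nu> u) {0} = 0" by (simp add: E.emeasure_\<nu>)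
  then show ?thesis by (intro AE_I[of _ _ "{0}"]) auto
qed

abbreviation "T \<equiv> schroedinger_semigroup V"

text \<open>The semigroup is a choice among the operators with a prescribed form. By polarization there is only one,
namely twice the dyadic operator of \<open>h = exp (t s) / 2\<close>. The factor 1/2 keeps \<open>h\<close> below 1 at \<open>s = 0\<close>, and
cutting \<open>h\<close> off for positive \<open>s\<close> changes nothing, because the spectrum is nonpositive.\<close>

lemma semigroup_bounded_and_norm:
  assumes t: "0 \<le> t"
  shows "bounded_linear (T t)" "(norm (T t u))\<^sup>2 = (LINT s|E.\<nu> u. (exp (t * s))\<^sup>2)"
proof -
  define h where "h s = (if s \<le> 0 then exp (t * s) / 2 else 0)" for s
  have h: "h \<in> borel_measurable borel" unfolding h_def by measurable
  have h01: "0 \<le> h s" "h s < 1" for s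
  proof -
    have e: "exp (t * s) \<le> 1" if "s \<le> 0" using t that by (simp add: mult_nonneg_nonpos)
    have "exp (t * s) / 2 < 1" if "s \<le> 0" using e[OF that] by linarith
    then show "0 \<le> h s" "h s < 1" unfolding h_def by simp_all
  qed
  let ?A = "\<lambda>u. scaleC 2 (E.dyadic_op h u)"
  have int: "integrable (E.\<nu> u) (\<lambda>s. exp (t * s) ^ k)" for u k
  proof -
    interpret finite_measure "E.\<nu> u" by (rule E.finite_measure_\<nu>)
    show ?thesis
    proof (rule integrable_const_bound[where B = 1])
      show "AE s in E.\<nu> u. norm (exp (t * s) ^ k) \<le> 1"
        using AE_nonpos[of u] by eventually_elim (use t in \<open>auto intro!: power_le_one simp: mult_nonneg_nonpos\<close>)
    qed measurable
  qed
  have dom: "spectral_integral_domain \<E> (\<lambda>s. exp (t * s)) = UNIV"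
    unfolding spectral_integral_domain_def using int[where k = 2] by simp
  have linA: "linear_operator_on UNIV ?A"
    unfolding linear_operator_on_def
    by (auto simp: E.dyadic_add[OF h h01] E.dyadic_scaleC[OF h h01] scaleC_add_right scaleC_scaleC mult.commute)
  have formA: "cinner u (?A u) = complex_of_real (LINT s|E.\<nu> u. exp (t * s))" for u
  proof -
    have "(LINT s|E.\<nu> u. exp (t * s)) = (LINT s|E.\<nu> u. 2 * h s)"
    proof (rule integral_cong_AE)
      show "AE s in E.\<nu> u. exp (t * s) = 2 * h s" using AE_nonpos[of u] by eventually_elim (simp add: h_def)
    qed (use h in measurable)
    also have "\<dots> = 2 * inner u (E.dyadic_op h u)" by (simp add: E.inner_dyadic[OF h h01])
    finally show ?thesis
      unfolding cinner_scaleC_right cinner_eq[of u "E.dyadic_op h u"] E.inner_dyadic_J[OF h h01] by simp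
  qed
  have A: "has_spectral_integral \<E> (\<lambda>s. exp (t * s)) UNIV ?A"
    unfolding has_spectral_integral_def dom using linA formA by simp
  have "has_spectral_integral \<E> (\<lambda>s. exp (t * s)) UNIV (T t)"
    unfolding schroedinger_semigroup_def exp_semigroup_def functional_calculus_def Let_def dom
    by (rule someI[where P = "has_spectral_integral \<E> (\<lambda>s. exp (t * s)) UNIV", OF A])
  then have "T t = ?A"
    using linA formA by (intro linear_operator_eq_if_form_eq) (auto simp: has_spectral_integral_def)
  then have TA: "T t u = 2 *\<^sub>R E.dyadic_op h u" for u
    using scaleC_of_real[of 2 "E.dyadic_op h u"] by simp
  show norm_T: "(norm (T t u))\<^sup>2 = (LINT s|E.\<nu> u. (exp (t * s))\<^sup>2)" for u
  proof -
    have "(norm (T t u))\<^sup>2 = (LINT s|E.\<nu> u. 4 * (h s)\<^sup>2)"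
      unfolding TA by (simp add: power_mult_distrib E.norm_dyadic[OF h h01])
    also have "\<dots> = (LINT s|E.\<nu> u. (exp (t * s))\<^sup>2)"
    proof (rule integral_cong_AE)
      show "AE s in E.\<nu> u. 4 * (h s)\<^sup>2 = (exp (t * s))\<^sup>2"
        using AE_nonpos[of u] by eventually_elim (simp add: h_def power_divide)
    qed (use h in measurable)
    finally show ?thesis .
  qed
  show "bounded_linear (T t)"
  proof (rule bounded_linear_intro[where K = 1])
    show "T t (u + v) = T t u + T t v" for u v
      unfolding TA E.dyadic_add[OF h h01] by (rule scaleR_right_distrib)
    show "T t (r *\<^sub>R u) = r *\<^sub>R T t u" for r u
      unfolding TA scaleR_L2_def E.dyadic_scaleC[OF h h01] scaleC_scaleC by (simp only: mult.commute)
    show "norm (T t u) \<le> norm u * 1" for u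
    proof -
      interpret finite_measure "E.\<nu> u" by (rule E.finite_measure_\<nu>)
      have "(norm (T t u))\<^sup>2 \<le> (LINT s|E.\<nu> u. 1)"
        unfolding norm_T
      proof (rule integral_mono_AE[OF int])
        show "AE s in E.\<nu> u. (exp (t * s))\<^sup>2 \<le> 1"
          using AE_nonpos[of u] by eventually_elim (use t in \<open>auto intro!: power_le_one simp: mult_nonneg_nonpos\<close>)
      qed simp
      also have "\<dots> = (norm u * 1)\<^sup>2" by (simp add: E.space_\<nu> E.measure_\<nu>_UNIV)
      finally show ?thesis by (rule power2_le_imp_le) simp
    qed
  qed
qed

lemma semigroup_stable: "stable_semigroup T"
  unfolding stable_semigroup_def
proof
  fix u
  interpret finite_measure "E.\<nu> u" by (rule E.finite_measure_\<nu>)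
  have "((\<lambda>t. LINT s|E.\<nu> u. (exp (t * s))\<^sup>2) \<longlongrightarrow> (LINT s|E.\<nu> u. 0)) at_top"
  proof (rule integral_dominated_convergence_at_top[where w = "\<lambda>s. 1"])
    show "\<forall>\<^sub>F t in at_top. AE s in E.\<nu> u. norm ((exp (t * s))\<^sup>2) \<le> (1::real)"
      using eventually_ge_at_top[of 0]
    proof eventually_elim
      case (elim t)
      show ?case
        using AE_nonpos[of u] by eventually_elim (use elim in \<open>auto intro!: power_le_one simp: mult_nonneg_nonpos\<close>)
    qed
    show "AE s in E.\<nu> u. ((\<lambda>t. (exp (t * s))\<^sup>2) \<longlongrightarrow> 0) at_top"
      using AE_nonpos[of u] AE_spectrum_nonzero[of u]
    proof eventually_elim
      case (elim s)
      then have "filterlim (\<lambda>t. t * s) at_bot at_top"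
      proof -
        have "filterlim (\<lambda>t. s * t) at_bot at_top"
          by (rule filterlim_tendsto_neg_mult_at_bot[OF tendsto_const _ filterlim_ident]) (use elim in simp)
        then show ?thesis by (simp only: mult.commute)
      qed
      then have "((\<lambda>t. exp (t * s)) \<longlongrightarrow> 0) at_top" by (rule filterlim_compose[OF exp_at_bot])
      then show ?case by (intro tendsto_null_power) simp_all
    qed
  qed measurable
  then have "((\<lambda>t. LINT s|E.\<nu> u. (exp (t * s))\<^sup>2) \<longlongrightarrow> 0) at_top" by simp
  then have "((\<lambda>t. (norm (T t u))\<^sup>2) \<longlongrightarrow> 0) at_top"
  proof (rule Lim_transform_eventually)
    show "\<forall>\<^sub>F t in at_top. (LINT s|E.\<nu> u. (exp (t * s))\<^sup>2) = (norm (T t u))\<^sup>2"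
      using eventually_ge_at_top[of "0::real"] by eventually_elim (rule semigroup_bounded_and_norm(2)[symmetric])
  qed
  then have "((\<lambda>t. sqrt ((norm (T t u))\<^sup>2)) \<longlongrightarrow> sqrt 0) at_top" by (rule tendsto_real_sqrt)
  then show "((\<lambda>t. norm (T t u)) \<longlongrightarrow> 0) at_top" by simp
qed

text \<open>If the semigroup decays at rate \<open>c\<close>, the mass of \<open>\<nu>\<^sub>u\<close> on \<open>s > - c / 2\<close> is at most a constant times
\<open>exp (- c t)\<close> for all \<open>t\<close>, hence 0, and the form has the gap \<open>c / 2\<close>. The converse bounds the
exponential on the support of \<open>\<nu>\<^sub>u\<close>.\<close>

lemma exponentially_stable_iff:
  "exponentially_stable_semigroup T \<longleftrightarrow> (\<exists>c>0. \<forall>u\<in>sobolev 2. inner u (H u) \<le> - c * (norm u)\<^sup>2)"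
proof
  assume "exponentially_stable_semigroup T"
  then obtain C c where C: "C > 0" "c > 0" "\<And>t. t \<ge> 0 \<Longrightarrow> onorm (T t) \<le> C * exp (- t * c)"
    unfolding exponentially_stable_semigroup_def by blast
  have "inner u (H u) \<le> - (c / 2) * (norm u)\<^sup>2" if u: "u \<in> sobolev 2" for u
  proof -
    interpret finite_measure "E.\<nu> u" by (rule E.finite_measure_\<nu>)
    let ?A = "{- (c / 2) <..}"
    have "measure (E.\<nu> u) ?A \<le> (C * norm u)\<^sup>2 * exp (- (c * real n))" for n
    proof -
      let ?t = "real n"
      have int: "integrable (E.\<nu> u) (\<lambda>s. (exp (?t * s))\<^sup>2)"
      proof (rule integrable_const_bound[where B = 1])
        show "AE s in E.\<nu> u. norm ((exp (?t * s))\<^sup>2) \<le> 1"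
          using AE_nonpos[of u] by eventually_elim (auto intro!: power_le_one simp: mult_nonneg_nonpos)
      qed measurable
      have iA: "integrable (E.\<nu> u) (\<lambda>s. exp (- (c * ?t)) * indicator ?A s)"
        by (intro integrable_mult_right integrable_real_indicator) (simp_all add: emeasure_eq_measure)
      have "exp (- (c * ?t)) * measure (E.\<nu> u) ?A = (LINT s|E.\<nu> u. exp (- (c * ?t)) * indicator ?A s)"
        by simp
      also have "\<dots> \<le> (LINT s|E.\<nu> u. (exp (?t * s))\<^sup>2)"
      proof (rule integral_mono[OF iA int])
        show "exp (- (c * ?t)) * indicator ?A s \<le> (exp (?t * s))\<^sup>2" for s
        proof (cases "s \<in> ?A")
          case True
          then have "?t * (- (c / 2)) \<le> ?t * s" by (intro mult_left_mono) auto
          then have "- (c * ?t) \<le> ?t * s + ?t * s" by (simp add: algebra_simps)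
          then show ?thesis using True by (simp add: power2_eq_square exp_add[symmetric])
        qed simp
      qed
      also have "\<dots> = (norm (T ?t u))\<^sup>2" by (rule semigroup_bounded_and_norm(2)[symmetric]) simp
      also have "\<dots> \<le> (C * exp (- ?t * c) * norm u)\<^sup>2"
      proof (rule power_mono)
        have "norm (T ?t u) \<le> onorm (T ?t) * norm u" by (rule onorm[OF semigroup_bounded_and_norm(1)]) simp
        also have "\<dots> \<le> C * exp (- ?t * c) * norm u" by (intro mult_right_mono C(3)) auto
        finally show "norm (T ?t u) \<le> C * exp (- ?t * c) * norm u" .
      qed simp
      also have "\<dots> = exp (- (c * ?t)) * ((C * norm u)\<^sup>2 * exp (- (c * ?t)))"
        by (simp add: power2_eq_square mult_ac)
      finally show ?thesis by (simp add: mult_le_cancel_left_pos)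
    qed
    moreover have "(\<lambda>n. (C * norm u)\<^sup>2 * exp (- (c * real n))) \<longlonglongrightarrow> 0"
    proof -
      have "(\<lambda>n. exp (- c) ^ n) \<longlonglongrightarrow> 0" using C(2) by (intro LIMSEQ_power_zero) simp
      then have "(\<lambda>n. exp (- (c * real n))) \<longlonglongrightarrow> 0" by (simp add: exp_of_nat_mult[symmetric] mult.commute)
      then show ?thesis by (rule tendsto_mult_right_zero)
    qed
    ultimately have "measure (E.\<nu> u) ?A \<le> 0" by (intro LIMSEQ_le_const) auto
    then have "emeasure (E.\<nu> u) ?A = 0" by (simp add: emeasure_eq_measure measure_le_0_iff)
    then have ae: "AE s in E.\<nu> u. s \<le> - (c / 2)" by (intro AE_I[of _ _ ?A]) auto
    have i: "integrable (E.\<nu> u) (\<lambda>s. s)"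
    proof (rule Bochner_Integration.integrable_bound)
      show "integrable (E.\<nu> u) (\<lambda>s. 1 + s\<^sup>2)" using u by (simp add: domain_iff)
      have "\<bar>s\<bar> \<le> 1 + s\<^sup>2" for s :: real using sum_squares_bound[of 1 "\<bar>s\<bar>"] by simp
      then show "AE s in E.\<nu> u. norm s \<le> norm (1 + s\<^sup>2)" by simp
    qed measurable
    have "(LINT s|E.\<nu> u. s) \<le> (LINT s|E.\<nu> u. - (c / 2))" by (rule integral_mono_AE[OF i _ ae]) simp
    then show ?thesis by (simp add: H_form_integral[OF u] E.space_\<nu> E.measure_\<nu>_UNIV mult.commute)
  qed
  then show "\<exists>c>0. \<forall>u\<in>sobolev 2. inner u (H u) \<le> - c * (norm u)\<^sup>2"
    using C(2) by (intro exI[of _ "c / 2"]) auto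
next
  assume "\<exists>c>0. \<forall>u\<in>sobolev 2. inner u (H u) \<le> - c * (norm u)\<^sup>2"
  then obtain c where c: "c > 0" "\<And>u. u \<in> sobolev 2 \<Longrightarrow> inner u (H u) \<le> - c * (norm u)\<^sup>2" by blast
  have "onorm (T t) \<le> 1 * exp (- t * c)" if t: "t \<ge> 0" for t
  proof (rule onorm_bound)
    show "0 \<le> 1 * exp (- t * c)" by simp
    fix u
    interpret finite_measure "E.\<nu> u" by (rule E.finite_measure_\<nu>)
    have ae: "AE s in E.\<nu> u. s \<le> - c" by (rule form_gap_imp_spectral_gap) (rule c(2))
    have "(norm (T t u))\<^sup>2 \<le> (LINT s|E.\<nu> u. (exp (- t * c))\<^sup>2)"
      unfolding semigroup_bounded_and_norm(2)[OF t]
    proof (rule integral_mono_AE')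
      show "AE s in E.\<nu> u. (exp (t * s))\<^sup>2 \<le> (exp (- t * c))\<^sup>2"
        using ae
      proof eventually_elim
        case (elim s)
        then have "t * s \<le> t * (- c)" using t by (intro mult_left_mono) auto
        then have "exp (t * s) \<le> exp (- t * c)" by simp
        then show ?case by (intro power_mono) auto
      qed
    qed auto
    also have "\<dots> = (1 * exp (- t * c) * norm u)\<^sup>2"
      by (simp add: E.space_\<nu> E.measure_\<nu>_UNIV power_mult_distrib)
    finally show "norm (T t u) \<le> 1 * exp (- t * c) * norm u" by (rule power2_le_imp_le) simp
  qed
  then show "exponentially_stable_semigroup T"
    unfolding exponentially_stable_semigroup_def using c(1) semigroup_bounded_and_norm(1)
    by (intro exI[of _ 1] exI[of _ c] conjI allI impI) auto
qed

end

section \<open>The topology of the space of potentials\<close>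

text \<open>If the distance is smaller than \<open>2\<^sup>-\<^sup>j\<close>, then the minimum in the \<open>j\<close>-th term of the series is attained
by the supremum over the ball of radius \<open>j\<close>.\<close>

lemma potential_dist_pointwise:
  assumes x: "norm x < real j" and d: "potential_dist V U < (1/2) ^ j"
  shows "\<bar>V x - U x\<bar> \<le> potential_dist V U"
proof -
  let ?t = "\<lambda>j. enn2real (min (ennreal ((1 / 2) ^ j)) (local_sup_dist j V U))"
  have "(\<Sum>i\<in>{j}. ?t i) \<le> (\<Sum>i. ?t i)"
    by (rule sum_le_suminf[OF summable_potential_dist]) auto
  then have t: "?t j \<le> potential_dist V U" by (simp add: potential_dist_def)
  have L: "ennreal \<bar>V x - U x\<bar> \<le> local_sup_dist j V U"
    unfolding local_sup_dist_def using x by (intro SUP_upper) auto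
  have fin: "min (ennreal ((1 / 2) ^ j)) (local_sup_dist j V U) < top" by (simp add: min_less_iff_disj)
  have eq: "ennreal (?t j) = min (ennreal ((1 / 2) ^ j)) (local_sup_dist j V U)"
    using fin by (rule ennreal_enn2real)
  have "ennreal (?t j) < ennreal ((1 / 2) ^ j)"
    using t d by (intro ennreal_lessI) auto
  then have "ennreal (?t j) = local_sup_dist j V U" unfolding eq by (auto simp: min_def split: if_splits)
  then have "ennreal \<bar>V x - U x\<bar> \<le> ennreal (?t j)" using L by simp
  then have "\<bar>V x - U x\<bar> \<le> ?t j" by (subst (asm) ennreal_le_iff) auto
  then show ?thesis using t by linarith
qed

lemma potential_dist_tendsto_pointwise:
  assumes "(\<lambda>k. potential_dist V (U k)) \<longlonglongrightarrow> 0"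
  shows "(\<lambda>k. U k x) \<longlonglongrightarrow> V x"
proof -
  obtain j :: nat where j: "norm x < real j" using reals_Archimedean2 by blast
  have "\<forall>\<^sub>F k in sequentially. potential_dist V (U k) < (1/2) ^ j"
    by (rule order_tendstoD(2)[OF assms]) simp
  then have "\<forall>\<^sub>F k in sequentially. norm (U k x - V x) \<le> potential_dist V (U k)"
    by eventually_elim (use potential_dist_pointwise[OF j] in \<open>simp add: abs_minus_commute\<close>)
  then have "(\<lambda>k. U k x - V x) \<longlonglongrightarrow> 0" by (rule Lim_null_comparison[OF _ assms])
  then show ?thesis by (simp add: LIM_zero_iff)
qed

text \<open>The terms up to \<open>N\<close> vanish, because both functions agree on the ball of radius \<open>N\<close>.\<close>

lemma potential_dist_truncation:
  fixes V :: "real ^ 'n::finite \<Rightarrow> real"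
  shows "potential_dist V (\<lambda>x. if norm x < real N then V x else 0) \<le> 2 * (1/2) ^ N"
proof -
  let ?U = "\<lambda>x. if norm x < real N then V x else 0"
  let ?t = "\<lambda>j. enn2real (min (ennreal ((1 / 2) ^ j)) (local_sup_dist j V ?U))"
  have z: "?t j = 0" if "j \<le> N" for j
  proof -
    have "local_sup_dist j V ?U \<le> 0"
      unfolding local_sup_dist_def
    proof (rule SUP_least)
      fix x :: "real ^ 'n" assume "x \<in> ball 0 (real j)"
      then have "norm x < real N" using that by simp
      then show "ennreal \<bar>V x - ?U x\<bar> \<le> 0" by simp
    qed
    then show ?thesis by simp
  qed
  have "(\<Sum>j. ?t j) = (\<Sum>j. ?t (j + N)) + (\<Sum>j<N. ?t j)"
    by (rule suminf_split_initial_segment[OF summable_potential_dist])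
  also have "(\<Sum>j<N. ?t j) = 0" using z by (intro sum.neutral) auto
  also have "(\<Sum>j. ?t (j + N)) \<le> (\<Sum>j. (1/2) ^ N * (1/2) ^ j)"
  proof (rule suminf_le)
    show "?t (j + N) \<le> (1/2) ^ N * (1/2) ^ j" for j
      using potential_dist_term(2)[of "j + N" "local_sup_dist (j + N) V ?U"] by (simp only: power_add mult.commute)
    show "summable (\<lambda>j. ?t (j + N))" using summable_ignore_initial_segment[OF summable_potential_dist] .
    show "summable (\<lambda>j. (1/2::real) ^ N * (1/2) ^ j)" by (intro summable_mult summable_geometric) simp
  qed
  also have "(\<Sum>j. (1/2::real) ^ N * (1/2) ^ j) = (1/2) ^ N * (1 / (1 - 1/2))"
    by (subst suminf_mult) (auto intro!: summable_geometric simp: suminf_geometric)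
  finally show ?thesis by (simp add: potential_dist_def)
qed

text \<open>The fixed sequence of gaps \<open>1 / (n + 1)\<close> makes the intersection of these sets countable.\<close>

definition gap_fails :: "real \<Rightarrow> nat \<Rightarrow> (real ^ 'n::finite \<Rightarrow> real) set" where
  "gap_fails a n = {V \<in> potentials a. \<exists>u\<in>sobolev 2. inner u (schroedinger V u) > - (1 / real (Suc n)) * (norm u)\<^sup>2}"

lemma stable_not_exponentially_stable_iff:
  assumes V: "V \<in> potentials a"
  shows "stable_semigroup (schroedinger_semigroup V) \<and> \<not> exponentially_stable_semigroup (schroedinger_semigroup V)
    \<longleftrightarrow> (\<forall>n. V \<in> gap_fails a n)"
proof -
  interpret schroedinger_potential V a by unfold_locales (rule V)
  have "exponentially_stable_semigroup (schroedinger_semigroup V) \<longleftrightarrow> (\<exists>n. V \<notin> gap_fails a n)"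
  proof
    assume "exponentially_stable_semigroup (schroedinger_semigroup V)"
    then obtain c where c: "c > 0" "\<And>u. u \<in> sobolev 2 \<Longrightarrow> inner u (H u) \<le> - c * (norm u)\<^sup>2"
      unfolding exponentially_stable_iff by blast
    obtain n :: nat where n: "1 / c < real (Suc n)" using reals_Archimedean2[of "1 / c"] by (metis less_SucI of_nat_less_iff lessI less_trans)
    have nc: "1 / real (Suc n) \<le> c" using n c(1) by (simp add: field_simps)
    have "inner u (H u) \<le> - (1 / real (Suc n)) * (norm u)\<^sup>2" if "u \<in> sobolev 2" for u
    proof -
      have "1 / real (Suc n) * (norm u)\<^sup>2 \<le> c * (norm u)\<^sup>2" by (rule mult_right_mono[OF nc]) simp
      then show ?thesis using c(2)[OF that] by simp
    qed
    then have "V \<notin> gap_fails a n" unfolding gap_fails_def by (auto simp: not_less)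
    then show "\<exists>n. V \<notin> gap_fails a n" ..
  next
    assume "\<exists>n. V \<notin> gap_fails a n"
    then obtain n where "V \<notin> gap_fails a n" ..
    then have "\<forall>u\<in>sobolev 2. inner u (H u) \<le> - (1 / real (Suc n)) * (norm u)\<^sup>2"
      unfolding gap_fails_def using V by (auto simp: not_less)
    then show "exponentially_stable_semigroup (schroedinger_semigroup V)"
      unfolding exponentially_stable_iff by (intro exI[of _ "1 / real (Suc n)"]) auto
  qed
  then show ?thesis using semigroup_stable by blast
qed

text \<open>The gradient term does not depend on the potential, and the potentials are bounded by \<open>a\<close>.\<close>

lemma form_tendsto:
  assumes V: "V \<in> potentials a" and U: "\<And>k. U k \<in> potentials a"
    and lim: "(\<lambda>k. potential_dist V (U k)) \<longlonglongrightarrow> 0" and u: "u \<in> sobolev 2"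
  shows "(\<lambda>k. inner u (schroedinger (U k) u)) \<longlonglongrightarrow> inner u (schroedinger V u)"
proof -
  have q: "inner u (schroedinger W u) = - (\<Sum>i\<in>UNIV. (norm (weak_grad i u))\<^sup>2) + (LINT x|lborel. W x * (cmod (rep_L2 u x))\<^sup>2)"
    if W: "W \<in> potentials a" for W
  proof -
    interpret schroedinger_potential W a by unfold_locales (rule W)
    show ?thesis by (rule H_quadratic[OF u])
  qed
  have [measurable]: "V \<in> borel_measurable borel" "U k \<in> borel_measurable borel" for k
    using V U by (auto simp: potentials_def)
  have "(\<lambda>k. LINT x|lborel. U k x * (cmod (rep_L2 u x))\<^sup>2) \<longlonglongrightarrow> (LINT x|lborel. V x * (cmod (rep_L2 u x))\<^sup>2)"
  proof (rule integral_dominated_convergence[where w = "\<lambda>x. a * (cmod (rep_L2 u x))\<^sup>2"])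
    show "integrable lborel (\<lambda>x. a * (cmod (rep_L2 u x))\<^sup>2)" using integrable_rep_L2 by (rule integrable_mult_right)
    show "AE x in lborel. (\<lambda>k. U k x * (cmod (rep_L2 u x))\<^sup>2) \<longlonglongrightarrow> V x * (cmod (rep_L2 u x))\<^sup>2"
      by (intro AE_I2 tendsto_mult tendsto_const potential_dist_tendsto_pointwise[OF lim])
    show "AE x in lborel. norm (U k x * (cmod (rep_L2 u x))\<^sup>2) \<le> a * (cmod (rep_L2 u x))\<^sup>2" for k
    proof (rule AE_I2)
      fix x
      have "- a \<le> U k x" "U k x \<le> 0" using U[of k] by (auto simp: potentials_def)
      then have "\<bar>U k x\<bar> \<le> a" by linarith
      then have "\<bar>U k x\<bar> * (cmod (rep_L2 u x))\<^sup>2 \<le> a * (cmod (rep_L2 u x))\<^sup>2" by (rule mult_right_mono) simp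
      then show "norm (U k x * (cmod (rep_L2 u x))\<^sup>2) \<le> a * (cmod (rep_L2 u x))\<^sup>2" by (simp add: abs_mult)
    qed
  qed measurable
  then show ?thesis unfolding q[OF V] q[OF U] by (intro tendsto_add tendsto_const)
qed

lemma open_gap_fails: "openin (potential_topology a) (gap_fails a n :: (real ^ 'n::finite \<Rightarrow> real) set)"
proof -
  interpret M: Metric_space "potentials a :: (real ^ 'n \<Rightarrow> real) set" potential_dist
    by (rule Metric_space_potentials)
  have "\<exists>r>0. M.mball V r \<subseteq> gap_fails a n" if V: "V \<in> gap_fails a n" for V
  proof (rule ccontr)
    assume no: "\<not> (\<exists>r>0. M.mball V r \<subseteq> gap_fails a n)"
    obtain u where u: "u \<in> sobolev 2" "inner u (schroedinger V u) > - (1 / real (Suc n)) * (norm u)\<^sup>2"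
      and Vp: "V \<in> potentials a" using V by (auto simp: gap_fails_def)
    have "\<exists>U. U \<in> M.mball V (inverse (real (Suc k))) \<and> U \<notin> gap_fails a n" for k
    proof -
      have "0 < inverse (real (Suc k))" by simp
      then show ?thesis using no by blast
    qed
    then obtain U where U: "\<And>k. U k \<in> M.mball V (inverse (real (Suc k)))" "\<And>k. U k \<notin> gap_fails a n" by metis
    have Up: "U k \<in> potentials a" and Ud: "potential_dist V (U k) < inverse (real (Suc k))" for k
      using U(1)[of k] by (auto simp: M.in_mball)
    have "(\<lambda>k. potential_dist V (U k)) \<longlonglongrightarrow> 0"
      by (rule tendsto_sandwich[OF _ _ tendsto_const LIMSEQ_inverse_real_of_nat])
         (use Ud M.nonneg in \<open>auto intro!: always_eventually less_imp_le\<close>)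
    from form_tendsto[OF Vp Up this u(1)] u(2)
    have "\<forall>\<^sub>F k in sequentially. - (1 / real (Suc n)) * (norm u)\<^sup>2 < inner u (schroedinger (U k) u)"
      by (rule order_tendstoD)
    then obtain k where "- (1 / real (Suc n)) * (norm u)\<^sup>2 < inner u (schroedinger (U k) u)"
      unfolding eventually_sequentially by blast
    then have "U k \<in> gap_fails a n" unfolding gap_fails_def using Up u(1) by blast
    then show False using U(2) by blast
  qed
  then show ?thesis
    unfolding potential_topology_def M.openin_mtopology by (auto simp: gap_fails_def)
qed

section \<open>Spreading test functions\<close>

definition spread_factor :: "real \<Rightarrow> real \<Rightarrow> real" where
  "spread_factor L t = flat_exp 1 (inverse L * (t - L)) * flat_exp 1 (inverse L * (2 * L - t))"

text \<open>A bump on the cube with edges from \<open>L\<close> to \<open>2 L\<close>, the dilation by \<open>L\<close> of a fixed function. As \<open>L\<close> grows it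
spreads out and leaves every ball, so no separate translation is needed.\<close>

definition spread_bump :: "real \<Rightarrow> real ^ 'n::finite \<Rightarrow> complex" where
  "spread_bump L = coord_product (\<lambda>i. spread_factor L)"

lemma test_function_spread_bump: "L > 0 \<Longrightarrow> test_function (spread_bump L)"
  unfolding spread_bump_def
  by (rule test_function_coord_product[of "inverse L" "\<chi> i. L" "\<chi> i. 2 * L"])
     (auto simp: spread_factor_def[abs_def] intro: bump_class.base)

lemma spread_factor_scale: "L > 0 \<Longrightarrow> spread_factor L t = spread_factor 1 (t / L)"
proof -
  assume L: "L > 0"
  have "inverse L * (t - L) = t / L - 1" "inverse L * (2 * L - t) = 2 - t / L"
    using L by (auto simp: field_simps)
  then show ?thesis by (simp add: spread_factor_def)
qed

lemma spread_bump_scale: "L > 0 \<Longrightarrow> spread_bump L x = spread_bump 1 ((1 / L) *\<^sub>R x)"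
  by (simp add: spread_bump_def coord_product_def spread_factor_scale[of L])

lemma spread_factor_outside: "L > 0 \<Longrightarrow> t \<le> L \<Longrightarrow> spread_factor L t = 0"
  by (simp add: spread_factor_def flat_exp_def zero_less_mult_iff)

lemma spread_bump_outside:
  fixes x :: "real ^ 'n::finite"
  assumes L: "L > 0" and x: "norm x \<le> L"
  shows "spread_bump L x = 0"
proof -
  obtain i :: 'n where True by blast
  have "x $ i \<le> L" using component_le_norm_cart[of x i] x by linarith
  then have "(\<Prod>i\<in>UNIV. spread_factor L (x $ i)) = 0"
    using spread_factor_outside[OF L] by (intro prod_zero) auto
  then show ?thesis by (simp add: spread_bump_def coord_product_def)
qed

lemma partial_deriv_spread_bump:
  fixes x :: "real ^ 'n::finite"
  assumes L: "L > 0"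
  shows "partial_deriv i (spread_bump L) x = complex_of_real (1 / L) * partial_deriv i (spread_bump 1) ((1 / L) *\<^sub>R x)"
proof -
  have eq: "spread_bump L = spread_bump 1 \<circ> (\<lambda>x :: real ^ 'n. (1 / L) *\<^sub>R x)"
    using spread_bump_scale[OF L] by (auto simp: fun_eq_iff)
  have d: "spread_bump 1 differentiable at ((1 / L) *\<^sub>R x)"
    using test_function_differentiable[OF test_function_spread_bump[of 1], of "[]"] by simp
  have "((\<lambda>x. (1 / L) *\<^sub>R x) has_derivative (\<lambda>x. (1 / L) *\<^sub>R x)) (at x)"
    by (intro bounded_linear_imp_has_derivative bounded_linear_scaleR_right)
  from diff_chain_at[OF this d[unfolded frechet_derivative_works]]
  have "(spread_bump L has_derivative frechet_derivative (spread_bump 1) (at ((1 / L) *\<^sub>R x)) \<circ> (\<lambda>x. (1 / L) *\<^sub>R x)) (at x)"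
    unfolding eq .
  from partial_derivI[OF this]
  have "partial_deriv i (spread_bump L) x = (1 / L) *\<^sub>R partial_deriv i (spread_bump 1) ((1 / L) *\<^sub>R x)"
    by (simp only: comp_apply partial_deriv_def[of i "spread_bump 1"] linear_scale[OF linear_frechet_derivative[OF d]])
  then show ?thesis by (simp only: scaleR_conv_of_real[where 'a = complex])
qed

lemma integral_dilation:
  fixes f :: "real ^ 'n::finite \<Rightarrow> real"
  assumes L: "L > 0" and f [measurable]: "f \<in> borel_measurable borel"
  shows "(LINT x|lborel. f ((1 / L) *\<^sub>R x)) = L ^ DIM(real ^ 'n) * (LINT x|lborel. f x)"
proof -
  have "(LINT x|lborel. f ((1 / L) *\<^sub>R x)) = (LINT x|density (distr lborel borel (\<lambda>x. 0 + L *\<^sub>R x)) (\<lambda>_. \<bar>L\<bar> ^ DIM(real ^ 'n)). f ((1 / L) *\<^sub>R x))"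
    using lborel_affine[of L "0 :: real ^ 'n"] L by simp
  also have "\<dots> = (LINT x|distr lborel borel (\<lambda>x. 0 + L *\<^sub>R x). \<bar>L\<bar> ^ DIM(real ^ 'n) *\<^sub>R f ((1 / L) *\<^sub>R x))"
    by (rule integral_density) auto
  also have "\<dots> = (LINT x|lborel. \<bar>L\<bar> ^ DIM(real ^ 'n) *\<^sub>R f ((1 / L) *\<^sub>R (0 + L *\<^sub>R x)))"
    by (rule integral_distr) auto
  finally show ?thesis using L by simp
qed

lemma norm_spread_bump_pos: "0 < (norm (abs_L2 (spread_bump 1 :: real ^ 'n::finite \<Rightarrow> complex)))\<^sup>2"
proof (rule ccontr)
  let ?f = "spread_bump 1 :: real ^ 'n \<Rightarrow> complex"
  have sq: "square_integrable ?f" by (rule sq_test[OF test_function_spread_bump]) simp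
  assume "\<not> 0 < (norm (abs_L2 ?f))\<^sup>2"
  then have "abs_L2 ?f = abs_L2 (\<lambda>x. 0)" by (simp add: zero_L2_def)
  then have ae: "AE x in lborel. ?f x = 0" using abs_L2_eq_iff[OF sq square_integrable_zero] by blast
  let ?B = "box (\<chi> i. 1) (\<chi> i. 2) :: (real ^ 'n) set"
  have nz: "?f x \<noteq> 0" if "x \<in> ?B" for x
    using that by (auto simp: spread_bump_def coord_product_def mem_box_cart spread_factor_def flat_exp_def)
  have "AE x in lborel. x \<notin> ?B" using ae by eventually_elim (use nz in blast)
  then have "emeasure lborel ?B = 0" by (subst (asm) AE_iff_measurable[OF _ refl]) auto
  moreover have "emeasure lborel ?B = (\<Prod>b\<in>Basis. ((\<chi> i. 2) - (\<chi> i. 1) :: real ^ 'n) \<bullet> b)"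
    by (rule emeasure_lborel_box) (auto simp: Basis_vec_def inner_axis)
  moreover have "((\<chi> i. 2) - (\<chi> i. 1) :: real ^ 'n) \<bullet> b = 1" if "b \<in> Basis" for b
    using that by (auto simp: Basis_vec_def inner_axis)
  ultimately show False by simp
qed

text \<open>For \<open>L \<ge> N\<close> the spread bump does not meet the support of the truncated potential. The squared norm of its
gradient is \<open>L\<^sup>-\<^sup>2 D / A\<close> times its squared norm, where \<open>A\<close> and \<open>D\<close> are the squared norms of the bump for
\<open>L = 1\<close> and of its gradient.\<close>

lemma truncated_in_gap_fails:
  fixes V :: "real ^ 'n::finite \<Rightarrow> real"
  assumes V: "V \<in> potentials a"
  shows "(\<lambda>x. if norm x < real N then V x else 0) \<in> gap_fails a n"
proof -
  let ?U = "\<lambda>x. if norm x < real N then V x else 0"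
  have [measurable]: "V \<in> borel_measurable borel" using V by (simp add: potentials_def)
  have a0: "0 \<le> a" using V unfolding potentials_def by (auto dest!: spec[of _ 0])
  have Up: "?U \<in> potentials a" using V a0 unfolding potentials_def by auto
  interpret schroedinger_potential ?U a by unfold_locales (rule Up)
  let ?f = "\<lambda>L. spread_bump L :: real ^ 'n \<Rightarrow> complex"
  define A where "A = (norm (abs_L2 (?f 1)))\<^sup>2"
  define D where "D = (\<Sum>i\<in>UNIV. (norm (abs_L2 (partial_deriv i (?f 1))))\<^sup>2)"
  have A: "A > 0" unfolding A_def by (rule norm_spread_bump_pos)
  have D: "D \<ge> 0" unfolding D_def by (intro sum_nonneg) simp
  \<comment> \<open>large enough that \<open>L\<^sup>-\<^sup>2 D / A < 1 / (n + 1)\<close>, and at least \<open>N\<close> so that the supports are disjoint\<close>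
  define L where "L = real N + 1 + real (Suc n) * D / A"
  have L1: "L \<ge> 1" "L \<ge> real N" using A D by (auto simp: L_def)
  then have L: "L > 0" by linarith
  have tf: "test_function (?f L)" "test_function (?f 1)"     by (rule test_function_spread_bump[OF L], rule test_function_spread_bump[OF zero_less_one])
  define u where "u = abs_L2 (?f L)"
  let ?d = "DIM(real ^ 'n)"
  have u1: "u \<in> sobolev1" unfolding u_def by (rule test_in_sobolev1[OF tf(1)])
  have weak_grad: "weak_grad i u = abs_L2 (partial_deriv i (?f L))" for i
    unfolding u_def by (rule weak_grad_eq[OF weak_partial_test[OF tf(1)]])
  have u2: "u \<in> sobolev 2"
    unfolding sobolev_2_iff weak_grad using u1 test_in_sobolev1[OF test_function_partial_deriv[OF tf(1)]] by blast
  have nu: "(norm u)\<^sup>2 = L ^ ?d * A"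
  proof -
    have "(norm u)\<^sup>2 = (LINT x|lborel. (cmod (?f 1 ((1 / L) *\<^sub>R x)))\<^sup>2)"
      unfolding u_def norm_abs_L2[OF sq_test[OF tf(1)]] spread_bump_scale[OF L] ..
    also have "\<dots> = L ^ ?d * (LINT x|lborel. (cmod (?f 1 x))\<^sup>2)"
      using sq_test[OF tf(2)] by (intro integral_dilation[OF L]) (auto simp: square_integrable_def)
    finally show ?thesis unfolding A_def norm_abs_L2[OF sq_test[OF tf(2)]] .
  qed
  have nd: "(norm (weak_grad i u))\<^sup>2 = L ^ ?d * ((1 / L)\<^sup>2 * (norm (abs_L2 (partial_deriv i (?f 1))))\<^sup>2)" for i
  proof -
    note s = sq_test[OF test_function_partial_deriv[OF tf(1)]] sq_test[OF test_function_partial_deriv[OF tf(2)]]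
    have [measurable]: "partial_deriv i (?f 1) \<in> borel_measurable borel"
      using s(2) by (simp add: square_integrable_def)
    have "(norm (weak_grad i u))\<^sup>2 = (LINT x|lborel. (cmod (partial_deriv i (?f L) x))\<^sup>2)"
      unfolding weak_grad by (rule norm_abs_L2[OF s(1)])
    also have "\<dots> = (LINT x|lborel. (\<lambda>y. (1 / L)\<^sup>2 * (cmod (partial_deriv i (?f 1) y))\<^sup>2) ((1 / L) *\<^sub>R x))"
      unfolding partial_deriv_spread_bump[OF L] using L by (simp add: norm_mult norm_divide power_mult_distrib power_divide)
    also have "\<dots> = L ^ ?d * (LINT x|lborel. (1 / L)\<^sup>2 * (cmod (partial_deriv i (?f 1) x))\<^sup>2)"
      by (intro integral_dilation[OF L]) measurable
    also have "(LINT x|lborel. (1 / L)\<^sup>2 * (cmod (partial_deriv i (?f 1) x))\<^sup>2) = (1 / L)\<^sup>2 * (norm (abs_L2 (partial_deriv i (?f 1))))\<^sup>2"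
      unfolding norm_abs_L2[OF s(2)] by simp
    finally show ?thesis .
  qed
  have "(LINT x|lborel. ?U x * (cmod (rep_L2 u x))\<^sup>2) = 0"
  proof (rule integral_eq_zero_AE)
    show "AE x in lborel. ?U x * (cmod (rep_L2 u x))\<^sup>2 = 0"
      using rep_abs_L2[OF sq_test[OF tf(1)]]
    proof eventually_elim
      case (elim x)
      show ?case
      proof (cases "norm x < real N")
        case True
        then have "?f L x = 0" using L L1 by (intro spread_bump_outside) auto
        then show ?thesis using elim by (simp add: u_def)
      qed simp
    qed
  qed
  then have "inner u (H u) = - (L ^ ?d * (1 / L)\<^sup>2 * D)"
    unfolding H_quadratic[OF u2] nd D_def by (simp add: sum_distrib_left mult.assoc)
  moreover have "L ^ ?d * (1 / L)\<^sup>2 * D < (1 / real (Suc n)) * (L ^ ?d * A)"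
  proof -
    have "real (Suc n) * D / A < L" by (simp add: L_def)
    then have "real (Suc n) * D < A * L" using A by (simp add: divide_less_eq mult.commute)
    also have "\<dots> \<le> A * L * L"
      using mult_left_mono[of 1 L "A * L"] L1(1) L A by simp
    finally have "(1 / L)\<^sup>2 * D < (1 / real (Suc n)) * A" using L by (simp add: field_simps power2_eq_square)
    then have "L ^ ?d * ((1 / L)\<^sup>2 * D) < L ^ ?d * ((1 / real (Suc n)) * A)" using L by (intro mult_strict_left_mono) auto
    then show ?thesis by (simp only: mult_ac)
  qed
  ultimately have "inner u (H u) > - (1 / real (Suc n)) * (norm u)\<^sup>2" by (simp add: nu)
  then show ?thesis unfolding gap_fails_def using Up u2 by blast
qed

theorem theorem1p2:
  fixes a :: real
  assumes "a > 0"
  shows "let S = {V \<in> potentials a :: (real ^ 'n::finite \<Rightarrow> real) set.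
                    stable_semigroup (schroedinger_semigroup V) \<and>
                    \<not> exponentially_stable_semigroup (schroedinger_semigroup V)}
         in gdelta_in (potential_topology a) S \<and>
            potential_topology a closure_of S = potentials a"
proof -
  interpret M: Metric_space "potentials a :: (real ^ 'n \<Rightarrow> real) set" potential_dist
    by (rule Metric_space_potentials)
  define S where "S = {V \<in> potentials a :: (real ^ 'n \<Rightarrow> real) set.
                    stable_semigroup (schroedinger_semigroup V) \<and>
                    \<not> exponentially_stable_semigroup (schroedinger_semigroup V)}"
  have S: "S = (\<Inter>n. gap_fails a n)"
  proof (rule set_eqI)
    fix V :: "real ^ 'n \<Rightarrow> real"
    show "V \<in> S \<longleftrightarrow> V \<in> (\<Inter>n. gap_fails a n)"
    proof (cases "V \<in> potentials a")
      case True
      then show ?thesis unfolding S_def using stable_not_exponentially_stable_iff[OF True] by simp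
    next
      case False
      then show ?thesis unfolding S_def gap_fails_def by simp
    qed
  qed
  have "gdelta_in (potential_topology a) S"
    unfolding S by (rule gdelta_in_Inter) (auto intro: open_imp_gdelta_in open_gap_fails)
  moreover have "potential_topology a closure_of S = potentials a"
    unfolding potential_topology_def M.metric_closure_of
  proof (intro set_eqI iffI CollectI conjI allI impI)
    fix V :: "real ^ 'n \<Rightarrow> real" and r :: real assume V: "V \<in> potentials a" and r: "0 < r"
    obtain N where N: "(1/2) ^ N < r / 2" using real_arch_pow_inv[of "r / 2" "1 / 2"] r by auto
    let ?U = "\<lambda>x. if norm x < real N then V x else 0"
    have "?U \<in> S" unfolding S using truncated_in_gap_fails[OF V] by blast
    moreover have "potential_dist V ?U < r" using potential_dist_truncation[of V N] N by linarith
    ultimately have "?U \<in> S \<and> ?U \<in> M.mball V r" using V by (auto simp: S_def M.in_mball)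
    then show "\<exists>U\<in>S. U \<in> M.mball V r" by blast
  qed auto
  ultimately show ?thesis unfolding S_def Let_def by blast
qed

end
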